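(* Let $\Omega$ be an (infinite) monothetic Cantor group, $\theta\in\Omega$ a topological generator, and $\mathbb{D}=\{z\in\mathbb{C}:|z|<1\}$. For $0<\tau<1$, let $\mathcal{H}^{\mathrm{CMV}}_\tau\subseteq C(\Omega,\mathbb{D})$ be the set of $g\in C(\Omega,\mathbb{D})$ such that $\Sigma^g$ is a $\tau$-homogeneous Cantor set, where $\Sigma^g\subseteq\partial\mathbb{D}$ denotes the common spectrum of the CMV operators $\mathcal{E}_{\alpha^g_\omega}$, $\omega\in\Omega$, with $\alpha^g_\omega(n)=g(n\theta+\omega)$, $n\in\mathbb{Z}$. Then for each $0<\tau<1$, $\mathcal{H}^{\mathrm{CMV}}_\tau$ is dense in $C(\Omega,\mathbb{D})$ with respect to the supremum metric.
   Context: A Cantor group is a compact (Hausdorff), abelian, totally disconnected topological group; Cantor groups are taken to be infinite, i.e. they are precisely the infinite profinite abelian groups. A monothetic group is a topological group containing a dense cyclic subgroup; a generator of such a dense cyclic subgroup is a topological generator. The group operation is written additively. Given $\alpha:\mathbb{Z}\to\mathbb{D}$, put $\rho(n)=\sqrt{1-|\alpha(n)|^2}$, $a(n)=-\overline{\alpha(n)}\alpha(n-1)$, $b(n)=\overline{\alpha(n)}\rho(n-1)$, $c(n)=-\rho(n)\alpha(n-1)$, $d(n)=\rho(n)\rho(n-1)$. The CMV operator $\mathcal{E}_\alpha$ is the unitary operator on $\ell^2(\mathbb{Z})$ whose matrix in the standard basis has, for each $k\in\mathbb{Z}$: in row $2k$, the entries $b(2k), a(2k), b(2k+1), d(2k+1)$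 in columns $2k-1,2k,2k+1,2k+2$ respectively; in row $2k+1$, the entries $d(2k), c(2k), a(2k+1), c(2k+1)$ in columns $2k-1,2k,2k+1,2k+2$ respectively; and all other entries zero. For $g\in C(\Omega,\mathbb{D})$ the spectrum $\sigma(\mathcal{E}_{\alpha^g_\omega})$ does not depend on $\omega\in\Omega$ (by minimality of the translation by $\theta$); this common compact set is $\Sigma^g$. For $\tau>0$, a closed set $K\subseteq\partial\mathbb{D}$ is $\tau$-homogeneous if there exists $\delta_0>0$ such that $|B_\delta(x)\cap K|\ge\tau\delta$ for every $x\in K$ and every $0<\delta\le\delta_0$, where $|\cdot|$ is arc-length measure on $\partial\mathbb{D}$ (total mass $2\pi$) and $B_\delta(x)$ is the open $\delta$-neighborhood of $x$ with respect to the usual metric on $\mathbb{C}$. A Cantor set is a totally disconnected (nonempty) compact set with no isolated points. *)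

theory Defs
  imports "HOL-Analysis.Analysis"
begin

section \<open>Topological groups and Cantor sets\<close>

definition totally_disconnected :: "'a::topological_space set \<Rightarrow> bool" where
  "totally_disconnected S \<longleftrightarrow> (\<forall>x\<in>S. connected_component_set S x = {x})"

definition int_multiple :: "int \<Rightarrow> 'a::ab_group_add \<Rightarrow> 'a" where
  "int_multiple n x = (if 0 \<le> n then (\<Sum>i<nat n. x) else - (\<Sum>i<nat (- n). x))"

definition topological_generator :: "'a::topological_ab_group_add \<Rightarrow> bool" where
  "topological_generator \<theta> \<longleftrightarrow> closure (range (\<lambda>n. int_multiple n \<theta>)) = UNIV"

definition Cantor_set :: "'a::topological_space set \<Rightarrow> bool" where
  "Cantor_set K \<longleftrightarrow> K \<noteq> {} \<and> compact K \<and> totally_disconnected K \<and> (\<forall>x. \<not> x isolated_in K)"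

section \<open>Homogeneous subsets of the unit circle\<close>

text \<open>Arc length, of total mass \<open>2 * pi\<close>, as a Borel measure on the plane carried by the
  unit circle.\<close>

definition arc_length :: "complex measure" where
  "arc_length = distr (restrict_space lborel {0..<2 * pi}) borel cis"

definition homogeneous :: "real \<Rightarrow> complex set \<Rightarrow> bool" where
  "homogeneous \<tau> K \<longleftrightarrow> closed K \<and> K \<subseteq> sphere 0 1 \<and>
     (\<exists>\<delta>\<^sub>0>0. \<forall>x\<in>K. \<forall>\<delta>. 0 < \<delta> \<and> \<delta> \<le> \<delta>\<^sub>0 \<longrightarrow> measure arc_length (ball x \<delta> \<inter> K) \<ge> \<tau> * \<delta>)"

section \<open>Operators on the space of square-summable two-sided sequences\<close>

definition ell2 :: "(int \<Rightarrow> complex) set" where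
  "ell2 = {u. (\<lambda>n. (cmod (u n))\<^sup>2) summable_on UNIV}"

definition ell2_norm :: "(int \<Rightarrow> complex) \<Rightarrow> real" where
  "ell2_norm u = sqrt (\<Sum>\<^sub>\<infinity>n. (cmod (u n))\<^sup>2)"

text \<open>Operators are total functions on all sequences; only their values on \<^const>\<open>ell2\<close>
  are relevant below.\<close>

definition ell2_bounded_operator :: "((int \<Rightarrow> complex) \<Rightarrow> (int \<Rightarrow> complex)) \<Rightarrow> bool" where
  "ell2_bounded_operator T \<longleftrightarrow>
     (\<forall>u\<in>ell2. T u \<in> ell2) \<and>
     (\<forall>u\<in>ell2. \<forall>v\<in>ell2. T (\<lambda>n. u n + v n) = (\<lambda>n. T u n + T v n)) \<and>
     (\<forall>c. \<forall>u\<in>ell2. T (\<lambda>n. c * u n) = (\<lambda>n. c * T u n)) \<and>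
     (\<exists>C. \<forall>u\<in>ell2. ell2_norm (T u) \<le> C * ell2_norm u)"

definition ell2_spectrum :: "((int \<Rightarrow> complex) \<Rightarrow> (int \<Rightarrow> complex)) \<Rightarrow> complex set" where
  "ell2_spectrum T = {z. \<not> (\<exists>R. ell2_bounded_operator R \<and>
     (\<forall>u\<in>ell2. R (\<lambda>n. T u n - z * u n) = u \<and> (\<lambda>n. T (R u) n - z * R u n) = u))}"

section \<open>CMV operators\<close>

definition cmv_\<rho> :: "(int \<Rightarrow> complex) \<Rightarrow> int \<Rightarrow> complex" where
  "cmv_\<rho> \<alpha> n = of_real (sqrt (1 - (cmod (\<alpha> n))\<^sup>2))"

definition cmv_a :: "(int \<Rightarrow> complex) \<Rightarrow> int \<Rightarrow> complex" where
  "cmv_a \<alpha> n = - cnj (\<alpha> n) * \<alpha> (n - 1)"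

definition cmv_b :: "(int \<Rightarrow> complex) \<Rightarrow> int \<Rightarrow> complex" where
  "cmv_b \<alpha> n = cnj (\<alpha> n) * cmv_\<rho> \<alpha> (n - 1)"

definition cmv_c :: "(int \<Rightarrow> complex) \<Rightarrow> int \<Rightarrow> complex" where
  "cmv_c \<alpha> n = - cmv_\<rho> \<alpha> n * \<alpha> (n - 1)"

definition cmv_d :: "(int \<Rightarrow> complex) \<Rightarrow> int \<Rightarrow> complex" where
  "cmv_d \<alpha> n = cmv_\<rho> \<alpha> n * cmv_\<rho> \<alpha> (n - 1)"

definition cmv_matrix :: "(int \<Rightarrow> complex) \<Rightarrow> int \<Rightarrow> int \<Rightarrow> complex" where
  "cmv_matrix \<alpha> i j = (let k = i div 2 in
     if i = 2 * k then
       (if j = 2 * k - 1 then cmv_b \<alpha> (2 * k)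
        else if j = 2 * k then cmv_a \<alpha> (2 * k)
        else if j = 2 * k + 1 then cmv_b \<alpha> (2 * k + 1)
        else if j = 2 * k + 2 then cmv_d \<alpha> (2 * k + 1)
        else 0)
     else
       (if j = 2 * k - 1 then cmv_d \<alpha> (2 * k)
        else if j = 2 * k then cmv_c \<alpha> (2 * k)
        else if j = 2 * k + 1 then cmv_a \<alpha> (2 * k + 1)
        else if j = 2 * k + 2 then cmv_c \<alpha> (2 * k + 1)
        else 0))"

definition cmv_operator :: "(int \<Rightarrow> complex) \<Rightarrow> (int \<Rightarrow> complex) \<Rightarrow> (int \<Rightarrow> complex)" where
  "cmv_operator \<alpha> u = (\<lambda>i. \<Sum>\<^sub>\<infinity>j. cmv_matrix \<alpha> i j * u j)"

text \<open>Each row has finite support, so the infinite sum is a sum of four terms.\<close>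

lemma cmv_operator_eq_sum:
  "cmv_operator \<alpha> u i = (\<Sum>j\<in>{2 * (i div 2) - 1..2 * (i div 2) + 2}. cmv_matrix \<alpha> i j * u j)"
proof -
  have "cmv_operator \<alpha> u i =
      (\<Sum>\<^sub>\<infinity>j\<in>{2 * (i div 2) - 1..2 * (i div 2) + 2}. cmv_matrix \<alpha> i j * u j)"
    unfolding cmv_operator_def
    by (rule infsum_cong_neutral) (auto simp: cmv_matrix_def Let_def)
  then show ?thesis by simp
qed

section \<open>Dynamically defined CMV operators over a compact group\<close>

text \<open>The base space is compact in the application, so bounded continuous functions are all
  the continuous ones, and the metric of \<open>\<Rightarrow>\<^sub>C\<close> is the supremum metric.\<close>

definition continuous_into_disk :: "('a::topological_space \<Rightarrow>\<^sub>C complex) set" where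
  "continuous_into_disk = {g. \<forall>x. apply_bcontfun g x \<in> ball 0 1}"

definition sampled_coefficients ::
    "'a::topological_ab_group_add \<Rightarrow> ('a \<Rightarrow>\<^sub>C complex) \<Rightarrow> 'a \<Rightarrow> int \<Rightarrow> complex" where
  "sampled_coefficients \<theta> g \<omega> n = apply_bcontfun g (int_multiple n \<theta> + \<omega>)"

text \<open>The spectrum does not depend on \<open>\<omega>\<close> when \<open>\<theta>\<close> is a topological generator of a compact
  group and \<open>g\<close> takes values in the open disk; the description below denotes that common set.\<close>

definition common_spectrum ::
    "'a::topological_ab_group_add \<Rightarrow> ('a \<Rightarrow>\<^sub>C complex) \<Rightarrow> complex set" where
  "common_spectrum \<theta> g =
     (THE \<Sigma>. \<forall>\<omega>. ell2_spectrum (cmv_operator (sampled_coefficients \<theta> g \<omega>)) = \<Sigma>)"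

definition H_CMV :: "'a::topological_ab_group_add \<Rightarrow> real \<Rightarrow> ('a \<Rightarrow>\<^sub>C complex) set" where
  "H_CMV \<theta> \<tau> = {g \<in> continuous_into_disk.
     homogeneous \<tau> (common_spectrum \<theta> g) \<and> Cantor_set (common_spectrum \<theta> g)}"

end

theory Submission
  imports Defs
begin

text \<open>
  A CMV operator factors as \<open>L M\<close> with \<open>L\<close>, \<open>M\<close> block diagonal and unitary, so its spectrum consists of
  approximate eigenvalues and is upper semicontinuous in the coefficients. For \<open>p\<close>-periodic
  coefficients it is \<open>{cis \<theta> | \<bar>\<Delta>(\<theta>)\<bar> \<le> 2}\<close>, where \<open>\<Delta>\<close> is the trace of the Szego monodromy, a path
  in \<open>SU(1,1)\<close> whose logarithmic derivative stays in a cone. Hence \<open>\<Delta>\<close> has no critical point with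
  \<open>\<bar>\<Delta>\<bar> < 2\<close> and runs monotonically through \<open>[-2, 2]\<close> on each band, so bands cannot become short under
  perturbations that are uniformly small on \<open>\<Delta>\<close>.

  Viewed with the longer period \<open>m p\<close>, the monodromy is \<open>1\<close> or \<open>-1\<close> wherever \<open>\<Delta> = 2 cos (\<pi> j / m)\<close>,
  \<open>0 < j < m\<close>. A radial change of one coefficient per period makes it hyperbolic at all these points,
  which opens a dense set of gaps while removing arbitrarily little measure. Locally constant
  samplings are dense, and iterating the step with rapidly decreasing perturbations gives a limit
  whose spectrum contains no arc and still meets every small ball centred on it in measure at least
  \<open>\<tau>\<close> times the radius.
\<close>

section \<open>Square-summable sequences\<close>

text \<open>The radius \<open>\<delta>\<^sub>0\<close> up to which homogeneity is claimed must be
  the same at every stage, although later gaps make the bands arbitrarily short. Each step therefore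
  has two regimes. Below half a band length \<open>L\<close>, measured with the discriminant before
  the perturbation, one band provides an arc as long as the radius on one side of each of its
  points. Above it, the displacement of the centre and the lost measure are small multiples of
  \<open>L\<close> and are paid for by lowering the constant. A band edge has an arc on one side
  only, so the constants start at 1 and descend through
  \<open>\<tau> + (1 - \<tau>) / real (Suc n)\<close> towards \<tau>; this is where \<tau> < 1
  enters. Periods are orders of finite cyclic quotients of the group. Its infinitude gives
  arbitrarily large multiples of a period but no control over which ones, so the perturbation step
  is proved for all large multiples. Upper semicontinuity of spectra alone would bound only the
  limit spectrum. The converse inclusion comes from the same semicontinuity applied at the limit.
  Every stage records a radius within which its conclusions persist, and all later stages stay
  inside it.\<close>

definition l2_le :: "(int \<Rightarrow> real) \<Rightarrow> real \<Rightarrow> bool" where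
  "l2_le x C \<longleftrightarrow> 0 \<le> C \<and> (\<forall>F. finite F \<longrightarrow> L2_set x F \<le> C)"

lemma l2_le_nonneg: "l2_le x C \<Longrightarrow> 0 \<le> C"
  by (simp add: l2_le_def)

lemma l2_le_add:
  assumes "l2_le x C" "l2_le y D"
  shows "l2_le (\<lambda>n. x n + y n) (C + D)"
  unfolding l2_le_def
proof (intro conjI allI impI)
  show "0 \<le> C + D" using assms by (simp add: l2_le_def)
  fix F :: "int set" assume "finite F"
  then have "L2_set x F \<le> C" "L2_set y F \<le> D" using assms by (auto simp: l2_le_def)
  then show "L2_set (\<lambda>n. x n + y n) F \<le> C + D"
    using L2_set_triangle_ineq[of x y F] by linarith
qed

lemma l2_le_mono:
  assumes "l2_le y C" "\<And>n. \<bar>x n\<bar> \<le> y n" "C \<le> D"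
  shows "l2_le x D"
  unfolding l2_le_def
proof (intro conjI allI impI)
  show "0 \<le> D" using assms l2_le_nonneg by force
  fix F :: "int set" assume F: "finite F"
  have "L2_set x F = L2_set (\<lambda>n. \<bar>x n\<bar>) F" by (simp add: L2_set_def)
  also have "\<dots> \<le> L2_set y F" using assms(2) by (intro L2_set_mono) auto
  also have "\<dots> \<le> D" using assms(1,3) F by (auto simp: l2_le_def intro: order_trans)
  finally show "L2_set x F \<le> D" .
qed

lemma l2_le_scale:
  assumes "l2_le x C"
  shows "l2_le (\<lambda>n. c * x n) (\<bar>c\<bar> * C)"
  unfolding l2_le_def
proof (intro conjI allI impI)
  show "0 \<le> \<bar>c\<bar> * C" using assms by (simp add: l2_le_def)
  fix F :: "int set" assume "finite F"
  then have "L2_set x F \<le> C" using assms by (auto simp: l2_le_def)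
  moreover have "L2_set (\<lambda>n. c * x n) F = L2_set (\<lambda>n. \<bar>c\<bar> * x n) F"
    by (simp add: L2_set_def power_mult_distrib)
  moreover have "\<dots> = \<bar>c\<bar> * L2_set x F" by (simp add: L2_set_right_distrib)
  ultimately show "L2_set (\<lambda>n. c * x n) F \<le> \<bar>c\<bar> * C" by (simp add: mult_left_mono)
qed

lemma l2_le_shift:
  assumes "l2_le x C"
  shows "l2_le (\<lambda>n. x (n + k)) C"
  unfolding l2_le_def
proof (intro conjI allI impI)
  show "0 \<le> C" using assms by (simp add: l2_le_def)
  fix F :: "int set" assume "finite F"
  then have "L2_set x ((\<lambda>n. n + k) ` F) \<le> C" using assms by (simp add: l2_le_def)
  then show "L2_set (\<lambda>n. x (n + k)) F \<le> C"
    by (simp add: L2_set_def sum.reindex inj_on_def)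
qed

lemma l2_le_sum:
  assumes "\<And>j. j \<in> J \<Longrightarrow> l2_le (x j) (C j)"
  shows "l2_le (\<lambda>n. \<Sum>j\<in>J. x j n) (\<Sum>j\<in>J. C j)"
  using assms
proof (induction J rule: infinite_finite_induct)
  case (insert j J)
  then show ?case using l2_le_add[of "x j" "C j" "\<lambda>n. \<Sum>j\<in>J. x j n"] by simp
qed (simp_all add: l2_le_def L2_set_def)

text \<open>\<open>l2_le\<close> bounds all finite sections, so the triangle inequality of
  \<open>L2_set\<close> applies without summability hypotheses. This lemma and the next one
  translate between the two descriptions.\<close>

lemma ell2_imp_l2_le:
  assumes "u \<in> ell2"
  shows "l2_le (\<lambda>n. cmod (u n)) (ell2_norm u)"
  unfolding l2_le_def
proof (intro conjI allI impI)
  show "0 \<le> ell2_norm u" by (simp add: ell2_norm_def infsum_nonneg)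
  fix F :: "int set" assume "finite F"
  then have "(\<Sum>n\<in>F. (cmod (u n))\<^sup>2) \<le> (\<Sum>\<^sub>\<infinity>n. (cmod (u n))\<^sup>2)"
    using assms by (intro finite_sum_le_infsum) (auto simp: ell2_def)
  then show "L2_set (\<lambda>n. cmod (u n)) F \<le> ell2_norm u"
    by (simp add: L2_set_def ell2_norm_def)
qed

lemma l2_le_imp_ell2:
  assumes "l2_le (\<lambda>n. cmod (u n)) C"
  shows "u \<in> ell2" "ell2_norm u \<le> C"
proof -
  have C: "0 \<le> C" using assms by (simp add: l2_le_def)
  have le: "(\<Sum>n\<in>F. (cmod (u n))\<^sup>2) \<le> C\<^sup>2" if "finite F" for F
  proof -
    have "sqrt (\<Sum>n\<in>F. (cmod (u n))\<^sup>2) \<le> C" using assms that by (simp add: l2_le_def L2_set_def)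
    then show ?thesis by (simp add: C real_sqrt_le_iff sqrt_le_D)
  qed
  have s: "(\<lambda>n. (cmod (u n))\<^sup>2) summable_on UNIV"
    by (rule nonneg_bdd_above_summable_on) (auto intro!: bdd_aboveI2[where M="C\<^sup>2"] le)
  then show "u \<in> ell2" by (simp add: ell2_def)
  have "(\<Sum>\<^sub>\<infinity>n. (cmod (u n))\<^sup>2) \<le> C\<^sup>2" using s le by (intro infsum_le_finite_sums) auto
  then show "ell2_norm u \<le> C" using C by (simp add: ell2_norm_def real_le_lsqrt)
qed

lemma ell2_norm_nonneg [simp]: "0 \<le> ell2_norm u"
  by (simp add: ell2_norm_def infsum_nonneg)

lemma cmod_le_ell2_norm:
  assumes "u \<in> ell2"
  shows "cmod (u n) \<le> ell2_norm u"
  using ell2_imp_l2_le[OF assms] unfolding l2_le_def L2_set_def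
  by (metis (no_types, lifting) finite.emptyI finite.insertI norm_ge_zero real_sqrt_abs2 abs_of_nonneg
      power2_eq_square sum.empty sum.insert add.right_neutral empty_iff)

lemma ell2_norm_eq_0:
  assumes "u \<in> ell2" "ell2_norm u = 0"
  shows "u = (\<lambda>n. 0)"
  using cmod_le_ell2_norm[OF assms(1)] assms(2) by auto

lemma ell2_norm_pos:
  assumes "u \<in> ell2" "u \<noteq> (\<lambda>n. 0)"
  shows "0 < ell2_norm u"
  using ell2_norm_eq_0[OF assms(1)] assms(2) ell2_norm_nonneg[of u] by linarith

lemma ell2_add:
  assumes "u \<in> ell2" "v \<in> ell2"
  shows "(\<lambda>n. u n + v n) \<in> ell2" "ell2_norm (\<lambda>n. u n + v n) \<le> ell2_norm u + ell2_norm v"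
proof -
  have "l2_le (\<lambda>n. cmod (u n + v n)) (ell2_norm u + ell2_norm v)"
    by (rule l2_le_mono[OF l2_le_add[OF ell2_imp_l2_le[OF assms(1)] ell2_imp_l2_le[OF assms(2)]]])
      (auto simp: norm_triangle_ineq)
  from l2_le_imp_ell2[OF this] show "(\<lambda>n. u n + v n) \<in> ell2"
    "ell2_norm (\<lambda>n. u n + v n) \<le> ell2_norm u + ell2_norm v" .
qed

lemma ell2_scale:
  assumes "u \<in> ell2"
  shows "(\<lambda>n. c * u n) \<in> ell2" "ell2_norm (\<lambda>n. c * u n) = cmod c * ell2_norm u"
proof -
  show "(\<lambda>n. c * u n) \<in> ell2"
    using assms by (auto simp: ell2_def norm_mult power_mult_distrib intro: summable_on_cmult_right)
  show "ell2_norm (\<lambda>n. c * u n) = cmod c * ell2_norm u"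
    by (simp add: ell2_norm_def norm_mult power_mult_distrib infsum_cmult_right' real_sqrt_mult)
qed

lemma ell2_diff:
  assumes "u \<in> ell2" "v \<in> ell2"
  shows "(\<lambda>n. u n - v n) \<in> ell2" "ell2_norm (\<lambda>n. u n - v n) \<le> ell2_norm u + ell2_norm v"
  using ell2_add[OF assms(1) ell2_scale(1)[OF assms(2), of "-1"]] ell2_scale(2)[OF assms(2), of "-1"]
  by simp_all

lemma ell2_zero: "(\<lambda>n. 0) \<in> ell2" "ell2_norm (\<lambda>n. 0) = 0"
  by (simp_all add: ell2_def ell2_norm_def)

lemma ell2_norm_triangle_lower:
  assumes "u \<in> ell2" "v \<in> ell2"
  shows "ell2_norm u - ell2_norm v \<le> ell2_norm (\<lambda>n. u n - v n)"
  using ell2_add(2)[OF ell2_diff(1)[OF assms] assms(2)] by simp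

text \<open>Boundedness test for banded operators: \<open>J\<close> lists the offsets of the
  diagonals that may carry nonzero entries, and \<open>C\<close> bounds the entries.\<close>

lemma ell2_dominated:
  assumes "u \<in> ell2" "\<And>n. cmod (w n) \<le> C * (\<Sum>j\<in>J. cmod (u (n + j)))" "0 \<le> C"
  shows "w \<in> ell2" "ell2_norm w \<le> C * real (card J) * ell2_norm u"
proof -
  have "l2_le (\<lambda>n. \<Sum>j\<in>J. cmod (u (n + j))) (\<Sum>j\<in>J. ell2_norm u)"
    by (intro l2_le_sum l2_le_shift[of "\<lambda>n. cmod (u n)"] ell2_imp_l2_le assms)
  from l2_le_scale[OF this, of C]
  have "l2_le (\<lambda>n. cmod (w n)) (C * real (card J) * ell2_norm u)"
    by (rule l2_le_mono) (use assms in auto)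
  from l2_le_imp_ell2[OF this] show "w \<in> ell2" "ell2_norm w \<le> C * real (card J) * ell2_norm u" .
qed

text \<open>Banach's fixed point theorem, which takes the place of Neumann series in the resolvent
  constructions below. \<open>ell2\<close> is a set of functions, so completeness is proved along
  the way from pointwise limits of the iterates.\<close>

lemma ell2_contraction_fixpoint:
  assumes G: "\<And>x. x \<in> ell2 \<Longrightarrow> G x \<in> ell2"
    and contr: "\<And>x y. x \<in> ell2 \<Longrightarrow> y \<in> ell2 \<Longrightarrow>
      ell2_norm (\<lambda>n. G x n - G y n) \<le> q * ell2_norm (\<lambda>n. x n - y n)"
    and q: "0 \<le> q" "q < 1"
  shows "\<exists>x\<in>ell2. G x = x"
proof -
  define X where "X k = (G ^^ k) (\<lambda>n. 0)" for k
  have X: "X k \<in> ell2" for k by (induction k) (auto simp: X_def ell2_zero G)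
  define C where "C = ell2_norm (\<lambda>n. X 1 n - X 0 n)"
  have step: "ell2_norm (\<lambda>n. X (Suc k) n - X k n) \<le> C * q ^ k" for k
  proof (induction k)
    case (Suc k)
    have "ell2_norm (\<lambda>n. X (Suc (Suc k)) n - X (Suc k) n) \<le> q * ell2_norm (\<lambda>n. X (Suc k) n - X k n)"
      using contr[OF X X, of "Suc k" k] by (simp add: X_def)
    also have "\<dots> \<le> q * (C * q ^ k)" using Suc q by (intro mult_left_mono) auto
    finally show ?case by (simp add: mult_ac)
  qed (simp add: C_def)
  have tail: "ell2_norm (\<lambda>n. X (k + m) n - X k n) \<le> C * q ^ k / (1 - q)" for k m
  proof -
    have "ell2_norm (\<lambda>n. X (k + m) n - X k n) \<le> (\<Sum>i<m. C * q ^ (k + i))"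
    proof (induction m)
      case (Suc m)
      have "(\<lambda>n. X (k + Suc m) n - X k n) = 
          (\<lambda>n. (X (Suc (k + m)) n - X (k + m) n) + (X (k + m) n - X k n))" by auto
      then have "ell2_norm (\<lambda>n. X (k + Suc m) n - X k n) \<le>
          ell2_norm (\<lambda>n. X (Suc (k + m)) n - X (k + m) n) + ell2_norm (\<lambda>n. X (k + m) n - X k n)"
        using ell2_add(2)[OF ell2_diff(1)[OF X[of "Suc (k + m)"] X[of "k + m"]]
            ell2_diff(1)[OF X[of "k + m"] X[of k]]] by simp
      then show ?case using Suc step[of "k + m"] by simp
    qed (simp add: ell2_zero)
    also have "\<dots> = C * q ^ k * (\<Sum>i<m. q ^ i)" by (simp add: power_add sum_distrib_left mult_ac)
    also have "\<dots> \<le> C * q ^ k * (1 / (1 - q))"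
    proof -
      have "(\<Sum>i<m. q ^ i) \<le> 1 / (1 - q)"
        using q by (auto simp: sum_gp_strict divide_simps)
      then show ?thesis using q by (intro mult_left_mono) (auto simp: C_def)
    qed
    finally show ?thesis by simp
  qed
  have lim0: "(\<lambda>k. C * q ^ k / (1 - q)) \<longlonglongrightarrow> 0"
    using q by (auto intro!: tendsto_eq_intros LIMSEQ_realpow_zero)
  have "Cauchy (\<lambda>k. X k n)" for n
  proof (rule metric_CauchyI)
    fix e :: real assume "0 < e"
    then have "eventually (\<lambda>k. C * q ^ k / (1 - q) < e / 2) sequentially"
      using lim0 by (intro order_tendstoD) auto
    then obtain K where K: "C * q ^ K / (1 - q) < e / 2" by (auto simp: eventually_sequentially)
    have *: "cmod (X m n - X K n) < e / 2" if "m \<ge> K" for m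
    proof -
      have "ell2_norm (\<lambda>n. X m n - X K n) \<le> C * q ^ K / (1 - q)"
        using tail[of K "m - K"] that by simp
      then show ?thesis
        using cmod_le_ell2_norm[OF ell2_diff(1)[OF X[of m] X[of K]], of n] K by linarith
    qed
    show "\<exists>M. \<forall>m\<ge>M. \<forall>m'\<ge>M. dist (X m n) (X m' n) < e"
    proof (intro exI[of _ K] allI impI)
      fix m m' assume "m \<ge> K" "m' \<ge> K"
      then show "dist (X m n) (X m' n) < e" 
        using *[of m] *[of m'] dist_triangle_half_l[of "X m n" "X K n" e "X m' n"]
        by (simp add: dist_norm norm_minus_commute)
    qed
  qed
  then have "\<exists>l. (\<lambda>k. X k n) \<longlonglongrightarrow> l" for n
    using Cauchy_convergent convergent_def by blast
  then obtain x where x: "\<And>n. (\<lambda>k. X k n) \<longlonglongrightarrow> x n" by metis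
  \<comment> \<open>Finite sections see only pointwise convergence, so the tail bound survives the
    limit and puts \<open>x - X k\<close> into \<open>ell2\<close>.\<close>
  have "l2_le (\<lambda>n. cmod (x n - X k n)) (C * q ^ k / (1 - q))" for k
    unfolding l2_le_def
  proof (intro conjI allI impI)
    show "0 \<le> C * q ^ k / (1 - q)" using q by (simp add: C_def)
    fix F :: "int set" assume F: "finite F"
    have "(\<lambda>m. L2_set (\<lambda>n. cmod (X (m + k) n - X k n)) F) \<longlonglongrightarrow> L2_set (\<lambda>n. cmod (x n - X k n)) F"
      unfolding L2_set_def by (intro tendsto_intros LIMSEQ_ignore_initial_segment x)
    moreover have "L2_set (\<lambda>n. cmod (X (m + k) n - X k n)) F \<le> C * q ^ k / (1 - q)" for m
      using ell2_imp_l2_le[OF ell2_diff(1)[OF X[of "m + k"] X[of k]]] tail[of k m] F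
      by (auto simp: l2_le_def add.commute intro: order_trans)
    ultimately show "L2_set (\<lambda>n. cmod (x n - X k n)) F \<le> C * q ^ k / (1 - q)"
      using tendsto_upperbound[OF _ always_eventually trivial_limit_sequentially] by blast
  qed
  note lim = l2_le_imp_ell2[OF this]
  have xell: "x \<in> ell2" using ell2_add(1)[OF lim(1)[of 0] X[of 0]] by simp
  \<comment> \<open>Compare both terms with \<open>X (Suc k) = G (X k)\<close>; each difference is
    controlled by a tail of the geometric series.\<close>
  have "ell2_norm (\<lambda>n. G x n - x n) \<le> 2 * (C * q ^ k / (1 - q))" for k
  proof -
    have "(\<lambda>n. G x n - x n) = (\<lambda>n. (G x n - G (X k) n) - (x n - X (Suc k) n))"
      by (auto simp: X_def)
    then have "ell2_norm (\<lambda>n. G x n - x n) \<le>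
        ell2_norm (\<lambda>n. G x n - G (X k) n) + ell2_norm (\<lambda>n. x n - X (Suc k) n)"
      using ell2_diff(2)[OF ell2_diff(1)[OF G[OF xell] G[OF X[of k]]] ell2_diff(1)[OF xell X[of "Suc k"]]] by simp
    also have "ell2_norm (\<lambda>n. G x n - G (X k) n) \<le> 1 * ell2_norm (\<lambda>n. x n - X k n)"
      by (rule order_trans[OF contr[OF xell X[of k]]]) (use q in \<open>intro mult_right_mono; simp\<close>)
    also have "1 * ell2_norm (\<lambda>n. x n - X k n) \<le> C * q ^ k / (1 - q)" using lim(2) by simp
    also have "ell2_norm (\<lambda>n. x n - X (Suc k) n) \<le> C * q ^ k / (1 - q)"
    proof (rule order_trans[OF lim(2)])
      have "C * (q * q ^ k) \<le> C * (1 * q ^ k)"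
        using q by (intro mult_left_mono mult_right_mono) (auto simp: C_def)
      then show "C * q ^ Suc k / (1 - q) \<le> C * q ^ k / (1 - q)"
        using q by (simp add: divide_right_mono)
    qed
    finally show ?thesis by simp
  qed
  moreover have "(\<lambda>k. 2 * (C * q ^ k / (1 - q))) \<longlonglongrightarrow> 0"
    using tendsto_mult_right_zero[OF lim0, of 2] by simp
  ultimately have "ell2_norm (\<lambda>n. G x n - x n) \<le> 0"
    using tendsto_lowerbound[OF _ always_eventually trivial_limit_sequentially] by blast
  then have "(\<lambda>n. G x n - x n) = (\<lambda>n. 0)"
    using ell2_norm_eq_0[OF ell2_diff(1)[OF G[OF xell] xell]] ell2_norm_nonneg[of "\<lambda>n. G x n - x n"] by linarith
  then have "G x = x" by (auto simp: fun_eq_iff)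
  with xell show ?thesis by blast
qed

section \<open>The spectrum of a CMV operator\<close>

text \<open>Block diagonal with blocks \<open>[[cnj (\<alpha> i), \<rho> i], [\<rho> i, - \<alpha> i]]\<close> on the sites \<open>i, i + 1\<close>, where \<open>i\<close> runs
  over the even integers if \<open>e\<close> holds and over the odd ones otherwise.\<close>

definition theta_block :: "bool \<Rightarrow> (int \<Rightarrow> complex) \<Rightarrow> (int \<Rightarrow> complex) \<Rightarrow> int \<Rightarrow> complex" where
  "theta_block e \<alpha> u i =
     (if even i = e then cnj (\<alpha> i) * u i + cmv_\<rho> \<alpha> i * u (i + 1)
      else cmv_\<rho> \<alpha> (i - 1) * u (i - 1) - \<alpha> (i - 1) * u i)"

lemma cmv_operator_factor:
  "cmv_operator \<alpha> u = theta_block True \<alpha> (theta_block False \<alpha> u)"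
proof
  fix i :: int
  define k where "k = i div 2"
  have I: "{2 * k - 1..2 * k + 2} = {2 * k - 1, 2 * k, 2 * k + 1, 2 * k + 2}" by auto
  have E: "cmv_operator \<alpha> u i = cmv_matrix \<alpha> i (2 * k - 1) * u (2 * k - 1) + cmv_matrix \<alpha> i (2 * k) * u (2 * k)
      + cmv_matrix \<alpha> i (2 * k + 1) * u (2 * k + 1) + cmv_matrix \<alpha> i (2 * k + 2) * u (2 * k + 2)"
    unfolding cmv_operator_eq_sum k_def[symmetric] I by simp
  show "cmv_operator \<alpha> u i = theta_block True \<alpha> (theta_block False \<alpha> u) i"
  proof (cases "even i")
    case True
    then have i: "i = 2 * k" by (simp add: k_def)
    show ?thesis unfolding E
      by (simp add: i cmv_matrix_def theta_block_def cmv_a_def cmv_b_def cmv_d_def algebra_simps)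
  next
    case False
    then have i: "i = 2 * k + 1" by (simp add: k_def)
    show ?thesis unfolding E
      by (simp add: i cmv_matrix_def theta_block_def cmv_a_def cmv_c_def cmv_d_def algebra_simps)
  qed
qed

lemma cmv_\<rho>_cnj [simp]: "cmv_\<rho> (\<lambda>n. cnj (\<alpha> n)) = cmv_\<rho> \<alpha>"
  by (simp add: cmv_\<rho>_def fun_eq_iff)

lemma cmv_\<rho>_sq:
  assumes "cmod (\<alpha> n) \<le> 1"
  shows "cmv_\<rho> \<alpha> n * cmv_\<rho> \<alpha> n = 1 - \<alpha> n * cnj (\<alpha> n)"
proof -
  have "(cmod (\<alpha> n))\<^sup>2 \<le> 1" using assms by (simp add: power_le_one)
  then have "cmv_\<rho> \<alpha> n * cmv_\<rho> \<alpha> n = of_real (1 - (cmod (\<alpha> n))\<^sup>2)"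
    by (simp add: cmv_\<rho>_def flip: of_real_mult)
  then show ?thesis by (simp only: of_real_diff of_real_1 complex_norm_square)
qed

lemma cmod_cmv_\<rho>_le:
  assumes "cmod (\<alpha> n) \<le> 1"
  shows "cmod (cmv_\<rho> \<alpha> n) \<le> 1"
proof -
  have "(cmod (\<alpha> n))\<^sup>2 \<le> 1" using assms by (simp add: power_le_one)
  then show ?thesis by (simp add: cmv_\<rho>_def norm_of_real)
qed

text \<open>Each block is unitary, and its adjoint has the same shape with conjugated
  coefficients.\<close>

lemma theta_block_inverse:
  assumes "\<forall>n. cmod (\<alpha> n) \<le> 1"
  shows "theta_block e (\<lambda>n. cnj (\<alpha> n)) (theta_block e \<alpha> u) = u"
proof
  fix i
  have "theta_block e (\<lambda>n. cnj (\<alpha> n)) (theta_block e \<alpha> u) i =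
     (if even i = e then (\<alpha> i * cnj (\<alpha> i) + cmv_\<rho> \<alpha> i * cmv_\<rho> \<alpha> i) * u i
      else (\<alpha> (i - 1) * cnj (\<alpha> (i - 1)) + cmv_\<rho> \<alpha> (i - 1) * cmv_\<rho> \<alpha> (i - 1)) * u i)"
    by (auto simp: theta_block_def algebra_simps)
  then show "theta_block e (\<lambda>n. cnj (\<alpha> n)) (theta_block e \<alpha> u) i = u i"
    using cmv_\<rho>_sq[of \<alpha>, OF assms[rule_format]] by simp
qed

lemma theta_block_add: "theta_block e \<alpha> (\<lambda>n. u n + v n) = (\<lambda>n. theta_block e \<alpha> u n + theta_block e \<alpha> v n)"
  and theta_block_diff: "theta_block e \<alpha> (\<lambda>n. u n - v n) = (\<lambda>n. theta_block e \<alpha> u n - theta_block e \<alpha> v n)"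
  and theta_block_scale: "theta_block e \<alpha> (\<lambda>n. c * u n) = (\<lambda>n. c * theta_block e \<alpha> u n)"
  by (auto simp: theta_block_def fun_eq_iff algebra_simps)

text \<open>Isometry on a single block: the conditional picks the partner of \<open>i\<close>, the
  other site of its block.\<close>

lemma theta_block_norm_add:
  assumes "\<forall>n. cmod (\<alpha> n) \<le> 1"
  shows "(cmod (theta_block e \<alpha> u i))\<^sup>2 + (cmod (theta_block e \<alpha> u (if even i = e then i + 1 else i - 1)))\<^sup>2
    = (cmod (u i))\<^sup>2 + (cmod (u (if even i = e then i + 1 else i - 1)))\<^sup>2"
proof -
  have key: "(cmod (cnj a * x + of_real r * y))\<^sup>2 + (cmod (of_real r * x - a * y))\<^sup>2 = (cmod x)\<^sup>2 + (cmod y)\<^sup>2"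
    if "r * r = 1 - (cmod a)\<^sup>2" for a x y :: complex and r :: real
  proof -
    have rr: "complex_of_real r * complex_of_real r = 1 - a * cnj a"
      using that by (metis complex_norm_square of_real_1 of_real_diff of_real_mult)
    have "complex_of_real ((cmod (cnj a * x + of_real r * y))\<^sup>2 + (cmod (of_real r * x - a * y))\<^sup>2)
       = (complex_of_real r * complex_of_real r + a * cnj a) * (x * cnj x + y * cnj y)"
      by (simp only: of_real_add complex_norm_square complex_cnj_add complex_cnj_diff complex_cnj_mult
          complex_cnj_cnj complex_cnj_complex_of_real) (simp add: algebra_simps)
    also have "\<dots> = complex_of_real ((cmod x)\<^sup>2 + (cmod y)\<^sup>2)"
      using rr by (simp add: complex_norm_square del: of_real_power)
    finally show ?thesis by (metis of_real_eq_iff)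
  qed
  have r: "sqrt (1 - (cmod (\<alpha> j))\<^sup>2) * sqrt (1 - (cmod (\<alpha> j))\<^sup>2) = 1 - (cmod (\<alpha> j))\<^sup>2" for j
    using assms by (simp add: power_le_one)
  show ?thesis
    using key[OF r[of i], of "u i" "u (i + 1)"] key[OF r[of "i - 1"], of "u (i - 1)" "u i"]
    by (auto simp: theta_block_def cmv_\<rho>_def add.commute)
qed

lemma theta_block_ell2:
  assumes "\<forall>n. cmod (\<alpha> n) \<le> 1" "u \<in> ell2"
  shows "theta_block e \<alpha> u \<in> ell2" "ell2_norm (theta_block e \<alpha> u) = ell2_norm u"
proof -
  show w: "theta_block e \<alpha> u \<in> ell2"
  proof (rule ell2_dominated(1)[OF assms(2), where J = "{-1, 0, 1}" and C = 1])
    fix n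
    have "cmod (cnj (\<alpha> n) * u n + cmv_\<rho> \<alpha> n * u (n + 1)) \<le> 1 * cmod (u n) + 1 * cmod (u (n + 1))"
      using assms(1) cmod_cmv_\<rho>_le[of \<alpha>, OF assms(1)[rule_format]]
      by (intro order_trans[OF norm_triangle_ineq] add_mono) (simp_all add: norm_mult mult_left_le_one_le)
    moreover have "cmod (cmv_\<rho> \<alpha> (n - 1) * u (n - 1) - \<alpha> (n - 1) * u n) \<le> 1 * cmod (u (n - 1)) + 1 * cmod (u n)"
      using assms(1) cmod_cmv_\<rho>_le[of \<alpha>, OF assms(1)[rule_format]]
      by (intro order_trans[OF norm_triangle_ineq4] add_mono) (simp_all add: norm_mult mult_left_le_one_le)
    moreover have "cmod (u n) + cmod (u (n + 1)) \<le> (\<Sum>j\<in>{- 1, 0, 1}. cmod (u (n + j)))"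
      "cmod (u (n - 1)) + cmod (u n) \<le> (\<Sum>j\<in>{- 1, 0, 1}. cmod (u (n + j)))" by simp_all
    ultimately show "cmod (theta_block e \<alpha> u n) \<le> 1 * (\<Sum>j\<in>{- 1, 0, 1}. cmod (u (n + j)))"
      unfolding theta_block_def mult_1 by (auto split: if_split intro: order_trans simp del: sum.insert)
  qed simp
  \<comment> \<open>The involution exchanging the two sites of each block. Summing over a site and
    its partner counts every site twice, which turns the blockwise isometry into equality of
    norms.\<close>
  define \<pi> where "\<pi> = (\<lambda>i::int. if even i = e then i + 1 else i - 1)"
  have inv: "\<pi> (\<pi> i) = i" for i by (auto simp: \<pi>_def)
  have bij: "bij_betw \<pi> UNIV UNIV" by (rule bij_betwI[where g = \<pi>]) (auto simp: inv)
  have dbl: "(\<Sum>\<^sub>\<infinity>n. (cmod (x n))\<^sup>2) + (\<Sum>\<^sub>\<infinity>n. (cmod (x n))\<^sup>2) =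
      (\<Sum>\<^sub>\<infinity>n. (cmod (x n))\<^sup>2 + (cmod (x (\<pi> n)))\<^sup>2)" if "x \<in> ell2" for x
  proof -
    have s: "(\<lambda>n. (cmod (x n))\<^sup>2) summable_on UNIV" using that by (simp add: ell2_def)
    have s': "(\<lambda>n. (cmod (x (\<pi> n)))\<^sup>2) summable_on UNIV"
      using summable_on_reindex_bij_betw[OF bij, of "\<lambda>n. (cmod (x n))\<^sup>2"] s by simp
    have "(\<Sum>\<^sub>\<infinity>n. (cmod (x (\<pi> n)))\<^sup>2) = (\<Sum>\<^sub>\<infinity>n. (cmod (x n))\<^sup>2)"
      by (rule infsum_reindex_bij_betw[OF bij])
    then show ?thesis using infsum_add[OF s s'] by simp
  qed
  have "(\<Sum>\<^sub>\<infinity>n. (cmod (theta_block e \<alpha> u n))\<^sup>2) = (\<Sum>\<^sub>\<infinity>n. (cmod (u n))\<^sup>2)"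
    using dbl[OF w] dbl[OF assms(2)] theta_block_norm_add[OF assms(1), of e u] by (simp add: \<pi>_def)
  then show "ell2_norm (theta_block e \<alpha> u) = ell2_norm u" by (simp add: ell2_norm_def)
qed

lemma cmv_operator_add: "cmv_operator \<alpha> (\<lambda>n. u n + v n) = (\<lambda>n. cmv_operator \<alpha> u n + cmv_operator \<alpha> v n)"
  and cmv_operator_diff: "cmv_operator \<alpha> (\<lambda>n. u n - v n) = (\<lambda>n. cmv_operator \<alpha> u n - cmv_operator \<alpha> v n)"
  and cmv_operator_scale: "cmv_operator \<alpha> (\<lambda>n. c * u n) = (\<lambda>n. c * cmv_operator \<alpha> u n)"
  by (simp_all add: cmv_operator_factor theta_block_add theta_block_diff theta_block_scale)

lemma cmv_operator_ell2:
  assumes "\<forall>n. cmod (\<alpha> n) \<le> 1" "u \<in> ell2"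
  shows "cmv_operator \<alpha> u \<in> ell2" "ell2_norm (cmv_operator \<alpha> u) = ell2_norm u"
  using assms by (simp_all add: cmv_operator_factor theta_block_ell2)

definition cmv_inverse :: "(int \<Rightarrow> complex) \<Rightarrow> (int \<Rightarrow> complex) \<Rightarrow> (int \<Rightarrow> complex)" where
  "cmv_inverse \<alpha> u = theta_block False (\<lambda>n. cnj (\<alpha> n)) (theta_block True (\<lambda>n. cnj (\<alpha> n)) u)"

lemma cmv_inverse_ell2:
  assumes "\<forall>n. cmod (\<alpha> n) \<le> 1" "u \<in> ell2"
  shows "cmv_inverse \<alpha> u \<in> ell2" "ell2_norm (cmv_inverse \<alpha> u) = ell2_norm u"
  using assms by (simp_all add: cmv_inverse_def theta_block_ell2)

lemma cmv_operator_inverse: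
  assumes "\<forall>n. cmod (\<alpha> n) \<le> 1"
  shows "cmv_operator \<alpha> (cmv_inverse \<alpha> u) = u"
  using theta_block_inverse[of "\<lambda>n. cnj (\<alpha> n)"] assms
  by (simp add: cmv_operator_factor cmv_inverse_def)

lemma cmv_inverse_diff: "cmv_inverse \<alpha> (\<lambda>n. u n - v n) = (\<lambda>n. cmv_inverse \<alpha> u n - cmv_inverse \<alpha> v n)"
  by (simp add: cmv_inverse_def theta_block_diff)

text \<open>The approximate point spectrum. For the unitary operators here it is the whole spectrum
  (\<open>cmv_spectrum_eq\<close>), and an approximate eigenvector is easily carried over to an
  operator with nearby coefficients.\<close>

definition approx_spectrum :: "((int \<Rightarrow> complex) \<Rightarrow> (int \<Rightarrow> complex)) \<Rightarrow> complex set" where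
  "approx_spectrum T = {z. \<forall>e>0. \<exists>u\<in>ell2. u \<noteq> (\<lambda>n. 0) \<and>
     ell2_norm (\<lambda>n. T u n - z * u n) \<le> e * ell2_norm u}"

lemma approx_spectrumI:
  assumes "\<And>e. 0 < e \<Longrightarrow> \<exists>u\<in>ell2. u \<noteq> (\<lambda>n. 0) \<and> ell2_norm (\<lambda>n. T u n - z * u n) \<le> e * ell2_norm u"
  shows "z \<in> approx_spectrum T"
  using assms by (simp add: approx_spectrum_def)

lemma approx_spectrumE:
  assumes "z \<in> approx_spectrum T" "0 < e"
  obtains u where "u \<in> ell2" "u \<noteq> (\<lambda>n. 0)" "ell2_norm (\<lambda>n. T u n - z * u n) \<le> e * ell2_norm u"
  using assms unfolding approx_spectrum_def by blast

lemma not_approx_spectrumE: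
  assumes "z \<notin> approx_spectrum T" "T (\<lambda>n. 0) = (\<lambda>n. 0)"
  obtains c where "0 < c" "\<And>u. u \<in> ell2 \<Longrightarrow> c * ell2_norm u \<le> ell2_norm (\<lambda>n. T u n - z * u n)"
proof -
  obtain e where e: "0 < e" "\<And>u. u \<in> ell2 \<Longrightarrow> u \<noteq> (\<lambda>n. 0) \<Longrightarrow> e * ell2_norm u < ell2_norm (\<lambda>n. T u n - z * u n)"
    using assms(1) unfolding approx_spectrum_def by (auto simp: not_le)
  have "e * ell2_norm u \<le> ell2_norm (\<lambda>n. T u n - z * u n)" if "u \<in> ell2" for u
    using e(2)[OF that] assms(2) by (cases "u = (\<lambda>n. 0)") (auto simp: ell2_zero intro: less_imp_le)
  with e(1) that show ?thesis by blast
qed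

lemma cmv_operator_zero: "cmv_operator \<alpha> (\<lambda>n. 0) = (\<lambda>n. 0)"
  by (simp add: cmv_operator_factor theta_block_def fun_eq_iff)

lemma cmv_minus_ell2:
  assumes "\<forall>n. cmod (\<alpha> n) \<le> 1" "u \<in> ell2"
  shows "(\<lambda>n. cmv_operator \<alpha> u n - z * u n) \<in> ell2"
  by (intro ell2_diff ell2_scale cmv_operator_ell2 assms)

text \<open>The equation says that \<open>x\<close> is a fixed point of x = (E x - y) / w, where E
  is the CMV operator; this is a contraction because E is isometric.\<close>

lemma cmv_minus_surj_outside:
  assumes \<alpha>: "\<forall>n. cmod (\<alpha> n) \<le> 1" and w: "1 < cmod w" and y: "y \<in> ell2"
  shows "\<exists>x\<in>ell2. (\<lambda>n. cmv_operator \<alpha> x n - w * x n) = y"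
proof -
  have "\<exists>x\<in>ell2. (\<lambda>n. inverse w * (cmv_operator \<alpha> x n - y n)) = x"
  proof (rule ell2_contraction_fixpoint[where q = "inverse (cmod w)"])
    fix x x' assume x: "x \<in> ell2" "x' \<in> ell2"
    show "(\<lambda>n. inverse w * (cmv_operator \<alpha> x n - y n)) \<in> ell2"
      by (intro ell2_scale ell2_diff cmv_operator_ell2 \<alpha> x y)
    have "(\<lambda>n. inverse w * (cmv_operator \<alpha> x n - y n) - inverse w * (cmv_operator \<alpha> x' n - y n))
        = (\<lambda>n. inverse w * cmv_operator \<alpha> (\<lambda>n. x n - x' n) n)"
      by (simp add: cmv_operator_diff algebra_simps)
    then show "ell2_norm (\<lambda>n. inverse w * (cmv_operator \<alpha> x n - y n) - inverse w * (cmv_operator \<alpha> x' n - y n))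
        \<le> inverse (cmod w) * ell2_norm (\<lambda>n. x n - x' n)"
      using ell2_scale(2)[OF cmv_operator_ell2(1)[OF \<alpha> ell2_diff(1)[OF x]]]
        cmv_operator_ell2(2)[OF \<alpha> ell2_diff(1)[OF x]] by (simp add: norm_inverse)
  qed (use w in \<open>auto simp: inverse_less_1_iff\<close>)
  then obtain x where x: "x \<in> ell2" "(\<lambda>n. inverse w * (cmv_operator \<alpha> x n - y n)) = x" by blast
  from w have "w \<noteq> 0" by auto
  have "cmv_operator \<alpha> x n - w * x n = y n" for n
  proof -
    have "w * x n = w * (inverse w * (cmv_operator \<alpha> x n - y n))" using fun_cong[OF x(2), of n] by simp
    also have "\<dots> = cmv_operator \<alpha> x n - y n" using \<open>w \<noteq> 0\<close> by (simp flip: mult.assoc)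
    finally show ?thesis by simp
  qed
  with x(1) show ?thesis by blast
qed

text \<open>Here the contraction uses the inverse operator: \<open>x\<close> is the image of y + w x
  under \<open>cmv_inverse \<alpha>\<close>.\<close>

lemma cmv_minus_surj_inside:
  assumes \<alpha>: "\<forall>n. cmod (\<alpha> n) \<le> 1" and w: "cmod w < 1" and y: "y \<in> ell2"
  shows "\<exists>x\<in>ell2. (\<lambda>n. cmv_operator \<alpha> x n - w * x n) = y"
proof -
  have "\<exists>x\<in>ell2. cmv_inverse \<alpha> (\<lambda>n. y n + w * x n) = x"
  proof (rule ell2_contraction_fixpoint[where q = "cmod w"])
    fix x x' assume x: "x \<in> ell2" "x' \<in> ell2"
    show "cmv_inverse \<alpha> (\<lambda>n. y n + w * x n) \<in> ell2"
      by (intro cmv_inverse_ell2 ell2_scale ell2_add \<alpha> x y)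
    have "(\<lambda>n. cmv_inverse \<alpha> (\<lambda>n. y n + w * x n) n - cmv_inverse \<alpha> (\<lambda>n. y n + w * x' n) n)
        = cmv_inverse \<alpha> (\<lambda>n. w * (x n - x' n))"
      by (simp add: cmv_inverse_diff[symmetric] algebra_simps)
    then show "ell2_norm (\<lambda>n. cmv_inverse \<alpha> (\<lambda>n. y n + w * x n) n - cmv_inverse \<alpha> (\<lambda>n. y n + w * x' n) n)
        \<le> cmod w * ell2_norm (\<lambda>n. x n - x' n)"
      using ell2_scale[OF ell2_diff(1)[OF x], of w] cmv_inverse_ell2(2)[OF \<alpha>, of "\<lambda>n. w * (x n - x' n)"] by simp
  qed (use w in auto)
  then obtain x where x: "x \<in> ell2" "cmv_inverse \<alpha> (\<lambda>n. y n + w * x n) = x" by blast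
  have "cmv_operator \<alpha> x = (\<lambda>n. y n + w * x n)"
    using cmv_operator_inverse[OF \<alpha>, of "\<lambda>n. y n + w * x n"] x(2) by simp
  then have "(\<lambda>n. cmv_operator \<alpha> x n - w * x n) = y" by simp
  with x(1) show ?thesis by blast
qed

text \<open>Surjectivity is an open condition: by the lower bound an inverse at \<open>w\<close> has
  norm at most \<open>1 / c\<close>, so the shift \<open>z - w\<close>, smaller than
  \<open>c\<close>, is absorbed by a contraction.\<close>

lemma cmv_minus_surj_near:
  assumes \<alpha>: "\<forall>n. cmod (\<alpha> n) \<le> 1" and c: "cmod (w - z) < c"
    and below: "\<And>u. u \<in> ell2 \<Longrightarrow> c * ell2_norm u \<le> ell2_norm (\<lambda>n. cmv_operator \<alpha> u n - w * u n)"
    and surj: "\<And>y. y \<in> ell2 \<Longrightarrow> \<exists>x\<in>ell2. (\<lambda>n. cmv_operator \<alpha> x n - w * x n) = y"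
    and y: "y \<in> ell2"
  shows "\<exists>x\<in>ell2. (\<lambda>n. cmv_operator \<alpha> x n - z * x n) = y"
proof -
  have c0: "0 < c" using c norm_ge_zero[of "w - z"] by linarith
  from surj obtain R where R: "\<And>y. y \<in> ell2 \<Longrightarrow> R y \<in> ell2"
      "\<And>y. y \<in> ell2 \<Longrightarrow> (\<lambda>n. cmv_operator \<alpha> (R y) n - w * R y n) = y" by metis
  have "\<exists>x\<in>ell2. R (\<lambda>n. y n + (z - w) * x n) = x"
  proof (rule ell2_contraction_fixpoint[where q = "cmod (w - z) / c"])
    fix x x' assume x: "x \<in> ell2" "x' \<in> ell2"
    define f f' where "f = (\<lambda>n. y n + (z - w) * x n)" and "f' = (\<lambda>n. y n + (z - w) * x' n)"
    have f: "f \<in> ell2" "f' \<in> ell2" unfolding f_def f'_def by (intro ell2_scale ell2_add x y)+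
    show "R (\<lambda>n. y n + (z - w) * x n) \<in> ell2" using R(1) f(1) f_def by simp
    have "(\<lambda>n. cmv_operator \<alpha> (\<lambda>n. R f n - R f' n) n - w * (R f n - R f' n)) = 
        (\<lambda>n. (cmv_operator \<alpha> (R f) n - w * R f n) - (cmv_operator \<alpha> (R f') n - w * R f' n))"
      by (simp add: cmv_operator_diff algebra_simps)
    also have "\<dots> = (\<lambda>n. f n - f' n)"
      using fun_cong[OF R(2)[OF f(1)]] fun_cong[OF R(2)[OF f(2)]] by simp
    also have "\<dots> = (\<lambda>n. (z - w) * (x n - x' n))" by (simp add: f_def f'_def algebra_simps)
    finally have "c * ell2_norm (\<lambda>n. R f n - R f' n) \<le> ell2_norm (\<lambda>n. (z - w) * (x n - x' n))"
      using below[OF ell2_diff(1)[OF R(1)[OF f(1)] R(1)[OF f(2)]]] by simp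
    also have "\<dots> = cmod (w - z) * ell2_norm (\<lambda>n. x n - x' n)"
      using ell2_scale(2)[OF ell2_diff(1)[OF x], of "z - w"] by (simp add: norm_minus_commute)
    finally show "ell2_norm (\<lambda>n. R (\<lambda>n. y n + (z - w) * x n) n - R (\<lambda>n. y n + (z - w) * x' n) n)
        \<le> cmod (w - z) / c * ell2_norm (\<lambda>n. x n - x' n)"
      using c0 by (simp add: f_def f'_def field_simps)
  qed (use c c0 in \<open>auto simp: field_simps\<close>)
  then obtain x where x: "x \<in> ell2" "R (\<lambda>n. y n + (z - w) * x n) = x" by blast
  have f: "(\<lambda>n. y n + (z - w) * x n) \<in> ell2" by (intro ell2_scale ell2_add x y)
  have "cmv_operator \<alpha> x n - z * x n = y n" for n
    using fun_cong[OF R(2)[OF f], of n] x(2) by (simp add: algebra_simps)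
  with x(1) show ?thesis by blast
qed

text \<open>A lower bound at \<open>z\<close> gives injectivity and boundedness of an inverse, so
  surjectivity is what remains. Inside the disk it is direct. Elsewhere \<open>z\<close> is moved
  radially outward, where the operator is onto, and \<open>cmv_minus_surj_near\<close> leads
  back.\<close>

theorem cmv_spectrum_eq:
  assumes \<alpha>: "\<forall>n. cmod (\<alpha> n) \<le> 1"
  shows "ell2_spectrum (cmv_operator \<alpha>) = approx_spectrum (cmv_operator \<alpha>)"
proof (intro set_eqI iffI)
  fix z assume z: "z \<in> approx_spectrum (cmv_operator \<alpha>)"
  show "z \<in> ell2_spectrum (cmv_operator \<alpha>)"
    unfolding ell2_spectrum_def
  proof (intro CollectI notI)
    assume "\<exists>R. ell2_bounded_operator R \<and>
      (\<forall>u\<in>ell2. R (\<lambda>n. cmv_operator \<alpha> u n - z * u n) = u \<and> (\<lambda>n. cmv_operator \<alpha> (R u) n - z * R u n) = u)"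
    then obtain R C where C: "\<And>u. u \<in> ell2 \<Longrightarrow> ell2_norm (R u) \<le> C * ell2_norm u"
      and R: "\<And>u. u \<in> ell2 \<Longrightarrow> R (\<lambda>n. cmv_operator \<alpha> u n - z * u n) = u"
      unfolding ell2_bounded_operator_def by blast
    \<comment> \<open>With this tolerance a left inverse bounded by \<open>C\<close> would give
      \<open>ell2_norm u \<le> ell2_norm u / 2\<close>.\<close>
    obtain u where u: "u \<in> ell2" "u \<noteq> (\<lambda>n. 0)"
      "ell2_norm (\<lambda>n. cmv_operator \<alpha> u n - z * u n) \<le> 1 / (2 * (\<bar>C\<bar> + 1)) * ell2_norm u"
      by (rule approx_spectrumE[OF z, of "1 / (2 * (\<bar>C\<bar> + 1))"]) auto
    have pos: "0 < ell2_norm u" using ell2_norm_pos u by blast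
    have "ell2_norm u \<le> C * ell2_norm (\<lambda>n. cmv_operator \<alpha> u n - z * u n)"
      using C[OF cmv_minus_ell2[of \<alpha> u z]] R[OF u(1)] \<alpha> u(1) by simp
    also have "\<dots> \<le> (\<bar>C\<bar> + 1) * ell2_norm (\<lambda>n. cmv_operator \<alpha> u n - z * u n)"
      by (intro mult_right_mono) auto
    also have "\<dots> \<le> (\<bar>C\<bar> + 1) * (1 / (2 * (\<bar>C\<bar> + 1)) * ell2_norm u)"
      by (intro mult_left_mono u(3)) auto
    also have "\<dots> = ell2_norm u / 2" by (simp add: field_simps)
    finally show False using pos by simp
  qed
next
  fix z assume "z \<in> ell2_spectrum (cmv_operator \<alpha>)"
  show "z \<in> approx_spectrum (cmv_operator \<alpha>)"
  proof (rule ccontr)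
    assume "z \<notin> approx_spectrum (cmv_operator \<alpha>)"
    then obtain c where c: "0 < c"
      "\<And>u. u \<in> ell2 \<Longrightarrow> c * ell2_norm u \<le> ell2_norm (\<lambda>n. cmv_operator \<alpha> u n - z * u n)"
      using not_approx_spectrumE cmv_operator_zero by metis
    have surj: "\<exists>x\<in>ell2. (\<lambda>n. cmv_operator \<alpha> x n - z * x n) = y" if y: "y \<in> ell2" for y
    proof (cases "cmod z < 1")
      case True
      with cmv_minus_surj_inside \<alpha> y show ?thesis by blast
    next
      case False
      \<comment> \<open>Chosen so that the outward move has length exactly \<open>c / 3\<close>: the
        lower bound loses that much, and the remaining \<open>2 * c / 3\<close> still exceeds the
        distance back to \<open>z\<close>.\<close>
      define \<eta> where "\<eta> = c / (3 * cmod z)"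
      have z0: "0 < cmod z" using False by linarith
      define w where "w = (1 + of_real \<eta>) * z"
      have \<eta>: "0 < \<eta>" using c z0 by (simp add: \<eta>_def)
      have "w - z = of_real \<eta> * z" by (simp add: w_def algebra_simps)
      then have wz: "cmod (w - z) = c / 3" using z0 c by (simp add: norm_mult norm_divide \<eta>_def)
      have "1 * 1 < (1 + \<eta>) * cmod z" using False \<eta> by (intro mult_less_le_imp_less) auto
      then have w1: "1 < cmod w" using \<eta> unfolding w_def norm_mult
        by (metis abs_of_pos add_pos_pos mult_1 norm_of_real of_real_1 of_real_add zero_less_one)
      have below: "2 * c / 3 * ell2_norm u \<le> ell2_norm (\<lambda>n. cmv_operator \<alpha> u n - w * u n)"
        if u: "u \<in> ell2" for u
      proof -
        have "(\<lambda>n. cmv_operator \<alpha> u n - w * u n) = (\<lambda>n. (cmv_operator \<alpha> u n - z * u n) - (w - z) * u n)"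
          by (simp add: algebra_simps)
        then have "ell2_norm (\<lambda>n. cmv_operator \<alpha> u n - z * u n) - ell2_norm (\<lambda>n. (w - z) * u n)
            \<le> ell2_norm (\<lambda>n. cmv_operator \<alpha> u n - w * u n)"
          using ell2_norm_triangle_lower[OF cmv_minus_ell2[of \<alpha> u z] ell2_scale(1)[OF u, of "w - z"]] \<alpha> u by simp
        then show ?thesis using c(2)[OF u] ell2_scale(2)[OF u, of "w - z"] wz by (simp add: algebra_simps)
      qed
      show ?thesis
        by (rule cmv_minus_surj_near[where w = w and c = "2 * c / 3"])
          (use \<alpha> c wz below cmv_minus_surj_outside[OF \<alpha> w1] y in auto)
    qed
    then obtain R where R: "\<And>y. y \<in> ell2 \<Longrightarrow> R y \<in> ell2"
      "\<And>y. y \<in> ell2 \<Longrightarrow> (\<lambda>n. cmv_operator \<alpha> (R y) n - z * R y n) = y" by metis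
    have inj: "x = x'" if x: "x \<in> ell2" "x' \<in> ell2"
      and eq: "(\<lambda>n. cmv_operator \<alpha> x n - z * x n) = (\<lambda>n. cmv_operator \<alpha> x' n - z * x' n)" for x x'
    proof -
      have "(\<lambda>n. cmv_operator \<alpha> (\<lambda>n. x n - x' n) n - z * (x n - x' n)) = (\<lambda>n. 0)"
        using fun_cong[OF eq] by (simp add: cmv_operator_diff fun_eq_iff algebra_simps)
      then have "c * ell2_norm (\<lambda>n. x n - x' n) \<le> 0"
        using c(2)[OF ell2_diff(1)[OF x]] by (simp add: ell2_zero)
      then have "ell2_norm (\<lambda>n. x n - x' n) = 0" 
        using c(1) ell2_norm_nonneg[of "\<lambda>n. x n - x' n"] by (simp add: mult_le_0_iff)
      then show ?thesis using ell2_norm_eq_0[OF ell2_diff(1)[OF x]] by (auto simp: fun_eq_iff)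
    qed
    \<comment> \<open>\<open>R\<close> was chosen pointwise; injectivity forces it to be
      linear.\<close>
    have "ell2_bounded_operator R"
      unfolding ell2_bounded_operator_def
    proof (intro conjI ballI allI)
      fix u v :: "int \<Rightarrow> complex" and d assume u: "u \<in> ell2" 
      show "R u \<in> ell2" by (rule R(1)[OF u])
      show "R (\<lambda>n. d * u n) = (\<lambda>n. d * R u n)"
      proof (rule inj)
        have "(\<lambda>n. cmv_operator \<alpha> (R (\<lambda>n. d * u n)) n - z * R (\<lambda>n. d * u n) n) = (\<lambda>n. d * u n)"
          by (rule R(2)[OF ell2_scale(1)[OF u]])
        also have "\<dots> = (\<lambda>n. d * (cmv_operator \<alpha> (R u) n - z * R u n))"
          using fun_cong[OF R(2)[OF u]] by simp
        also have "\<dots> = (\<lambda>n. cmv_operator \<alpha> (\<lambda>n. d * R u n) n - z * (d * R u n))"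
          by (simp add: cmv_operator_scale algebra_simps)
        finally show "(\<lambda>n. cmv_operator \<alpha> (R (\<lambda>n. d * u n)) n - z * R (\<lambda>n. d * u n) n) =
            (\<lambda>n. cmv_operator \<alpha> (\<lambda>n. d * R u n) n - z * (d * R u n))" .
      qed (intro R ell2_scale u)+
      assume v: "v \<in> ell2"
      show "R (\<lambda>n. u n + v n) = (\<lambda>n. R u n + R v n)"
      proof (rule inj)
        have "(\<lambda>n. cmv_operator \<alpha> (R (\<lambda>n. u n + v n)) n - z * R (\<lambda>n. u n + v n) n) = (\<lambda>n. u n + v n)"
          by (rule R(2)[OF ell2_add(1)[OF u v]])
        also have "\<dots> = (\<lambda>n. (cmv_operator \<alpha> (R u) n - z * R u n) + (cmv_operator \<alpha> (R v) n - z * R v n))"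
          using fun_cong[OF R(2)[OF u]] fun_cong[OF R(2)[OF v]] by simp
        also have "\<dots> = (\<lambda>n. cmv_operator \<alpha> (\<lambda>n. R u n + R v n) n - z * (R u n + R v n))"
          by (simp add: cmv_operator_add algebra_simps)
        finally show "(\<lambda>n. cmv_operator \<alpha> (R (\<lambda>n. u n + v n)) n - z * R (\<lambda>n. u n + v n) n) =
            (\<lambda>n. cmv_operator \<alpha> (\<lambda>n. R u n + R v n) n - z * (R u n + R v n))" .
      qed (intro R ell2_add u v)+
    next
      show "\<exists>C. \<forall>u\<in>ell2. ell2_norm (R u) \<le> C * ell2_norm u"
      proof (intro exI ballI)
        fix u :: "int \<Rightarrow> complex" assume u: "u \<in> ell2"
        show "ell2_norm (R u) \<le> 1 / c * ell2_norm u"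
          using c(2)[OF R(1)[OF u]] R(2)[OF u] c(1) by (simp add: field_simps)
      qed
    qed
    moreover have "R (\<lambda>n. cmv_operator \<alpha> u n - z * u n) = u" if u: "u \<in> ell2" for u
      by (rule inj) (use R cmv_minus_ell2[of \<alpha> u z] \<alpha> u in auto)
    ultimately have "z \<notin> ell2_spectrum (cmv_operator \<alpha>)"
      using R(2) unfolding ell2_spectrum_def by blast
    then show False using \<open>z \<in> ell2_spectrum (cmv_operator \<alpha>)\<close> by blast
  qed
qed

lemma approx_spectrum_circle:
  assumes \<alpha>: "\<forall>n. cmod (\<alpha> n) \<le> 1"
  shows "approx_spectrum (cmv_operator \<alpha>) \<subseteq> sphere 0 1"
proof
  fix z assume z: "z \<in> approx_spectrum (cmv_operator \<alpha>)"
  have "\<bar>1 - cmod z\<bar> \<le> e" if e: "0 < e" for e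
  proof -
    obtain u where u: "u \<in> ell2" "u \<noteq> (\<lambda>n. 0)" "ell2_norm (\<lambda>n. cmv_operator \<alpha> u n - z * u n) \<le> e * ell2_norm u"
      using approx_spectrumE[OF z e] by metis
    have "ell2_norm (cmv_operator \<alpha> u) - ell2_norm (\<lambda>n. z * u n) \<le> ell2_norm (\<lambda>n. cmv_operator \<alpha> u n - z * u n)"
      by (rule ell2_norm_triangle_lower) (intro cmv_operator_ell2 ell2_scale \<alpha> u)+
    moreover have "ell2_norm (\<lambda>n. z * u n) - ell2_norm (cmv_operator \<alpha> u) \<le> ell2_norm (\<lambda>n. cmv_operator \<alpha> u n - z * u n)"
      using ell2_norm_triangle_lower[OF ell2_scale(1)[OF u(1)] cmv_operator_ell2(1)[OF \<alpha> u(1)], of z]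
        ell2_scale(2)[OF cmv_minus_ell2[OF \<alpha> u(1), of z], of "-1"] by simp
    ultimately have "\<bar>1 - cmod z\<bar> * ell2_norm u \<le> e * ell2_norm u"
      using u(3) cmv_operator_ell2(2)[OF \<alpha> u(1)] ell2_scale(2)[OF u(1), of z]
      by (simp add: abs_if algebra_simps)
    then show ?thesis using ell2_norm_pos[OF u(1,2)] by simp
  qed
  then have "\<bar>1 - cmod z\<bar> \<le> 0" by (rule field_le_epsilon[of _ 0, simplified])
  then show "z \<in> sphere 0 1" by simp
qed

section \<open>Dependence of the spectrum on the coefficients\<close>

lemma sqrt_diff_le:
  assumes "0 \<le> x" "0 \<le> y"
  shows "\<bar>sqrt x - sqrt y\<bar> \<le> sqrt \<bar>x - y\<bar>"
proof -
  have *: "sqrt a \<le> sqrt b + sqrt (a - b)" if "0 \<le> b" "b \<le> a" for a b :: real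
    using sqrt_add_le_add_sqrt[of b "a - b"] that by simp
  show ?thesis using *[of x y] *[of y x] assms by (cases "x \<le> y") (auto simp: abs_if)
qed

text \<open>Coefficients of modulus up to 1 are allowed, and there \<rho> is only Hoelder continuous
  of exponent one half; hence the square root in the coefficient estimates below.\<close>

lemma cmv_\<rho>_diff:
  assumes "cmod (\<alpha> n) \<le> 1" "cmod (\<beta> n) \<le> 1" "cmod (\<alpha> n - \<beta> n) \<le> d"
  shows "cmod (cmv_\<rho> \<alpha> n - cmv_\<rho> \<beta> n) \<le> sqrt (2 * d)"
proof -
  have "(1 - (cmod (\<alpha> n))\<^sup>2) - (1 - (cmod (\<beta> n))\<^sup>2) = (cmod (\<beta> n) - cmod (\<alpha> n)) * (cmod (\<alpha> n) + cmod (\<beta> n))"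
    by (simp add: power2_eq_square algebra_simps)
  then have "\<bar>(1 - (cmod (\<alpha> n))\<^sup>2) - (1 - (cmod (\<beta> n))\<^sup>2)\<bar> = \<bar>cmod (\<beta> n) - cmod (\<alpha> n)\<bar> * (cmod (\<alpha> n) + cmod (\<beta> n))"
    by (simp add: abs_mult)
  also have "\<dots> \<le> d * 2"
    using assms norm_triangle_ineq3[of "\<beta> n" "\<alpha> n"] by (intro mult_mono) (auto simp: norm_minus_commute)
  finally have "sqrt \<bar>(1 - (cmod (\<alpha> n))\<^sup>2) - (1 - (cmod (\<beta> n))\<^sup>2)\<bar> \<le> sqrt (2 * d)"
    by simp
  moreover have "0 \<le> 1 - (cmod (\<alpha> n))\<^sup>2" "0 \<le> 1 - (cmod (\<beta> n))\<^sup>2"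
    using assms by (simp_all add: power_le_one)
  ultimately have "\<bar>sqrt (1 - (cmod (\<alpha> n))\<^sup>2) - sqrt (1 - (cmod (\<beta> n))\<^sup>2)\<bar> \<le> sqrt (2 * d)"
    using sqrt_diff_le[of "1 - (cmod (\<alpha> n))\<^sup>2" "1 - (cmod (\<beta> n))\<^sup>2"] by linarith
  then show ?thesis by (simp add: cmv_\<rho>_def flip: of_real_diff)
qed

lemma theta_block_coeff_diff:
  assumes \<alpha>: "\<forall>n. cmod (\<alpha> n) \<le> 1" and \<beta>: "\<forall>n. cmod (\<beta> n) \<le> 1"
    and d: "\<forall>n. cmod (\<alpha> n - \<beta> n) \<le> d" and u: "u \<in> ell2"
  shows "ell2_norm (\<lambda>n. theta_block e \<alpha> u n - theta_block e \<beta> u n) \<le> 3 * (d + sqrt (2 * d)) * ell2_norm u"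
proof -
  have d0: "0 \<le> d" using d norm_ge_zero order_trans by blast
  define D where "D = d + sqrt (2 * d)"
  have D: "cmod (\<alpha> n - \<beta> n) \<le> D" "cmod (cnj (\<alpha> n) - cnj (\<beta> n)) \<le> D" "cmod (cmv_\<rho> \<alpha> n - cmv_\<rho> \<beta> n) \<le> D" for n
    using d[rule_format, of n] cmv_\<rho>_diff[of \<alpha> n \<beta> d] \<alpha> \<beta> d0 unfolding D_def
    by (auto simp flip: complex_cnj_diff intro: add_increasing add_increasing2)
  have D0: "0 \<le> D" using d0 by (simp add: D_def)
  have "ell2_norm (\<lambda>n. theta_block e \<alpha> u n - theta_block e \<beta> u n) \<le> D * real (card {-1, 0, 1::int}) * ell2_norm u"
  proof (rule ell2_dominated(2)[OF u])
    fix n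
    have a: "cmod ((cnj (\<alpha> n) - cnj (\<beta> n)) * u n + (cmv_\<rho> \<alpha> n - cmv_\<rho> \<beta> n) * u (n + 1)) \<le> D * cmod (u n) + D * cmod (u (n + 1))"
      by (rule order_trans[OF norm_triangle_ineq]) (auto simp: norm_mult intro!: add_mono mult_right_mono D)
    have b: "cmod ((cmv_\<rho> \<alpha> (n - 1) - cmv_\<rho> \<beta> (n - 1)) * u (n - 1) - (\<alpha> (n - 1) - \<beta> (n - 1)) * u n)
        \<le> D * cmod (u (n - 1)) + D * cmod (u n)"
      by (rule order_trans[OF norm_triangle_ineq4]) (auto simp: norm_mult intro!: add_mono mult_right_mono D)
    have "D * cmod (u n) + D * cmod (u (n + 1)) \<le> D * (\<Sum>j\<in>{- 1, 0, 1}. cmod (u (n + j)))"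
      "D * cmod (u (n - 1)) + D * cmod (u n) \<le> D * (\<Sum>j\<in>{- 1, 0, 1}. cmod (u (n + j)))"
      using D0 by (simp_all add: distrib_left)
    with a b show "cmod (theta_block e \<alpha> u n - theta_block e \<beta> u n) \<le> D * (\<Sum>j\<in>{- 1, 0, 1}. cmod (u (n + j)))"
      by (auto simp: theta_block_def algebra_simps)
  qed (rule D0)
  then show ?thesis by (simp add: D_def algebra_simps)
qed

text \<open>Telescoping: \<open>L M - L' M' = (L - L') M + L' (M - M')\<close>, where
  \<open>M\<close> and \<open>L'\<close> are isometric.\<close>

lemma cmv_operator_coeff_diff:
  assumes \<alpha>: "\<forall>n. cmod (\<alpha> n) \<le> 1" and \<beta>: "\<forall>n. cmod (\<beta> n) \<le> 1"
    and d: "\<forall>n. cmod (\<alpha> n - \<beta> n) \<le> d" and u: "u \<in> ell2"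
  shows "ell2_norm (\<lambda>n. cmv_operator \<alpha> u n - cmv_operator \<beta> u n) \<le> 6 * (d + sqrt (2 * d)) * ell2_norm u"
proof -
  let ?v = "theta_block False \<alpha> u" and ?v' = "theta_block False \<beta> u"
  have v: "?v \<in> ell2" "?v' \<in> ell2" by (intro theta_block_ell2 \<alpha> \<beta> u)+
  have "(\<lambda>n. cmv_operator \<alpha> u n - cmv_operator \<beta> u n) =
     (\<lambda>n. (theta_block True \<alpha> ?v n - theta_block True \<beta> ?v n) + theta_block True \<beta> (\<lambda>n. ?v n - ?v' n) n)"
    by (simp add: cmv_operator_factor theta_block_diff)
  then have "ell2_norm (\<lambda>n. cmv_operator \<alpha> u n - cmv_operator \<beta> u n) \<le>
     ell2_norm (\<lambda>n. theta_block True \<alpha> ?v n - theta_block True \<beta> ?v n) + ell2_norm (theta_block True \<beta> (\<lambda>n. ?v n - ?v' n))"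
    using ell2_add(2)[OF ell2_diff(1)[OF theta_block_ell2(1)[OF \<alpha> v(1)] theta_block_ell2(1)[OF \<beta> v(1)]]
      theta_block_ell2(1)[OF \<beta> ell2_diff(1)[OF v]]] by simp
  also have "\<dots> \<le> 3 * (d + sqrt (2 * d)) * ell2_norm u + 3 * (d + sqrt (2 * d)) * ell2_norm u"
    using theta_block_coeff_diff[OF \<alpha> \<beta> d v(1), where e = True] theta_block_coeff_diff[OF \<alpha> \<beta> d u, where e = False]
      theta_block_ell2(2)[OF \<beta> ell2_diff(1)[OF v]] theta_block_ell2(2)[OF \<alpha> u] by (intro add_mono) simp_all
  finally show ?thesis by (simp add: algebra_simps)
qed

text \<open>Joint semicontinuity in the coefficients and the spectral parameter: an approximate
  eigenvector of a late member of the sequence serves for the limit. Constant coefficient sequences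
  yield closedness.\<close>

lemma approx_spectrum_limit:
  assumes \<alpha>: "\<forall>n. cmod (\<alpha> n) \<le> 1" and \<beta>: "\<And>k. \<forall>n. cmod (\<beta> k n) \<le> 1"
    and d: "\<And>k. \<forall>n. cmod (\<beta> k n - \<alpha> n) \<le> d k" "d \<longlonglongrightarrow> 0"
    and z: "\<And>k. z k \<in> approx_spectrum (cmv_operator (\<beta> k))" "z \<longlonglongrightarrow> z'"
  shows "z' \<in> approx_spectrum (cmv_operator \<alpha>)"
proof (rule approx_spectrumI)
  fix e :: real assume e: "0 < e"
  have "(\<lambda>k. 6 * (d k + sqrt (2 * d k)) + cmod (z k - z')) \<longlonglongrightarrow> 6 * (0 + sqrt (2 * 0)) + cmod (z' - z')"
    by (intro tendsto_intros d z)
  then have "\<forall>\<^sub>F k in sequentially. 6 * (d k + sqrt (2 * d k)) + cmod (z k - z') < e / 2"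
    using e by (intro order_tendstoD) auto
  then obtain k where k: "6 * (d k + sqrt (2 * d k)) + cmod (z k - z') < e / 2"
    by (auto simp: eventually_sequentially)
  obtain u where u: "u \<in> ell2" "u \<noteq> (\<lambda>n. 0)"
      "ell2_norm (\<lambda>n. cmv_operator (\<beta> k) u n - z k * u n) \<le> e / 2 * ell2_norm u"
    using approx_spectrumE[OF z(1), of "e / 2"] e by auto
  have E: "cmv_operator \<alpha> u \<in> ell2" "cmv_operator (\<beta> k) u \<in> ell2" by (intro cmv_operator_ell2 \<alpha> \<beta> u)+
  have "(\<lambda>n. cmv_operator \<alpha> u n - z' * u n) = (\<lambda>n. (cmv_operator (\<beta> k) u n - z k * u n) +
      ((z k - z') * u n - (cmv_operator (\<beta> k) u n - cmv_operator \<alpha> u n)))"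
    by (simp add: algebra_simps)
  then have h1: "ell2_norm (\<lambda>n. cmv_operator \<alpha> u n - z' * u n) \<le> ell2_norm (\<lambda>n. cmv_operator (\<beta> k) u n - z k * u n)
      + ell2_norm (\<lambda>n. (z k - z') * u n - (cmv_operator (\<beta> k) u n - cmv_operator \<alpha> u n))"
    using ell2_add(2)[OF ell2_diff(1)[OF E(2) ell2_scale(1)[OF u(1)]]
        ell2_diff(1)[OF ell2_scale(1)[OF u(1)] ell2_diff(1)[OF E(2) E(1)]], of "z k" "z k - z'"] by simp
  have h2: "ell2_norm (\<lambda>n. (z k - z') * u n - (cmv_operator (\<beta> k) u n - cmv_operator \<alpha> u n))
      \<le> cmod (z k - z') * ell2_norm u + 6 * (d k + sqrt (2 * d k)) * ell2_norm u"
    using ell2_diff(2)[OF ell2_scale(1)[OF u(1)] ell2_diff(1)[OF E(2) E(1)], of "z k - z'"]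
      ell2_scale(2)[OF u(1), of "z k - z'"] cmv_operator_coeff_diff[OF \<beta> \<alpha> d(1) u(1), of k] by linarith
  have "(6 * (d k + sqrt (2 * d k)) + cmod (z k - z')) * ell2_norm u \<le> e / 2 * ell2_norm u"
    using k by (intro mult_right_mono) auto
  then have "6 * (d k + sqrt (2 * d k)) * ell2_norm u + cmod (z k - z') * ell2_norm u \<le> e / 2 * ell2_norm u"
    unfolding distrib_right[of _ "cmod (z k - z')"] .
  with h1 h2 u(3) have "ell2_norm (\<lambda>n. cmv_operator \<alpha> u n - z' * u n) \<le> e / 2 * ell2_norm u + e / 2 * ell2_norm u"
    by linarith
  then have "ell2_norm (\<lambda>n. cmv_operator \<alpha> u n - z' * u n) \<le> e * ell2_norm u" by simp
  with u(1,2) show "\<exists>u\<in>ell2. u \<noteq> (\<lambda>n. 0) \<and> ell2_norm (\<lambda>n. cmv_operator \<alpha> u n - z' * u n) \<le> e * ell2_norm u"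
    by (intro bexI[of _ u] conjI)
qed

lemma closed_approx_spectrum:
  assumes "\<forall>n. cmod (\<alpha> n) \<le> 1"
  shows "closed (approx_spectrum (cmv_operator \<alpha>))"
  unfolding closed_sequential_limits
proof (intro allI impI, elim conjE)
  fix x l assume "\<forall>n. x n \<in> approx_spectrum (cmv_operator \<alpha>)" "x \<longlonglongrightarrow> l"
  note xl = this
  show "l \<in> approx_spectrum (cmv_operator \<alpha>)"
    by (rule approx_spectrum_limit[OF assms, of "\<lambda>k. \<alpha>" "\<lambda>k. 0" x]) (use assms xl in auto)
qed

text \<open>Compactness of the circle turns a sequence of counterexamples into a limit point that
  \<open>approx_spectrum_limit\<close> forbids; the radius \<open>d\<close> thus serves all \<beta>
  at once.\<close>

lemma approx_spectrum_upper_semicontinuous: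
  assumes \<alpha>: "\<forall>n. cmod (\<alpha> n) \<le> 1" and \<eta>: "0 < \<eta>"
  obtains d where "0 < d" "\<And>\<beta>. (\<forall>n. cmod (\<beta> n) \<le> 1) \<Longrightarrow> (\<forall>n. cmod (\<beta> n - \<alpha> n) \<le> d) \<Longrightarrow>
     approx_spectrum (cmv_operator \<beta>) \<subseteq> (\<Union>x\<in>approx_spectrum (cmv_operator \<alpha>). ball x \<eta>)"
proof (rule ccontr)
  assume no: "\<not> thesis"
  let ?K = "approx_spectrum (cmv_operator \<alpha>)"
  have "\<exists>\<beta> z. (\<forall>n. cmod (\<beta> n) \<le> 1) \<and> (\<forall>n. cmod (\<beta> n - \<alpha> n) \<le> inverse (real (Suc k)))
      \<and> z \<in> approx_spectrum (cmv_operator \<beta>) \<and> z \<notin> (\<Union>x\<in>?K. ball x \<eta>)" for k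
  proof -
    have "0 < inverse (real (Suc k))" by simp
    with no that[of "inverse (real (Suc k))"] show ?thesis by blast
  qed
  then obtain \<beta> z where \<beta>: "\<And>k. \<forall>n. cmod (\<beta> k n) \<le> 1" "\<And>k. \<forall>n. cmod (\<beta> k n - \<alpha> n) \<le> inverse (real (Suc k))"
    and z: "\<And>k. z k \<in> approx_spectrum (cmv_operator (\<beta> k))" "\<And>k. z k \<notin> (\<Union>x\<in>?K. ball x \<eta>)"
    by metis
  have "z k \<in> sphere 0 1" for k using approx_spectrum_circle[OF \<beta>(1)] z(1) by blast
  then obtain l r where l: "strict_mono r" "(z \<circ> r) \<longlonglongrightarrow> l"
    using compact_sphere[of "0::complex" 1] unfolding compact_def by blast
  have "l \<in> ?K"
  proof (rule approx_spectrum_limit[OF \<alpha>])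
    show "(\<lambda>k. inverse (real (Suc (r k)))) \<longlonglongrightarrow> 0"
      using LIMSEQ_subseq_LIMSEQ[OF LIMSEQ_inverse_real_of_nat l(1)] by (simp add: o_def)
    show "(\<lambda>k. z (r k)) \<longlonglongrightarrow> l" using l(2) by (simp add: o_def)
  qed (use \<beta> z in auto)
  moreover have "\<forall>\<^sub>F k in sequentially. z (r k) \<in> ball l \<eta>"
    using tendstoD[OF l(2) \<eta>] by (simp add: o_def dist_commute)
  then obtain k where "z (r k) \<in> ball l \<eta>" by (auto simp: eventually_sequentially)
  ultimately show False using z(2) by blast
qed

section \<open>Szego transfer matrices\<close>

text \<open>A pair \<open>(a, b)\<close> stands for the matrix \<open>[[a, b], [cnj b, cnj a]]\<close>.\<close>

definition su_mul :: "complex \<times> complex \<Rightarrow> complex \<times> complex \<Rightarrow> complex \<times> complex" where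
  "su_mul X Y = (fst X * fst Y + snd X * cnj (snd Y), fst X * snd Y + snd X * cnj (fst Y))"

definition su_apply :: "complex \<times> complex \<Rightarrow> complex \<times> complex \<Rightarrow> complex \<times> complex" where
  "su_apply X v = (fst X * fst v + snd X * snd v, cnj (snd X) * fst v + cnj (fst X) * snd v)"

definition SU11 :: "(complex \<times> complex) set" where
  "SU11 = {X. fst X * cnj (fst X) - snd X * cnj (snd X) = 1}"

definition szego_\<rho> :: "complex \<Rightarrow> complex" where
  "szego_\<rho> a = of_real (sqrt (1 - (cmod a)\<^sup>2))"

text \<open>The Szego transfer matrix at spectral parameter \<open>\<zeta>\<^sup>2\<close>. Working
  with the square root \<zeta> normalises the determinant to 1, so that the matrix lies in
  \<open>SU11\<close> for unimodular \<zeta>.\<close>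

definition szego :: "complex \<Rightarrow> complex \<Rightarrow> complex \<times> complex" where
  "szego \<zeta> a = (cnj \<zeta> / szego_\<rho> a, - a / szego_\<rho> a)"

primrec transfer :: "complex \<Rightarrow> (int \<Rightarrow> complex) \<Rightarrow> int \<Rightarrow> nat \<Rightarrow> complex \<times> complex" where
  "transfer \<zeta> \<alpha> n 0 = (1, 0)"
| "transfer \<zeta> \<alpha> n (Suc k) = su_mul (szego \<zeta> (\<alpha> (n + int k))) (transfer \<zeta> \<alpha> n k)"

definition discriminant :: "complex \<Rightarrow> (int \<Rightarrow> complex) \<Rightarrow> nat \<Rightarrow> real" where
  "discriminant \<zeta> \<alpha> p = 2 * Re (fst (transfer \<zeta> \<alpha> 0 p))"

lemma cmv_\<rho>_szego: "cmv_\<rho> \<alpha> n = szego_\<rho> (\<alpha> n)"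
  by (simp add: cmv_\<rho>_def szego_\<rho>_def)

lemma szego_\<rho>:
  assumes "cmod a < 1"
  shows "szego_\<rho> a \<noteq> 0" "cnj (szego_\<rho> a) = szego_\<rho> a" "szego_\<rho> a * szego_\<rho> a = 1 - a * cnj a"
proof -
  have a: "(cmod a)\<^sup>2 < 1" using assms by (simp add: power_less_one_iff)
  then show "szego_\<rho> a \<noteq> 0" by (simp add: szego_\<rho>_def)
  show "cnj (szego_\<rho> a) = szego_\<rho> a" by (simp add: szego_\<rho>_def)
  have "szego_\<rho> a * szego_\<rho> a = of_real (1 - (cmod a)\<^sup>2)"
    using a by (simp add: szego_\<rho>_def flip: of_real_mult)
  then show "szego_\<rho> a * szego_\<rho> a = 1 - a * cnj a"
    by (simp only: of_real_diff of_real_1 complex_norm_square)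
qed

lemma su_mul_assoc: "su_mul (su_mul X Y) Z = su_mul X (su_mul Y Z)"
  by (simp add: su_mul_def algebra_simps)

lemma su_mul_one [simp]: "su_mul (1, 0) X = X" "su_mul X (1, 0) = X"
  by (simp_all add: su_mul_def)

lemma su_apply_mul: "su_apply (su_mul X Y) v = su_apply X (su_apply Y v)"
  by (simp add: su_mul_def su_apply_def algebra_simps)

lemma su_apply_one [simp]: "su_apply (1, 0) v = v"
  by (simp add: su_apply_def)

lemma su_apply_diff: "su_apply X (v - w) = su_apply X v - su_apply X w"
  by (simp add: su_apply_def algebra_simps)

lemma su_trace_commute: "Re (fst (su_mul X Y)) = Re (fst (su_mul Y X))"
  by (simp add: su_mul_def algebra_simps)

lemma SU11_mul:
  assumes "X \<in> SU11" "Y \<in> SU11"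
  shows "su_mul X Y \<in> SU11"
proof -
  have "fst (su_mul X Y) * cnj (fst (su_mul X Y)) - snd (su_mul X Y) * cnj (snd (su_mul X Y)) =
    (fst X * cnj (fst X) - snd X * cnj (snd X)) * (fst Y * cnj (fst Y) - snd Y * cnj (snd Y))"
    by (simp add: su_mul_def algebra_simps)
  then show ?thesis using assms by (simp add: SU11_def)
qed

lemma szego_SU11:
  assumes "cmod \<zeta> = 1" "cmod a < 1"
  shows "szego \<zeta> a \<in> SU11"
proof -
  have "\<zeta> * cnj \<zeta> = 1" using assms(1) by (simp add: complex_norm_square[symmetric])
  moreover have "szego_\<rho> a * szego_\<rho> a \<noteq> 0" using szego_\<rho>(1)[OF assms(2)] by simp
  ultimately have "cnj \<zeta> * \<zeta> / (szego_\<rho> a * szego_\<rho> a) - a * cnj a / (szego_\<rho> a * szego_\<rho> a) = 1"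
    using szego_\<rho>(3)[OF assms(2)] by (simp add: diff_divide_distrib[symmetric] mult.commute)
  then show ?thesis
    using szego_\<rho>[OF assms(2)] by (simp add: SU11_def szego_def)
qed

lemma transfer_SU11:
  assumes "cmod \<zeta> = 1" "\<forall>n. cmod (\<alpha> n) < 1"
  shows "transfer \<zeta> \<alpha> n k \<in> SU11"
proof (induction k)
  case (Suc k)
  then show ?case using assms by (simp add: SU11_mul szego_SU11)
qed (simp add: SU11_def)

lemma transfer_first:
  "transfer \<zeta> \<alpha> n (Suc k) = su_mul (transfer \<zeta> \<alpha> (n + 1) k) (szego \<zeta> (\<alpha> n))"
proof (induction k)
  case (Suc k)
  have "n + int (Suc k) = n + 1 + int k" by simp
  then show ?case
    using Suc by (simp only: transfer.simps(2) su_mul_assoc)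
qed simp

lemma transfer_cong:
  assumes "\<And>j. j < k \<Longrightarrow> \<alpha> (n + int j) = \<beta> (m + int j)"
  shows "transfer \<zeta> \<alpha> n k = transfer \<zeta> \<beta> m k"
  using assms by (induction k) simp_all

lemma transfer_add:
  "transfer \<zeta> \<alpha> n (k + m) = su_mul (transfer \<zeta> \<alpha> (n + int k) m) (transfer \<zeta> \<alpha> n k)"
  by (induction m) (simp_all add: su_mul_assoc add.assoc)

lemma periodic_mod:
  fixes \<alpha> :: "int \<Rightarrow> 'a"
  assumes "\<forall>n. \<alpha> (n + p) = \<alpha> n"
  shows "\<alpha> (n mod p) = \<alpha> n"
proof -
  have a: "\<alpha> (n + int k * p) = \<alpha> n" for n k
  proof (induction k)
    case (Suc k)
    have "\<alpha> (n + int (Suc k) * p) = \<alpha> ((n + int k * p) + p)" by (simp add: algebra_simps)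
    then show ?case using assms Suc by metis
  qed simp
  have "\<alpha> (n + k * p) = \<alpha> n" for n k
  proof (cases "k \<ge> 0")
    case True
    then show ?thesis using a[of n "nat k"] by simp
  next
    case False
    then show ?thesis using a[of "n + k * p" "nat (- k)"] by simp
  qed
  from this[of "n mod p" "n div p"] show ?thesis by simp
qed

text \<open>Moving the starting site by one permutes the factors of the monodromy cyclically, which
  preserves the trace.\<close>

lemma discriminant_shift:
  assumes "\<forall>n. \<alpha> (n + int p) = \<alpha> n" "0 < p"
  shows "2 * Re (fst (transfer \<zeta> \<alpha> n p)) = discriminant \<zeta> \<alpha> p"
proof -
  have step: "Re (fst (transfer \<zeta> \<alpha> (n + 1) p)) = Re (fst (transfer \<zeta> \<alpha> n p))" for n
  proof -
    obtain q where q: "p = Suc q" using assms(2) gr0_conv_Suc by blast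
    have "\<alpha> (n + 1 + int q) = \<alpha> n" using assms(1)[rule_format, of n] by (simp add: q algebra_simps)
    then have "transfer \<zeta> \<alpha> (n + 1) p = su_mul (szego \<zeta> (\<alpha> n)) (transfer \<zeta> \<alpha> (n + 1) q)"
      by (simp add: q)
    then show ?thesis
      unfolding q transfer_first[of \<zeta> \<alpha> n] by (metis su_trace_commute)
  qed
  show ?thesis unfolding discriminant_def
  proof (induction n rule: int_induct[where k = 0])
    case (step1 i)
    then show ?case using step[of i] by simp
  next
    case (step2 i)
    then show ?case using step[of "i - 1"] by simp
  qed simp
qed

text \<open>The Cayley-Hamilton identity for determinant 1. It converts the monodromy into a
  three-term recursion without choosing eigenvectors.\<close>

lemma su_cayley_hamilton:
  assumes "X \<in> SU11"
  shows "su_apply X (su_apply X v) - (2 * Re (fst X)) *\<^sub>R su_apply X v + v = 0"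
proof -
  obtain a b x y where X: "X = (a, b)" "v = (x, y)" by (metis surj_pair)
  have d: "b * cnj b = a * cnj a - 1" using assms by (simp add: SU11_def X algebra_simps)
  have t: "complex_of_real (2 * Re a) = a + cnj a" by (simp add: complex_add_cnj)
  have "a * (a * x + b * y) + b * (cnj b * x + cnj a * y) - (a + cnj a) * (a * x + b * y) + x
      = (b * cnj b) * x - a * cnj a * x + x" by (simp add: algebra_simps)
  also have "\<dots> = 0" unfolding d by (simp add: algebra_simps)
  finally have 1: "a * (a * x + b * y) + b * (cnj b * x + cnj a * y) - (a + cnj a) * (a * x + b * y) + x = 0" .
  have "cnj b * (a * x + b * y) + cnj a * (cnj b * x + cnj a * y) - (a + cnj a) * (cnj b * x + cnj a * y) + y
      = (b * cnj b) * y - a * cnj a * y + y" by (simp add: algebra_simps)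
  also have "\<dots> = 0" unfolding d by (simp add: algebra_simps)
  finally have 2: "cnj b * (a * x + b * y) + cnj a * (cnj b * x + cnj a * y) - (a + cnj a) * (cnj b * x + cnj a * y) + y = 0" .
  show ?thesis using 1 2
    by (simp add: X su_apply_def scaleR_conv_of_real t zero_prod_def del: of_real_mult)
qed

lemma norm_su_apply_le: "norm (su_apply X v) \<le> (cmod (fst X) + cmod (snd X)) * norm v"
proof -
  obtain a b x y where X: "X = (a, b)" "v = (x, y)" by (metis surj_pair)
  have "su_apply X v = (a * x, cnj a * y) + (b * y, cnj b * x)" by (simp add: X su_apply_def)
  also have "norm \<dots> \<le> norm (a * x, cnj a * y) + norm (b * y, cnj b * x)" by (rule norm_triangle_ineq)
  also have "norm (a * x, cnj a * y) = cmod a * norm v"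
    by (simp add: X norm_Pair norm_mult power_mult_distrib real_sqrt_mult flip: distrib_left)
  also have "norm (b * y, cnj b * x) = cmod b * norm v"
    by (simp add: X norm_Pair norm_mult power_mult_distrib real_sqrt_mult add.commute flip: distrib_left)
  finally show ?thesis by (simp add: X algebra_simps)
qed

lemma periodic_range_finite:
  fixes \<alpha> :: "int \<Rightarrow> 'a"
  assumes "\<forall>n. \<alpha> (n + int p) = \<alpha> n" "0 < p"
  shows "finite (range \<alpha>)"
proof -
  have "range \<alpha> \<subseteq> \<alpha> ` {0..<int p}"
  proof
    fix x assume "x \<in> range \<alpha>"
    then obtain n where "x = \<alpha> n" by auto
    then have "x = \<alpha> (n mod int p)" using periodic_mod[OF assms(1)] by simp
    then show "x \<in> \<alpha> ` {0..<int p}" using assms(2) by auto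
  qed
  then show ?thesis by (meson finite_atLeastLessThan_int finite_imageI finite_subset)
qed

lemma periodic_bdd:
  fixes \<alpha> :: "int \<Rightarrow> 'a" and f :: "'a \<Rightarrow> real"
  assumes "\<forall>n. \<alpha> (n + int p) = \<alpha> n" "0 < p"
  obtains B where "1 \<le> B" "\<And>n. f (\<alpha> n) \<le> B"
proof -
  have "finite (f ` range \<alpha>)" using periodic_range_finite[OF assms] by blast
  then obtain B where "\<forall>x\<in>f ` range \<alpha>. x \<le> B" using bdd_above_finite unfolding bdd_above_def by blast
  then show ?thesis using that[of "max 1 B"] by (simp add: le_max_iff_disj)
qed

section \<open>From the eigenvalue equation to the Szego recursion\<close>

text \<open>Exchanging the two entries at odd sites makes one and the same recursion hold at every site,
  although the CMV matrix distinguishes even from odd rows.\<close>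

definition cmv_state :: "complex \<Rightarrow> (int \<Rightarrow> complex) \<Rightarrow> (int \<Rightarrow> complex) \<Rightarrow> int \<Rightarrow> complex \<times> complex" where
  "cmv_state \<zeta> \<alpha> u n = (if even n then (theta_block False \<alpha> u n, \<zeta> * u n)
     else (\<zeta> * u n, theta_block False \<alpha> u n))"

text \<open>With \<open>f\<close> the residual of the eigenvalue equation, an odd step rewrites the
  definition of \<open>theta_block False \<alpha> u\<close> and is exact. An even step uses the
  other factor, and only there does \<open>f\<close> enter, at both sites of the block.\<close>

lemma cmv_state_step:
  assumes z: "cmod \<zeta> = 1" and a: "\<forall>n. cmod (\<alpha> n) < 1"
  defines "f \<equiv> \<lambda>u n. cmv_operator \<alpha> u n - \<zeta>\<^sup>2 * u n"
  shows "cmv_state \<zeta> \<alpha> u (n + 1) - su_apply (szego \<zeta> (\<alpha> n)) (cmv_state \<zeta> \<alpha> u n) =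
    (if even n then (cnj \<zeta> * (- \<alpha> n * f u n / szego_\<rho> (\<alpha> n) - f u (n + 1)), f u n / szego_\<rho> (\<alpha> n)) else 0)"
proof -
  define v where "v = theta_block False \<alpha> u"
  define r where "r = szego_\<rho> (\<alpha> n)"
  have r: "r \<noteq> 0" "cnj r = r" "r * r = 1 - \<alpha> n * cnj (\<alpha> n)"
    using szego_\<rho>[OF a[rule_format, of n]] by (simp_all add: r_def)
  have s1: "\<alpha> n * cnj (\<alpha> n) + r * r = 1" using r(3) by simp
  have zz: "cnj \<zeta> * \<zeta> = 1" using z by (simp add: complex_norm_square[symmetric] mult.commute)
  have f: "f u = (\<lambda>n. theta_block True \<alpha> v n - \<zeta>\<^sup>2 * u n)" by (simp add: f_def v_def cmv_operator_factor)
  show ?thesis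
  proof (cases "even n")
    case True
    have fn: "f u n = cnj (\<alpha> n) * v n + r * v (n + 1) - \<zeta>\<^sup>2 * u n"
      "f u (n + 1) = r * v n - \<alpha> n * v (n + 1) - \<zeta>\<^sup>2 * u (n + 1)"
      using True by (simp_all add: f theta_block_def cmv_\<rho>_szego r_def)
    have "cnj \<zeta> * (- \<alpha> n * f u n / r - f u (n + 1)) =
        (cnj \<zeta> * \<zeta>) * \<zeta> * u (n + 1) + (cnj \<zeta> * \<zeta>) * \<zeta> * \<alpha> n * u n / r - cnj \<zeta> * v n * ((\<alpha> n * cnj (\<alpha> n) + r * r) / r)"
      unfolding fn using r(1) by (simp add: field_simps power2_eq_square)
    also have "\<dots> = \<zeta> * u (n + 1) - (cnj \<zeta> / r * v n + - \<alpha> n / r * (\<zeta> * u n))"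
      unfolding s1 by (simp add: zz)
    finally have 1: "\<zeta> * u (n + 1) - (cnj \<zeta> / r * v n + - \<alpha> n / r * (\<zeta> * u n)) = cnj \<zeta> * (- \<alpha> n * f u n / r - f u (n + 1))" by simp
    have 2: "v (n + 1) - (cnj (- \<alpha> n / r) * v n + cnj (cnj \<zeta> / r) * (\<zeta> * u n)) = f u n / r"
      unfolding fn using r(1,2) by (simp add: field_simps power2_eq_square)
    show ?thesis using True 1 2
      by (simp add: cmv_state_def su_apply_def szego_def v_def[symmetric] r_def[symmetric])
  next
    case False
    have vn: "v n = cnj (\<alpha> n) * u n + r * u (n + 1)" "v (n + 1) = r * u n - \<alpha> n * u (n + 1)"
      using False by (simp_all add: v_def theta_block_def cmv_\<rho>_szego r_def)
    have 1: "v (n + 1) = cnj \<zeta> / r * (\<zeta> * u n) + - \<alpha> n / r * v n"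
    proof -
      have "cnj \<zeta> / r * (\<zeta> * u n) + - \<alpha> n / r * v n = ((cnj \<zeta> * \<zeta>) - \<alpha> n * cnj (\<alpha> n)) * u n / r - \<alpha> n * u (n + 1)"
        unfolding vn using r(1) by (simp add: field_simps)
      also have "\<dots> = v (n + 1)" unfolding vn zz r(3)[symmetric] using r(1) by simp
      finally show ?thesis by simp
    qed
    have 2: "\<zeta> * u (n + 1) = cnj (- \<alpha> n / r) * (\<zeta> * u n) + cnj (cnj \<zeta> / r) * v n"
      unfolding vn using r(1,2) by (simp add: field_simps)
    show ?thesis using False 1 2
      by (simp add: cmv_state_def su_apply_def szego_def v_def[symmetric] r_def[symmetric] zero_prod_def)
  qed
qed

text \<open>Variation of constants with crude propagators: \<open>K\<close> bounds one step, and
  \<open>1 \<le> K\<close> lets \<open>K ^ k\<close> dominate every partial product.\<close>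

lemma transfer_error:
  fixes X F :: "int \<Rightarrow> complex \<times> complex"
  assumes X: "\<And>n. X (n + 1) = su_apply (szego \<zeta> (\<alpha> n)) (X n) + F n"
    and K: "\<And>n v. norm (su_apply (szego \<zeta> (\<alpha> n)) v) \<le> K * norm v" "1 \<le> K"
  shows "norm (X (n + int k) - su_apply (transfer \<zeta> \<alpha> n k) (X n)) \<le> K ^ k * (\<Sum>j<k. norm (F (n + int j)))"
proof (induction k)
  case (Suc k)
  let ?S = "szego \<zeta> (\<alpha> (n + int k))"
  have e: "n + int (Suc k) = n + int k + 1" by simp
  have "X (n + int (Suc k)) - su_apply (transfer \<zeta> \<alpha> n (Suc k)) (X n) =
      su_apply ?S (X (n + int k) - su_apply (transfer \<zeta> \<alpha> n k) (X n)) + F (n + int k)"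
    unfolding e X[of "n + int k"] transfer.simps su_apply_mul su_apply_diff by simp
  then have "norm (X (n + int (Suc k)) - su_apply (transfer \<zeta> \<alpha> n (Suc k)) (X n)) \<le>
      K * norm (X (n + int k) - su_apply (transfer \<zeta> \<alpha> n k) (X n)) + norm (F (n + int k))"
    using order_trans[OF norm_triangle_ineq add_right_mono[OF K(1)]] by metis
  also have "\<dots> \<le> K * (K ^ k * (\<Sum>j<k. norm (F (n + int j)))) + K ^ Suc k * norm (F (n + int k))"
  proof (intro add_mono mult_left_mono Suc)
    have "1 * norm (F (n + int k)) \<le> K ^ Suc k * norm (F (n + int k))"
      using K(2) by (intro mult_right_mono one_le_power) auto
    then show "norm (F (n + int k)) \<le> K ^ Suc k * norm (F (n + int k))" by simp
  qed (use K in auto)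
  also have "\<dots> = K ^ Suc k * (\<Sum>j<Suc k. norm (F (n + int j)))" by (simp add: algebra_simps)
  finally show ?case .
qed simp

text \<open>Cayley-Hamilton relates \<open>X\<close> at n, n + p and n + 2 p up to forcing terms.
  Taking square-summable norms, which shifts preserve, gives |\<Delta>| N \<le> 2 N + forcing, and
  |\<Delta>| > 2 allows 2 N to be absorbed.\<close>

lemma transfer_hyperbolic_bound:
  fixes X F :: "int \<Rightarrow> complex \<times> complex"
  assumes z: "cmod \<zeta> = 1" and a: "\<forall>n. cmod (\<alpha> n) < 1"
    and per: "\<forall>n. \<alpha> (n + int p) = \<alpha> n" "0 < p"
    and K: "\<And>n v. norm (su_apply (szego \<zeta> (\<alpha> n)) v) \<le> K * norm v" "1 \<le> K"
    and X: "\<And>n. X (n + 1) = su_apply (szego \<zeta> (\<alpha> n)) (X n) + F n"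
    and l2: "l2_le (\<lambda>n. norm (X n)) N0" "l2_le (\<lambda>n. norm (F n)) G"
    and D: "2 < \<bar>discriminant \<zeta> \<alpha> p\<bar>"
  shows "l2_le (\<lambda>n. norm (X n))
    ((K ^ p + K ^ p * K ^ p + \<bar>discriminant \<zeta> \<alpha> p\<bar> * K ^ p) * (2 * real p * G) / (\<bar>discriminant \<zeta> \<alpha> p\<bar> - 2))"
proof -
  define \<Delta> where "\<Delta> = discriminant \<zeta> \<alpha> p"
  define C where "C = K ^ p + K ^ p * K ^ p + \<bar>\<Delta>\<bar> * K ^ p"
  have K1: "1 \<le> K ^ k" for k using K(2) by (rule one_le_power)
  have C0: "0 \<le> C" using K(2) by (simp add: C_def)
  have Kt: "norm (su_apply (transfer \<zeta> \<alpha> n k) v) \<le> K ^ k * norm v" for n k v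
  proof (induction k)
    case (Suc k)
    have "norm (su_apply (transfer \<zeta> \<alpha> n (Suc k)) v) \<le> K * norm (su_apply (transfer \<zeta> \<alpha> n k) v)"
      using K(1) by (simp add: su_apply_mul)
    also have "\<dots> \<le> K * (K ^ k * norm v)" using Suc K(2) by (intro mult_left_mono) auto
    finally show ?case by simp
  qed simp
  have main: "\<bar>\<Delta>\<bar> * norm (X (n + int p)) \<le> norm (X (n + int p + int p)) + norm (X n) + C * (\<Sum>j<2*p. norm (F (n + int j)))" for n
  proof -
    define T where "T = transfer \<zeta> \<alpha> n p"
    \<comment> \<open>By periodicity the next period has the same monodromy, so Cayley-Hamilton
      applies to two consecutive periods.\<close>
    have Tp: "transfer \<zeta> \<alpha> (n + int p) p = T"
      unfolding T_def by (rule transfer_cong) (use per(1) in \<open>metis add.assoc add.commute\<close>)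
    have tr: "2 * Re (fst T) = \<Delta>" using discriminant_shift[OF per] by (simp add: T_def \<Delta>_def)
    define E1 where "E1 = X (n + int p) - su_apply T (X n)"
    define E2 where "E2 = X (n + int p + int p) - su_apply T (X (n + int p))"
    define S where "S = (\<Sum>j<2*p. norm (F (n + int j)))"
    have "(\<Sum>j<p. norm (F (n + int j))) \<le> S" unfolding S_def by (intro sum_mono2) auto
    then have E1: "norm E1 \<le> K ^ p * S"
      using transfer_error[where X = X and F = F and \<zeta> = \<zeta> and \<alpha> = \<alpha> and K = K, OF X K, of n p] K1[of p] unfolding E1_def T_def
      by (meson mult_left_mono order_trans zero_le_one)
    have "(\<Sum>j<p. norm (F (n + int p + int j))) = (\<Sum>j\<in>{p..<2*p}. norm (F (n + int j)))"
      by (rule sum.reindex_bij_witness[where i = "\<lambda>j. j - p" and j = "\<lambda>j. j + p"]) (auto simp: algebra_simps)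
    also have "\<dots> \<le> S" unfolding S_def by (intro sum_mono2) auto
    finally have E2: "norm E2 \<le> K ^ p * S"
      using transfer_error[where X = X and F = F and \<zeta> = \<zeta> and \<alpha> = \<alpha> and K = K, OF X K, of "n + int p" p] K1[of p] unfolding E2_def Tp
      by (meson mult_left_mono order_trans zero_le_one)
    have ch: "su_apply T (su_apply T (X n)) - \<Delta> *\<^sub>R su_apply T (X n) + X n = 0"
      using su_cayley_hamilton[of T "X n"] transfer_SU11[OF z a] tr by (simp add: T_def)
    have "X (n + int p + int p) - \<Delta> *\<^sub>R X (n + int p) + X n =
        E2 + su_apply T E1 - \<Delta> *\<^sub>R E1 + (su_apply T (su_apply T (X n)) - \<Delta> *\<^sub>R su_apply T (X n) + X n)"
      by (simp add: E1_def E2_def su_apply_diff algebra_simps)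
    then have eq: "\<Delta> *\<^sub>R X (n + int p) = X (n + int p + int p) + X n - (E2 + su_apply T E1 - \<Delta> *\<^sub>R E1)"
      unfolding ch by (simp add: algebra_simps)
    have "norm (E2 + su_apply T E1 - \<Delta> *\<^sub>R E1) \<le> norm E2 + norm (su_apply T E1) + norm (\<Delta> *\<^sub>R E1)"
      by (intro order_trans[OF norm_triangle_ineq4] add_right_mono norm_triangle_ineq)
    also have "\<dots> \<le> K ^ p * S + K ^ p * (K ^ p * S) + \<bar>\<Delta>\<bar> * (K ^ p * S)"
    proof (intro add_mono)
      show "norm (su_apply T E1) \<le> K ^ p * (K ^ p * S)"
        using Kt[of n p E1] E1 K1[of p] unfolding T_def by (meson mult_left_mono order_trans zero_le_one)
      show "norm (\<Delta> *\<^sub>R E1) \<le> \<bar>\<Delta>\<bar> * (K ^ p * S)" using E1 by (simp add: mult_left_mono)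
    qed (rule E2)
    also have "\<dots> = C * S" by (simp add: C_def algebra_simps)
    finally have "norm (E2 + su_apply T E1 - \<Delta> *\<^sub>R E1) \<le> C * S" .
    moreover have "norm (\<Delta> *\<^sub>R X (n + int p)) \<le> norm (X (n + int p + int p)) + norm (X n) + norm (E2 + su_apply T E1 - \<Delta> *\<^sub>R E1)"
      unfolding eq by (intro order_trans[OF norm_triangle_ineq4] add_right_mono norm_triangle_ineq)
    ultimately show ?thesis by (simp add: S_def)
  qed
  \<comment> \<open>The a priori bound \<open>N0\<close> makes \<open>N\<close> finite, so that the
    term 2 N can be subtracted below.\<close>
  define U where "U = (\<lambda>n. complex_of_real (norm (X n)))"
  define N where "N = ell2_norm U"
  have Ul: "U \<in> ell2" using l2(1) l2_le_imp_ell2[of U N0] by (simp add: U_def)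
  have lN: "l2_le (\<lambda>n. norm (X n)) N" using ell2_imp_l2_le[OF Ul] by (simp add: U_def N_def)
  have "l2_le (\<lambda>n. norm (X (n + int p + int p)) + norm (X n) + C * (\<Sum>j<2*p. norm (F (n + int j))))
      (N + N + \<bar>C\<bar> * (\<Sum>j<2*p. G))"
    using l2_le_shift[OF lN, of "int p + int p"]
    by (intro l2_le_add l2_le_scale l2_le_sum lN l2_le_shift[of "\<lambda>n. norm (F n)"] l2(2)) (simp add: add.assoc)
  then have "l2_le (\<lambda>n. \<bar>\<Delta>\<bar> * norm (X (n + int p))) (N + N + C * (2 * real p * G))"
    by (rule l2_le_mono) (use main C0 in auto)
  from l2_le_shift[OF this, of "- int p"]
  have "l2_le (\<lambda>n. \<bar>\<Delta>\<bar> * norm (X n)) (N + N + C * (2 * real p * G))" by simp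
  from l2_le_scale[OF this, of "1 / \<bar>\<Delta>\<bar>"] D
  have "l2_le (\<lambda>n. norm (X n)) ((N + N + C * (2 * real p * G)) / \<bar>\<Delta>\<bar>)" by (simp add: \<Delta>_def)
  then have "N \<le> (N + N + C * (2 * real p * G)) / \<bar>\<Delta>\<bar>"
    using l2_le_imp_ell2(2)[of U] by (simp add: U_def N_def)
  then have "N \<le> C * (2 * real p * G) / (\<bar>\<Delta>\<bar> - 2)"
    using D by (simp add: \<Delta>_def field_simps)
  then show ?thesis using lN unfolding C_def \<Delta>_def by (auto intro: l2_le_mono)
qed

text \<open>The residual controls the whole vector: \<open>cmv_state \<zeta> \<alpha> u\<close> is
  square-summable and solves the Szego recursion with forcing of the size of the residual, so the
  previous bound excludes approximate eigenvectors.\<close>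

theorem not_approx_spectrum_hyperbolic:
  assumes z: "cmod \<zeta> = 1" and a: "\<forall>n. cmod (\<alpha> n) < 1"
    and per: "\<forall>n. \<alpha> (n + int p) = \<alpha> n" "0 < p"
    and D: "2 < \<bar>discriminant \<zeta> \<alpha> p\<bar>"
  shows "\<zeta>\<^sup>2 \<notin> approx_spectrum (cmv_operator \<alpha>)"
proof
  assume in_sp: "\<zeta>\<^sup>2 \<in> approx_spectrum (cmv_operator \<alpha>)"
  have a1: "\<forall>n. cmod (\<alpha> n) \<le> 1" using a less_imp_le by blast
  \<comment> \<open>Periodic coefficients take finitely many values, which bounds 1 / \<rho>; each
    of the two entries of a Szego matrix is then at most \<open>B\<close> in modulus.\<close>
  obtain B where B: "1 \<le> B" "\<And>n. 1 / cmod (szego_\<rho> (\<alpha> n)) \<le> B"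
    using periodic_bdd[OF per, of "\<lambda>a. 1 / cmod (szego_\<rho> a)"] by blast
  have K: "norm (su_apply (szego \<zeta> (\<alpha> n)) v) \<le> (2 * B) * norm v" for n v
  proof (rule order_trans[OF norm_su_apply_le mult_right_mono])
    have "cmod (\<alpha> n) / cmod (szego_\<rho> (\<alpha> n)) \<le> 1 / cmod (szego_\<rho> (\<alpha> n))"
      using a1 by (intro divide_right_mono) auto
    then show "cmod (fst (szego \<zeta> (\<alpha> n))) + cmod (snd (szego \<zeta> (\<alpha> n))) \<le> 2 * B"
      using B(2)[of n] z by (simp add: szego_def norm_divide)
  qed simp
  define D0 where "D0 = \<bar>discriminant \<zeta> \<alpha> p\<bar>"
  define M where "M = ((2 * B) ^ p + (2 * B) ^ p * (2 * B) ^ p + D0 * (2 * B) ^ p) * (2 * real p * (4 * B)) / (D0 - 2)"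
  have M0: "0 \<le> M" using B(1) D by (simp add: M_def D0_def)
  have est: "ell2_norm u \<le> M * ell2_norm (\<lambda>n. cmv_operator \<alpha> u n - \<zeta>\<^sup>2 * u n)" if u: "u \<in> ell2" for u
  proof -
    define f where "f = (\<lambda>n. cmv_operator \<alpha> u n - \<zeta>\<^sup>2 * u n)"
    have f: "f \<in> ell2" unfolding f_def by (rule cmv_minus_ell2[OF a1 u])
    define X where "X = cmv_state \<zeta> \<alpha> u"
    define F where "F n = X (n + 1) - su_apply (szego \<zeta> (\<alpha> n)) (X n)" for n
    have F: "norm (F n) \<le> 2 * B * (cmod (f n) + cmod (f (n + 1)))" for n
    proof (cases "even n")
      case True
      have Fn: "F n = (cnj \<zeta> * (- \<alpha> n * f n / szego_\<rho> (\<alpha> n) - f (n + 1)), f n / szego_\<rho> (\<alpha> n))"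
        using cmv_state_step[OF z a, of u n] True by (simp add: F_def X_def f_def)
      have 1: "cmod (f n / szego_\<rho> (\<alpha> n)) \<le> B * cmod (f n)"
        using mult_right_mono[OF B(2)[of n], of "cmod (f n)"] by (simp add: norm_divide)
      have "cmod (- \<alpha> n * f n / szego_\<rho> (\<alpha> n)) = cmod (\<alpha> n) * cmod (f n / szego_\<rho> (\<alpha> n))"
        by (simp add: norm_divide norm_mult)
      also have "\<dots> \<le> 1 * (B * cmod (f n))" using a1 1 by (intro mult_mono) auto
      finally have 2: "cmod (- \<alpha> n * f n / szego_\<rho> (\<alpha> n)) \<le> B * cmod (f n)" by simp
      have 3: "cmod (cnj \<zeta> * (- \<alpha> n * f n / szego_\<rho> (\<alpha> n) - f (n + 1))) \<le> B * cmod (f n) + cmod (f (n + 1))"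
        using norm_triangle_ineq4[of "- \<alpha> n * f n / szego_\<rho> (\<alpha> n)" "f (n + 1)"] 2 z
        unfolding norm_mult complex_mod_cnj by simp
      have "norm (F n) \<le> (B * cmod (f n) + cmod (f (n + 1))) + B * cmod (f n)"
        unfolding Fn using norm_Pair_le 1 3 by (meson add_mono order_trans)
      also have "cmod (f (n + 1)) \<le> 2 * B * cmod (f (n + 1))"
        using B(1) mult_right_mono[of 1 "2 * B" "cmod (f (n + 1))"] by simp
      finally show ?thesis by (simp add: algebra_simps)
    next
      case False
      then have "F n = 0" using cmv_state_step[OF z a, of u n] by (simp add: F_def X_def)
      then show ?thesis using B(1) by simp
    qed
    have lF: "l2_le (\<lambda>n. norm (F n)) (4 * B * ell2_norm f)"
    proof (rule l2_le_mono)
      show "l2_le (\<lambda>n. (2 * B) * (cmod (f n) + cmod (f (n + 1)))) (\<bar>2 * B\<bar> * (ell2_norm f + ell2_norm f))"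
        by (intro l2_le_scale l2_le_add l2_le_shift[of "\<lambda>n. cmod (f n)"] ell2_imp_l2_le f)
    qed (use F B(1) in auto)
    have v: "theta_block False \<alpha> u \<in> ell2" by (rule theta_block_ell2(1)[OF a1 u])
    have lX: "l2_le (\<lambda>n. norm (X n)) (ell2_norm (theta_block False \<alpha> u) + ell2_norm u)"
    proof (rule l2_le_mono[OF l2_le_add[OF ell2_imp_l2_le[OF v] ell2_imp_l2_le[OF u]]])
      fix n
      show "\<bar>norm (X n)\<bar> \<le> cmod (theta_block False \<alpha> u n) + cmod (u n)"
        using norm_Pair_le[of "theta_block False \<alpha> u n" "\<zeta> * u n"] norm_Pair_le[of "\<zeta> * u n" "theta_block False \<alpha> u n"] z
        by (simp add: X_def cmv_state_def norm_mult)
    qed simp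
    have "l2_le (\<lambda>n. norm (X n)) (((2 * B) ^ p + (2 * B) ^ p * (2 * B) ^ p + D0 * (2 * B) ^ p) *
        (2 * real p * (4 * B * ell2_norm f)) / (D0 - 2))"
      unfolding D0_def
      by (rule transfer_hyperbolic_bound[OF z a per K _ _ lX lF D]) (use B(1) in \<open>auto simp: F_def\<close>)
    then have "l2_le (\<lambda>n. norm (X n)) (M * ell2_norm f)" by (simp add: M_def mult.assoc)
    then have "l2_le (\<lambda>n. cmod (u n)) (M * ell2_norm f)"
    proof (rule l2_le_mono)
      fix n
      have "cmod (\<zeta> * u n) \<le> norm (X n)"
        using norm_fst_le[of "\<zeta> * u n" "theta_block False \<alpha> u n"] norm_snd_le[of "\<zeta> * u n" "theta_block False \<alpha> u n"]
        by (simp add: X_def cmv_state_def)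
      then show "\<bar>cmod (u n)\<bar> \<le> norm (X n)" using z by (simp add: norm_mult)
    qed simp
    then show ?thesis using l2_le_imp_ell2(2) by (simp add: f_def)
  qed
  obtain u where u: "u \<in> ell2" "u \<noteq> (\<lambda>n. 0)"
    "ell2_norm (\<lambda>n. cmv_operator \<alpha> u n - \<zeta>\<^sup>2 * u n) \<le> 1 / (2 * (M + 1)) * ell2_norm u"
    by (rule approx_spectrumE[OF in_sp, of "1 / (2 * (M + 1))"]) (use M0 in auto)
  have "ell2_norm u \<le> M * (1 / (2 * (M + 1)) * ell2_norm u)"
    using est[OF u(1)] mult_left_mono[OF u(3) M0] by linarith
  also have "\<dots> \<le> (M + 1) * (1 / (2 * (M + 1)) * ell2_norm u)"
    using M0 by (intro mult_right_mono) auto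
  also have "\<dots> = ell2_norm u / 2" using M0 by (simp add: field_simps)
  finally show False using ell2_norm_pos[OF u(1,2)] by simp
qed

section \<open>Periodic coefficients\<close>

lemma l2_le_geometric:
  assumes q: "0 < q" "q < 1"
  shows "l2_le (\<lambda>n. q ^ nat \<bar>n\<bar>) (2 / (1 - q))"
  unfolding l2_le_def
proof (intro conjI allI impI)
  show "0 \<le> 2 / (1 - q)" using q by simp
  fix F :: "int set" assume F: "finite F"
  have part: "(\<Sum>n\<in>A. q ^ nat \<bar>n\<bar>) \<le> 1 / (1 - q)" if A: "finite A" "inj_on (\<lambda>n. nat \<bar>n\<bar>) A" for A
  proof -
    have "(\<Sum>n\<in>A. q ^ nat \<bar>n\<bar>) = (\<Sum>k\<in>(\<lambda>n. nat \<bar>n\<bar>) ` A. q ^ k)"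
      using A(2) by (simp add: sum.reindex)
    also have "\<dots> \<le> (\<Sum>k. q ^ k)"
      using q A(1) by (intro sum_le_suminf) (auto simp: summable_geometric)
    also have "\<dots> = 1 / (1 - q)" using q by (simp add: suminf_geometric)
    finally show ?thesis .
  qed
  have "L2_set (\<lambda>n. q ^ nat \<bar>n\<bar>) F \<le> (\<Sum>n\<in>F. q ^ nat \<bar>n\<bar>)"
    using q by (intro L2_set_le_sum) auto
  also have "\<dots> = (\<Sum>n\<in>F \<inter> {0..}. q ^ nat \<bar>n\<bar>) + (\<Sum>n\<in>F \<inter> {..<0}. q ^ nat \<bar>n\<bar>)"
    using F by (subst sum.union_disjoint[symmetric]) (auto intro!: sum.cong)
  also have "\<dots> \<le> 1 / (1 - q) + 1 / (1 - q)"
    using F by (intro add_mono part) (auto simp: inj_on_def)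
  finally show "L2_set (\<lambda>n. q ^ nat \<bar>n\<bar>) F \<le> 2 / (1 - q)" by simp
qed

text \<open>The geometric cutoff varies slowly: neighbouring weights agree up to relative error
  \<kappa>. The error is measured by \<open>w m\<close>, where \<open>m\<close> will be the site
  from which a matrix entry reads.\<close>

lemma weight_ratio:
  fixes m n :: int and \<kappa> :: real
  assumes \<kappa>: "0 < \<kappa>" and mn: "\<bar>m - n\<bar> = 1"
  defines "w \<equiv> \<lambda>n. (1 / (1 + \<kappa>)) ^ nat \<bar>n\<bar>"
  shows "\<bar>w m - w n\<bar> \<le> \<kappa> * w m"
proof -
  have w0: "0 < w k" for k using \<kappa> unfolding w_def by (intro zero_less_power) simp
  have up: "w k = (1 + \<kappa>) * w l" if "nat \<bar>l\<bar> = Suc (nat \<bar>k\<bar>)" for k l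
  proof -
    have "(1 + \<kappa>) * (1 / (1 + \<kappa>)) = 1" using \<kappa> by simp
    then show ?thesis unfolding w_def that power_Suc mult.assoc[symmetric] by simp
  qed
  have "nat \<bar>n\<bar> = Suc (nat \<bar>m\<bar>) \<or> nat \<bar>m\<bar> = Suc (nat \<bar>n\<bar>)" using mn by linarith
  then show ?thesis
  proof
    assume "nat \<bar>n\<bar> = Suc (nat \<bar>m\<bar>)"
    then have wm: "w m = (1 + \<kappa>) * w n" by (rule up)
    then have d: "w m - w n = \<kappa> * w n" by (simp add: algebra_simps)
    have "w n \<le> w m" using wm w0[of n] \<kappa> by (simp add: mult_le_cancel_right1)
    then have "\<kappa> * w n \<le> \<kappa> * w m" using \<kappa> by simp
    then show ?thesis using d w0[of n] \<kappa> by (simp add: abs_mult)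
  next
    assume "nat \<bar>m\<bar> = Suc (nat \<bar>n\<bar>)"
    then have "w n = (1 + \<kappa>) * w m" by (rule up)
    then show ?thesis using w0[of m] \<kappa> by (simp add: algebra_simps abs_if)
  qed
qed

text \<open>The commutator of a block operator with the cutoff: the diagonal cancels, and each
  off-diagonal entry carries a difference of neighbouring weights.\<close>

lemma theta_block_weight:
  fixes w :: "int \<Rightarrow> real"
  assumes a: "\<forall>n. cmod (\<alpha> n) \<le> 1" and \<kappa>: "0 < \<kappa>"
  defines "w \<equiv> \<lambda>n. (1 / (1 + \<kappa>)) ^ nat \<bar>n\<bar>"
  assumes wu: "(\<lambda>n. of_real (w n) * u n) \<in> ell2"
  shows "(\<lambda>n. theta_block e \<alpha> (\<lambda>n. of_real (w n) * u n) n - of_real (w n) * theta_block e \<alpha> u n) \<in> ell2" (is "?r \<in> _")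
    and "ell2_norm (\<lambda>n. theta_block e \<alpha> (\<lambda>n. of_real (w n) * u n) n - of_real (w n) * theta_block e \<alpha> u n)
      \<le> 2 * \<kappa> * ell2_norm (\<lambda>n. of_real (w n) * u n)"
proof -
  have "cmod (?r n) \<le> \<kappa> * (\<Sum>j\<in>{-1, 1}. cmod (of_real (w (n + j)) * u (n + j)))" for n
  proof -
    have wr: "\<bar>w m - w n\<bar> \<le> \<kappa> * w m" if "\<bar>m - n\<bar> = 1" for m n
      using weight_ratio[OF \<kappa> that] by (simp add: w_def)
    have w0: "0 \<le> w k" for k using \<kappa> unfolding w_def by (intro zero_le_power) simp
    have b: "cmod (cmv_\<rho> \<alpha> k * (of_real (w m - w n) * u m)) \<le> \<kappa> * cmod (of_real (w m) * u m)"
      if "\<bar>m - n\<bar> = 1" for k m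
    proof -
      have "cmod (cmv_\<rho> \<alpha> k) * (\<bar>w m - w n\<bar> * cmod (u m)) \<le> 1 * (\<kappa> * w m * cmod (u m))"
        using cmod_cmv_\<rho>_le[OF a[rule_format]] wr[OF that] by (intro mult_mono) auto
      then show ?thesis using w0 by (simp add: norm_mult mult.assoc del: of_real_diff)
    qed
    have "?r n = (if even n = e then cmv_\<rho> \<alpha> n * (of_real (w (n + 1) - w n) * u (n + 1))
        else cmv_\<rho> \<alpha> (n - 1) * (of_real (w (n - 1) - w n) * u (n - 1)))"
      by (simp add: theta_block_def algebra_simps)
    also have "cmod \<dots> \<le> \<kappa> * cmod (of_real (w (n + 1)) * u (n + 1)) + \<kappa> * cmod (of_real (w (n - 1)) * u (n - 1))"
      using b[of "n + 1" n] b[of "n - 1" "n - 1"] \<kappa>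
      by (auto intro: add_increasing add_increasing2)
    finally show ?thesis by (simp add: algebra_simps)
  qed
  from ell2_dominated[OF wu this] \<kappa>
  show "?r \<in> ell2" "ell2_norm ?r \<le> 2 * \<kappa> * ell2_norm (\<lambda>n. of_real (w n) * u n)"
    by (simp_all add: mult_ac)
qed

text \<open>A bounded generalised eigenfunction becomes an approximate eigenvector when damped by a
  slowly decaying weight; the commutators with the two factors are the whole error.\<close>

theorem bounded_solution_approx_spectrum:
  assumes a: "\<forall>n. cmod (\<alpha> n) \<le> 1" and z: "cmod z = 1"
    and M: "\<forall>n. cmod (u n) \<le> M" and nz: "u \<noteq> (\<lambda>n. 0)"
    and v: "theta_block False \<alpha> u = v" and eq: "theta_block True \<alpha> v = (\<lambda>n. z * u n)"
  shows "z \<in> approx_spectrum (cmv_operator \<alpha>)"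
proof (rule approx_spectrumI)
  fix e :: real assume e: "0 < e"
  \<comment> \<open>Relative to \<open>U\<close> the two commutators cost
    \<open>2 * \<kappa>\<close> and \<open>2 * \<kappa> * 3\<close>, in total
    \<open>8 * \<kappa>\<close>. The factor 3 bounds \<open>V\<close> by \<open>U\<close> and uses
    \<open>\<kappa> \<le> 1\<close>.\<close>
  define \<kappa> where "\<kappa> = min 1 (e / 8)"
  have \<kappa>: "0 < \<kappa>" "\<kappa> \<le> 1" "8 * \<kappa> \<le> e" using e by (auto simp: \<kappa>_def)
  define w where "w = (\<lambda>n::int. (1 / (1 + \<kappa>)) ^ nat \<bar>n\<bar>)"
  have w0: "0 < w n" for n using \<kappa> unfolding w_def by (intro zero_less_power) simp
  have lw: "l2_le w (2 / (1 - 1 / (1 + \<kappa>)))" 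
    unfolding w_def using \<kappa> by (intro l2_le_geometric) (auto simp: field_simps)
  have M0: "0 \<le> M" using M norm_ge_zero order_trans by blast
  define U where "U = (\<lambda>n. of_real (w n) * u n)"
  have "l2_le (\<lambda>n. cmod (U n)) (\<bar>M\<bar> * (2 / (1 - 1 / (1 + \<kappa>))))"
  proof (rule l2_le_mono[OF l2_le_scale[OF lw]])
    fix n show "\<bar>cmod (U n)\<bar> \<le> M * w n"
      using M w0[of n] by (simp add: U_def norm_mult mult.commute)
  qed simp
  then have U: "U \<in> ell2" by (rule l2_le_imp_ell2)
  have Unz: "U \<noteq> (\<lambda>n. 0)"
  proof
    assume "U = (\<lambda>n. 0)"
    then have "of_real (w n) * u n = 0" for n by (simp add: U_def fun_eq_iff)
    then have "u n = 0" for n using w0[of n] by (metis mult_eq_0_iff of_real_eq_0_iff less_irrefl)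
    then show False using nz by (auto simp: fun_eq_iff)
  qed
  define V where "V = (\<lambda>n. of_real (w n) * v n)"
  define r1 where "r1 = (\<lambda>n. theta_block False \<alpha> U n - V n)"
  have r1: "r1 \<in> ell2" "ell2_norm r1 \<le> 2 * \<kappa> * ell2_norm U"
    using theta_block_weight[OF a \<kappa>(1), of u False] U v unfolding r1_def U_def V_def w_def by simp_all
  have MU: "theta_block False \<alpha> U \<in> ell2" "ell2_norm (theta_block False \<alpha> U) = ell2_norm U"
    using theta_block_ell2[OF a U] by simp_all
  have V: "V \<in> ell2" "ell2_norm V \<le> ell2_norm U + 2 * \<kappa> * ell2_norm U"
    using ell2_diff[OF MU(1) r1(1)] r1(2) MU(2) by (simp_all add: r1_def)
  define r2 where "r2 = (\<lambda>n. theta_block True \<alpha> V n - z * U n)"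
  have r2: "r2 \<in> ell2" "ell2_norm r2 \<le> 2 * \<kappa> * ell2_norm V"
    using theta_block_weight[OF a \<kappa>(1), of v True] V(1) eq unfolding r2_def U_def V_def w_def
    by (simp_all add: mult.left_commute)
  have "(\<lambda>n. cmv_operator \<alpha> U n - z * U n) = (\<lambda>n. theta_block True \<alpha> r1 n + r2 n)"
    by (simp add: cmv_operator_factor r1_def r2_def theta_block_diff)
  then have "ell2_norm (\<lambda>n. cmv_operator \<alpha> U n - z * U n) \<le> ell2_norm r1 + ell2_norm r2"
    using ell2_add(2)[OF theta_block_ell2(1)[OF a r1(1)] r2(1)] theta_block_ell2(2)[OF a r1(1)] by simp
  also have "\<dots> \<le> 2 * \<kappa> * ell2_norm U + 2 * \<kappa> * (3 * ell2_norm U)"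
  proof (rule add_mono[OF r1(2) order_trans[OF r2(2)]])
    have "\<kappa> * ell2_norm U \<le> 1 * ell2_norm U" using \<kappa> by (intro mult_right_mono) auto
    then have "ell2_norm V \<le> 3 * ell2_norm U" using V(2) by simp
    then show "2 * \<kappa> * ell2_norm V \<le> 2 * \<kappa> * (3 * ell2_norm U)" using \<kappa> by (intro mult_left_mono) auto
  qed
  also have "\<dots> = (8 * \<kappa>) * ell2_norm U" by simp
  also have "\<dots> \<le> e * ell2_norm U" using \<kappa> by (intro mult_right_mono) auto
  finally show "\<exists>u\<in>ell2. u \<noteq> (\<lambda>n. 0) \<and> ell2_norm (\<lambda>n. cmv_operator \<alpha> u n - z * u n) \<le> e * ell2_norm u"
    using U Unz by (intro bexI[of _ U] conjI)
qed

text \<open>The eigenvalues solve l^2 - 2 t l + 1 = 0 with |t| \<le> 1 and are therefore unimodular.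
  At |t| = 1 the matrix may be a Jordan block, but one eigenvector is enough.\<close>

lemma SU11_unimodular_eigenvector:
  assumes X: "X \<in> SU11" and tr: "\<bar>2 * Re (fst X)\<bar> \<le> 2"
  obtains l v where "cmod l = 1" "v \<noteq> 0" "su_apply X v = (l * fst v, l * snd v)"
proof -
  obtain a b where ab: "X = (a, b)" by (metis surj_pair)
  have det: "a * cnj a - b * cnj b = 1" using X by (simp add: SU11_def ab)
  show thesis
  proof (cases "b = 0")
    case True
    then have "a * cnj a = 1" using det by simp
    then have "cmod a = 1" by (metis complex_norm_square norm_ge_zero norm_one of_real_1 of_real_eq_iff of_real_power power2_eq_1_iff abs_norm_cancel norm_of_real norm_power power_one real_sqrt_abs real_sqrt_one)
    then show thesis using True by (intro that[of a "(1, 0)"]) (auto simp: ab su_apply_def zero_prod_def)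
  next
    case False
    define t where "t = Re a"
    have t: "t\<^sup>2 \<le> 1" using tr by (simp add: ab t_def abs_square_le_1)
    \<comment> \<open>The root with nonnegative imaginary part. The eigenvector
      \<open>(b, l - a)\<close> is read off the first row of the eigenvalue equation and is nonzero
      because \<open>b \<noteq> 0\<close>.\<close>
    define l where "l = Complex t (sqrt (1 - t\<^sup>2))"
    have l1: "cmod l = 1" using t by (simp add: l_def cmod_def)
    have ll: "l * l = (a + cnj a) * l - 1"
      using t by (simp add: l_def complex_eq_iff t_def power2_eq_square algebra_simps)
    have "cnj b * b + cnj a * (l - a) = (a + cnj a) * l - 1 - a * l + (b * cnj b - a * cnj a + 1)"
      by (simp add: algebra_simps)
    also have "\<dots> = l * (l - a)" using det ll by (simp add: algebra_simps)
    finally show thesis using False l1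
      by (intro that[of l "(b, l - a)"]) (auto simp: ab su_apply_def zero_prod_def algebra_simps)
  qed
qed

lemma bloch_solution:
  assumes z: "cmod \<zeta> = 1" and a: "\<forall>n. cmod (\<alpha> n) < 1"
    and per: "\<forall>n. \<alpha> (n + int p) = \<alpha> n" "0 < p"
    and D: "\<bar>discriminant \<zeta> \<alpha> p\<bar> \<le> 2"
  obtains Y M where "\<And>n. Y (n + 1) = su_apply (szego \<zeta> (\<alpha> n)) (Y n)" "\<And>n. norm (Y n) \<le> M" "Y 0 \<noteq> 0"
proof -
  obtain l v where l: "cmod l = 1" and v: "v \<noteq> 0" "su_apply (transfer \<zeta> \<alpha> 0 p) v = (l * fst v, l * snd v)"
    using SU11_unimodular_eigenvector[OF transfer_SU11[OF z a]] D unfolding discriminant_def by metis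
  \<comment> \<open>Bloch extension: transfer matrices within a period, the unimodular factor
    \<open>l\<close> from one period to the next.\<close>
  define Y where "Y = (\<lambda>n. let k = l powi (n div int p); y = su_apply (transfer \<zeta> \<alpha> 0 (nat (n mod int p))) v in (k * fst y, k * snd y))"
  have l0: "l \<noteq> 0" using l by auto
  have scale: "su_apply X (k * fst y, k * snd y) = (k * fst (su_apply X y), k * snd (su_apply X y))" for X k y
    by (simp add: su_apply_def algebra_simps)
  have step: "Y (n + 1) = su_apply (szego \<zeta> (\<alpha> n)) (Y n)" for n
  proof -
    define r where "r = nat (n mod int p)"
    have r: "int r = n mod int p" using per(2) by (simp add: r_def)
    have r': "r < p" using per(2) unfolding r_def by (simp add: nat_less_iff)
    have al: "\<alpha> (int r) = \<alpha> n" unfolding r by (rule periodic_mod[OF per(1)])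
    have Yn: "su_apply (szego \<zeta> (\<alpha> n)) (Y n) = (l powi (n div int p) * fst (su_apply (transfer \<zeta> \<alpha> 0 (Suc r)) v),
        l powi (n div int p) * snd (su_apply (transfer \<zeta> \<alpha> 0 (Suc r)) v))"
      by (simp add: Y_def Let_def r_def[symmetric] scale su_apply_mul al)
    have n: "n = int p * (n div int p) + int r" using r by simp
    show ?thesis
    proof (cases "Suc r = p")
      \<comment> \<open>The last site of a period wraps round: here the eigenvector equation
        replaces the next transfer matrix.\<close>
      case True
      have "n + 1 = int p * (n div int p + 1)" by (subst n) (simp add: algebra_simps flip: True)
      then have "(n + 1) div int p = n div int p + 1" "(n + 1) mod int p = 0"
        using per(2) by simp_all
      then show ?thesis unfolding Yn True
        using l0 v(2) by (simp add: Y_def Let_def power_int_add mult_ac)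
    next
      case False
      have e: "n + 1 = int (Suc r) + (n div int p) * int p" by (subst n) (simp add: algebra_simps)
      have "(n + 1) div int p = n div int p" "(n + 1) mod int p = int (Suc r)"
        using False r' unfolding e by (simp_all add: div_mult_self1 zdiv_int[symmetric])
      then show ?thesis unfolding Yn by (simp add: Y_def Let_def nat_int del: of_nat_Suc)
    qed
  qed
  define B where "B = (\<Sum>k<p. norm (su_apply (transfer \<zeta> \<alpha> 0 k) v))"
  have "norm (Y n) \<le> B" for n
  proof -
    define k y where "k = l powi (n div int p)" and "y = su_apply (transfer \<zeta> \<alpha> 0 (nat (n mod int p))) v"
    have "cmod k = 1" using l by (simp add: k_def norm_power_int)
    then have "norm (Y n) = norm y"
      by (simp add: Y_def Let_def k_def[symmetric] y_def[symmetric] norm_Pair norm_mult norm_prod_def)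
    also have "\<dots> \<le> B" unfolding B_def y_def
      by (rule member_le_sum) (use per(2) in \<open>auto simp: nat_less_iff\<close>)
    finally show ?thesis .
  qed
  moreover have "Y 0 \<noteq> 0" using v by (simp add: Y_def)
  ultimately show thesis using step that by blast
qed

text \<open>The Bloch solution of the Szego recursion is translated back into a bounded solution of
  the two block equations.\<close>

theorem approx_spectrum_elliptic:
  assumes z: "cmod \<zeta> = 1" and a: "\<forall>n. cmod (\<alpha> n) < 1"
    and per: "\<forall>n. \<alpha> (n + int p) = \<alpha> n" "0 < p"
    and D: "\<bar>discriminant \<zeta> \<alpha> p\<bar> \<le> 2"
  shows "\<zeta>\<^sup>2 \<in> approx_spectrum (cmv_operator \<alpha>)"
proof -
  obtain Y M where Y: "\<And>n. Y (n + 1) = su_apply (szego \<zeta> (\<alpha> n)) (Y n)" and M: "\<And>n. norm (Y n) \<le> M" and Y0: "Y 0 \<noteq> 0"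
    by (rule bloch_solution[OF assms]) blast
  \<comment> \<open>This undoes the exchange of entries in \<open>cmv_state\<close>;
    \<open>cnj \<zeta>\<close> is the inverse of \<zeta>.\<close>
  define u where "u n = cnj \<zeta> * (if even n then snd (Y n) else fst (Y n))" for n
  define v where "v n = (if even n then fst (Y n) else snd (Y n))" for n
  have a1: "\<forall>n. cmod (\<alpha> n) \<le> 1" using a less_imp_le by blast
  have zz: "\<zeta> * cnj \<zeta> = 1" using z by (simp add: complex_norm_square[symmetric])
  have zu: "\<zeta> * u n = (if even n then snd (Y n) else fst (Y n))" for n
    by (simp add: u_def mult.assoc[symmetric] zz)
  have r: "szego_\<rho> (\<alpha> n) \<noteq> 0" "cnj (szego_\<rho> (\<alpha> n)) = szego_\<rho> (\<alpha> n)" 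
      "szego_\<rho> (\<alpha> n) * szego_\<rho> (\<alpha> n) + \<alpha> n * cnj (\<alpha> n) = 1" for n
    using szego_\<rho>[OF a[rule_format, of n]] by simp_all
  have st: "szego_\<rho> (\<alpha> n) * fst (Y (n + 1)) = cnj \<zeta> * fst (Y n) - \<alpha> n * snd (Y n)"
    "szego_\<rho> (\<alpha> n) * snd (Y (n + 1)) = \<zeta> * snd (Y n) - cnj (\<alpha> n) * fst (Y n)" for n
    using r[of n] unfolding Y by (simp_all add: su_apply_def szego_def field_simps)
  \<comment> \<open>Rows at the second site of a block look back to \<open>n - 1\<close>, which
    calls for the inverse Szego step.\<close>
  have inv: "szego_\<rho> (\<alpha> n) * fst (Y n) = \<zeta> * fst (Y (n + 1)) + \<alpha> n * snd (Y (n + 1))"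
    "szego_\<rho> (\<alpha> n) * snd (Y n) = cnj \<zeta> * snd (Y (n + 1)) + cnj (\<alpha> n) * fst (Y (n + 1))" for n
  proof -
    let ?r = "szego_\<rho> (\<alpha> n)"
    have rr: "\<zeta> * cnj \<zeta> - \<alpha> n * cnj (\<alpha> n) = ?r * ?r"
      unfolding zz using r(3)[of n] by (simp add: diff_eq_eq)
    have "?r * (\<zeta> * fst (Y (n + 1)) + \<alpha> n * snd (Y (n + 1))) =
        \<zeta> * (?r * fst (Y (n + 1))) + \<alpha> n * (?r * snd (Y (n + 1)))" by (simp add: algebra_simps)
    also have "\<dots> = (\<zeta> * cnj \<zeta> - \<alpha> n * cnj (\<alpha> n)) * fst (Y n)"
      unfolding st by (simp add: algebra_simps)
    also have "\<dots> = ?r * (?r * fst (Y n))" unfolding rr by (simp add: mult.assoc)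
    finally show "?r * fst (Y n) = \<zeta> * fst (Y (n + 1)) + \<alpha> n * snd (Y (n + 1))" using r(1)[of n] by simp
    have "?r * (cnj \<zeta> * snd (Y (n + 1)) + cnj (\<alpha> n) * fst (Y (n + 1))) =
        cnj \<zeta> * (?r * snd (Y (n + 1))) + cnj (\<alpha> n) * (?r * fst (Y (n + 1)))" by (simp add: algebra_simps)
    also have "\<dots> = (\<zeta> * cnj \<zeta> - \<alpha> n * cnj (\<alpha> n)) * snd (Y n)"
      unfolding st by (simp add: algebra_simps)
    also have "\<dots> = ?r * (?r * snd (Y n))" unfolding rr by (simp add: mult.assoc)
    finally show "?r * snd (Y n) = cnj \<zeta> * snd (Y (n + 1)) + cnj (\<alpha> n) * fst (Y (n + 1))" using r(1)[of n] by simp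
  qed
  have Mu: "theta_block False \<alpha> u = v"
  proof
    fix n
    show "theta_block False \<alpha> u n = v n"
    proof (cases "even n")
      case True
      have "theta_block False \<alpha> u n = cnj \<zeta> * (szego_\<rho> (\<alpha> (n - 1)) * fst (Y (n - 1)) - \<alpha> (n - 1) * snd (Y n))"
        using True by (simp add: theta_block_def cmv_\<rho>_szego u_def algebra_simps)
      also have "\<dots> = (\<zeta> * cnj \<zeta>) * fst (Y n)" using inv(1)[of "n - 1"] by (simp add: algebra_simps)
      finally show ?thesis using True by (simp add: zz v_def)
    next
      case False
      have "theta_block False \<alpha> u n = cnj \<zeta> * (cnj (\<alpha> n) * fst (Y n) + szego_\<rho> (\<alpha> n) * snd (Y (n + 1)))"
        using False by (simp add: theta_block_def cmv_\<rho>_szego u_def algebra_simps)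
      also have "\<dots> = (\<zeta> * cnj \<zeta>) * snd (Y n)" using st(2)[of n] by (simp add: algebra_simps)
      finally show ?thesis using False by (simp add: zz v_def)
    qed
  qed
  have Lv: "theta_block True \<alpha> v = (\<lambda>n. \<zeta>\<^sup>2 * u n)"
  proof
    fix n
    have zu2: "\<zeta>\<^sup>2 * u n = \<zeta> * (if even n then snd (Y n) else fst (Y n))"
      unfolding zu[symmetric] by (simp add: power2_eq_square)
    show "theta_block True \<alpha> v n = \<zeta>\<^sup>2 * u n"
    proof (cases "even n")
      case True
      then show ?thesis using st(2)[of n] unfolding zu2
        by (simp add: theta_block_def cmv_\<rho>_szego v_def)
    next
      case False
      then show ?thesis using inv(1)[of "n - 1"] unfolding zu2
        by (simp add: theta_block_def cmv_\<rho>_szego v_def)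
    qed
  qed
  show ?thesis
  proof (rule bounded_solution_approx_spectrum[OF a1 _ _ _ Mu Lv])
    show "cmod (\<zeta>\<^sup>2) = 1" using z by (simp add: norm_power)
    have "cmod (fst (Y n)) \<le> M" "cmod (snd (Y n)) \<le> M" for n
      using M[of n] norm_fst_le[of "fst (Y n)" "snd (Y n)"] norm_snd_le[of "snd (Y n)" "fst (Y n)"] by simp_all
    then show "\<forall>n. cmod (u n) \<le> M" using z by (simp add: u_def norm_mult)
    show "u \<noteq> (\<lambda>n. 0)"
    proof
      assume u0: "u = (\<lambda>n. 0)"
      then have "v = (\<lambda>n. 0)" unfolding Mu[symmetric] u0 by (simp add: theta_block_def fun_eq_iff)
      then have "v 0 = 0" by simp
      then have "fst (Y 0) = 0" "snd (Y 0) = 0" using zu[of 0] by (simp_all add: v_def u0)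
      then show False using Y0 by (simp add: prod_eq_iff)
    qed
  qed
qed

theorem periodic_spectrum:
  assumes z: "cmod \<zeta> = 1" and a: "\<forall>n. cmod (\<alpha> n) < 1"
    and per: "\<forall>n. \<alpha> (n + int p) = \<alpha> n" "0 < p"
  shows "\<zeta>\<^sup>2 \<in> approx_spectrum (cmv_operator \<alpha>) \<longleftrightarrow> \<bar>discriminant \<zeta> \<alpha> p\<bar> \<le> 2"
  using approx_spectrum_elliptic[OF assms] not_approx_spectrum_hyperbolic[OF assms] by fastforce

section \<open>The discriminant on the unit circle\<close>

text \<open>This provides the Leibniz rule for products of transfer matrices. Bilinearity is over
  the reals, since the second argument enters with conjugates.\<close>

lemma bounded_bilinear_su_mul: "bounded_bilinear su_mul"
proof
  show "\<exists>K. \<forall>a b. norm (su_mul a b) \<le> norm a * norm b * K"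
  proof (intro exI allI)
    fix X Y :: "complex \<times> complex"
    have n: "cmod (fst X) \<le> norm X" "cmod (snd X) \<le> norm X" "cmod (fst Y) \<le> norm Y" "cmod (snd Y) \<le> norm Y"
      using norm_fst_le[of "fst X" "snd X"] norm_snd_le[of "snd X" "fst X"]
        norm_fst_le[of "fst Y" "snd Y"] norm_snd_le[of "snd Y" "fst Y"] by simp_all
    have "norm (su_mul X Y) \<le> cmod (fst X * fst Y + snd X * cnj (snd Y)) + cmod (fst X * snd Y + snd X * cnj (fst Y))"
      unfolding su_mul_def by (rule norm_Pair_le)
    also have "\<dots> \<le> (norm X * norm Y + norm X * norm Y) + (norm X * norm Y + norm X * norm Y)"
      using n by (intro add_mono order_trans[OF norm_triangle_ineq]) (simp_all add: norm_mult mult_mono)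
    finally show "norm (su_mul X Y) \<le> norm X * norm Y * 4" by simp
  qed
qed (simp_all add: su_mul_def algebra_simps scaleR_conv_of_real)

text \<open>The cone in the Lie algebra of \<open>SU(1,1)\<close>, given by \<open>su_cone\<close> and its interior, is invariant under
  conjugation and contains the logarithmic derivatives of the Szego matrices.\<close>

definition su_cone :: "(complex \<times> complex) set" where
  "su_cone = {K. \<exists>\<kappa> \<beta>. K = (\<i> * of_real \<kappa>, \<beta>) \<and> cmod \<beta> \<le> - \<kappa>}"

definition su_open_cone :: "(complex \<times> complex) set" where
  "su_open_cone = {K. \<exists>\<kappa> \<beta>. K = (\<i> * of_real \<kappa>, \<beta>) \<and> cmod \<beta> < - \<kappa>}"

lemma su_cone_add:
  assumes "K \<in> su_cone" "K' \<in> su_open_cone"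
  shows "K + K' \<in> su_open_cone"
proof -
  obtain \<kappa> \<beta> \<kappa>' \<beta>' where K: "K = (\<i> * of_real \<kappa>, \<beta>)" "cmod \<beta> \<le> - \<kappa>" "K' = (\<i> * of_real \<kappa>', \<beta>')" "cmod \<beta>' < - \<kappa>'"
    using assms unfolding su_cone_def su_open_cone_def by blast
  have "K + K' = (\<i> * of_real (\<kappa> + \<kappa>'), \<beta> + \<beta>')" by (simp add: K algebra_simps)
  moreover have "cmod (\<beta> + \<beta>') < - (\<kappa> + \<kappa>')" using norm_triangle_ineq[of \<beta> \<beta>'] K(2,4) by linarith
  ultimately show ?thesis unfolding su_open_cone_def by blast
qed

lemma su_open_cone_subset: "su_open_cone \<subseteq> su_cone"
  unfolding su_cone_def su_open_cone_def by force

text \<open>Conjugation preserves the determinant \<kappa>^2 - |\<beta>|^2, so the result stays in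
  the double cone; the explicit diagonal entry then shows that it stays in the same half.\<close>

lemma su_cone_conjugate:
  assumes t: "t \<in> SU11" and K: "K \<in> su_cone"
  obtains K' where "K' \<in> su_cone" "su_mul t K = su_mul K' t"
proof -
  obtain \<kappa> \<beta> where KK: "K = (\<i> * of_real \<kappa>, \<beta>)" "cmod \<beta> \<le> - \<kappa>" using K unfolding su_cone_def by blast
  obtain c s where cs: "t = (c, s)" by (metis surj_pair)
  have det: "c * cnj c - s * cnj s = 1" using t by (simp add: SU11_def cs)
  define inv where "inv = (cnj c, - s)"
  have inv: "su_mul inv t = (1, 0)" using det by (simp add: su_mul_def cs inv_def mult.commute)
  define K' where "K' = su_mul (su_mul t K) inv"
  \<comment> \<open>The diagonal entry of the conjugated element, divided by the imaginary unit; its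
    sign decides the half of the cone.\<close>
  define \<kappa>' where "\<kappa>' = \<kappa> * ((cmod c)\<^sup>2 + (cmod s)\<^sup>2) - 2 * Im (c * \<beta> * cnj s)"
  have im: "\<i> * complex_of_real (2 * Im w) = w - cnj w" for w
    by (simp add: complex_eq_iff)
  have fst': "fst K' = \<i> * of_real \<kappa>'"
  proof -
    have "fst K' = \<i> * of_real \<kappa> * (c * cnj c + s * cnj s) - (c * \<beta> * cnj s - cnj (c * \<beta> * cnj s))"
      by (simp add: K'_def inv_def KK cs su_mul_def algebra_simps)
    also have "\<dots> = \<i> * of_real \<kappa>'"
      unfolding im[symmetric] \<kappa>'_def complex_norm_square[symmetric] by (simp add: algebra_simps)
    finally show ?thesis .
  qed
  have sd: "fst (su_mul X Y) * cnj (fst (su_mul X Y)) - snd (su_mul X Y) * cnj (snd (su_mul X Y)) =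
    (fst X * cnj (fst X) - snd X * cnj (snd X)) * (fst Y * cnj (fst Y) - snd Y * cnj (snd Y))" for X Y
    by (simp add: su_mul_def algebra_simps)
  have dinv: "fst inv * cnj (fst inv) - snd inv * cnj (snd inv) = 1"
    using det by (simp add: inv_def algebra_simps)
  have h: "fst K' * cnj (fst K') - snd K' * cnj (snd K') = of_real (\<kappa>\<^sup>2) - \<beta> * cnj \<beta>"
    unfolding K'_def sd using det dinv by (simp add: cs KK power2_eq_square algebra_simps)
  have e: "\<i> * complex_of_real \<kappa>' * cnj (\<i> * complex_of_real \<kappa>') = of_real (\<kappa>'\<^sup>2)"
    by (simp add: power2_eq_square complex_eq_iff)
  have "complex_of_real (\<kappa>'\<^sup>2 - (cmod (snd K'))\<^sup>2) = of_real (\<kappa>\<^sup>2 - (cmod \<beta>)\<^sup>2)"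
    using h unfolding fst' e of_real_diff complex_norm_square .
  then have "\<kappa>'\<^sup>2 - (cmod (snd K'))\<^sup>2 = \<kappa>\<^sup>2 - (cmod \<beta>)\<^sup>2" using of_real_eq_iff by blast
  moreover have "(cmod \<beta>)\<^sup>2 \<le> \<kappa>\<^sup>2"
    using KK(2) power_mono[of "cmod \<beta>" "- \<kappa>" 2] by simp
  ultimately have sq: "(cmod (snd K'))\<^sup>2 \<le> \<kappa>'\<^sup>2" by linarith
  \<comment> \<open>Since \<open>cmod \<beta> \<le> - \<kappa>\<close>, the worst case completes the
    square \<open>\<kappa> * (cmod c - cmod s)\<^sup>2\<close>.\<close>
  have "\<kappa>' \<le> 0"
  proof -
    have "- Im (c * \<beta> * cnj s) \<le> cmod (c * \<beta> * cnj s)" using abs_Im_le_cmod[of "c * \<beta> * cnj s"] by linarith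
    also have "\<dots> = cmod \<beta> * (cmod c * cmod s)" by (simp add: norm_mult)
    also have "\<dots> \<le> (- \<kappa>) * (cmod c * cmod s)" using KK(2) by (intro mult_right_mono) auto
    finally have "\<kappa>' \<le> \<kappa> * ((cmod c)\<^sup>2 + (cmod s)\<^sup>2) + 2 * ((- \<kappa>) * (cmod c * cmod s))"
      by (simp add: \<kappa>'_def)
    also have "\<dots> = \<kappa> * (cmod c - cmod s)\<^sup>2" by (simp add: power2_eq_square algebra_simps)
    also have "\<dots> \<le> 0" using order_trans[OF norm_ge_zero KK(2)] by (intro mult_nonpos_nonneg) auto
    finally show ?thesis .
  qed
  with sq have "cmod (snd K') \<le> - \<kappa>'"
    using power2_le_imp_le[of "cmod (snd K')" "- \<kappa>'"] by simp
  moreover have "K' = (\<i> * of_real \<kappa>', snd K')" using fst' by (simp add: prod_eq_iff)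
  ultimately have "K' \<in> su_cone" unfolding su_cone_def by blast
  moreover have "su_mul t K = su_mul K' t" by (simp add: K'_def su_mul_assoc inv)
  ultimately show thesis using that by blast
qed

lemma szego_has_derivative:
  assumes a: "cmod a < 1"
  obtains K where "K \<in> su_open_cone"
    "((\<lambda>\<theta>. szego (cis (\<theta> / 2)) a) has_vector_derivative su_mul K (szego (cis (\<theta> / 2)) a)) (at \<theta>)"
proof -
  define c s where "c = cnj (cis (\<theta> / 2)) / szego_\<rho> a" and "s = - a / szego_\<rho> a"
  have r: "szego_\<rho> a \<noteq> 0" using szego_\<rho>[OF a] by simp
  have det: "c * cnj c - s * cnj s = 1"
    using szego_SU11[of "cis (\<theta> / 2)" a] a by (simp add: SU11_def szego_def c_def s_def)
  have cpos: "0 < cmod c" using r by (simp add: c_def norm_divide)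
  \<comment> \<open>Derivative times inverse: the derivative of the Szego matrix is
    \<open>(- (\<i> / 2) * c, 0)\<close> and its inverse is \<open>(cnj c, - s)\<close>. The strict
    inequality |s| < |c| puts \<open>K\<close> into the open cone.\<close>
  define K where "K = (\<i> * of_real (- ((cmod c)\<^sup>2 / 2)), \<i> / 2 * c * s)"
  have "cmod s < cmod c" using r a by (simp add: c_def s_def norm_divide divide_strict_right_mono)
  then have "cmod (\<i> / 2 * c * s) < - (- ((cmod c)\<^sup>2 / 2))"
    using cpos by (simp add: norm_mult norm_divide power2_eq_square)
  then have K: "K \<in> su_open_cone" unfolding su_open_cone_def K_def by blast
  have cc: "complex_of_real ((cmod c)\<^sup>2) = c * cnj c" by (rule complex_norm_square)
  have "su_mul K (c, s) = (- (\<i> / 2) * c, 0)"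
  proof -
    have "\<i> * of_real (- ((cmod c)\<^sup>2 / 2)) * c + \<i> / 2 * c * s * cnj s = - (\<i> / 2) * c * (c * cnj c - s * cnj s)"
      using cc by (simp add: algebra_simps)
    moreover have "\<i> * of_real (- ((cmod c)\<^sup>2 / 2)) * s + \<i> / 2 * c * s * cnj c = 0"
      using cc by (simp add: algebra_simps)
    ultimately show ?thesis using det by (simp add: su_mul_def K_def)
  qed
  moreover have "((\<lambda>\<theta>. szego (cis (\<theta> / 2)) a) has_vector_derivative (- (\<i> / 2) * c, 0)) (at \<theta>)"
  proof -
    have e: "cnj (cis (\<theta> / 2)) = exp (- (\<i> / 2 * of_real \<theta>))" for \<theta>
    proof -
      have "cnj (cis (\<theta> / 2)) = exp (\<i> * of_real (- (\<theta> / 2)))"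
        unfolding cis_cnj by (rule cis_conv_exp)
      also have "\<i> * of_real (- (\<theta> / 2)) = - (\<i> / 2 * of_real \<theta>)" by simp
      finally show ?thesis .
    qed
    have "((\<lambda>\<theta>. exp (- (\<i> / 2 * of_real \<theta>)) / szego_\<rho> a) has_vector_derivative - (\<i> / 2) * c) (at \<theta>)"
      by (rule has_vector_derivative_real_field)
        (use r in \<open>auto intro!: derivative_eq_intros simp: c_def e\<close>)
    then show ?thesis unfolding szego_def
      by (intro has_vector_derivative_Pair) (simp_all add: e)
  qed
  ultimately show thesis using that[OF K] by (simp add: szego_def c_def s_def)
qed

text \<open>By the Leibniz rule a further factor \<open>t\<close> conjugates the logarithmic
  derivative by \<open>t\<close> and adds that of \<open>t\<close>; a sum of elements of the closed
  and the open cone lies in the open cone.\<close>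

lemma transfer_has_derivative:
  assumes a: "\<forall>n. cmod (\<alpha> n) < 1" and p: "0 < p"
  obtains K where "K \<in> su_open_cone"
    "((\<lambda>\<theta>. transfer (cis (\<theta> / 2)) \<alpha> n p) has_vector_derivative su_mul K (transfer (cis (\<theta> / 2)) \<alpha> n p)) (at \<theta>)"
proof -
  have step: "\<exists>K\<in>su_open_cone. ((\<lambda>\<theta>. transfer (cis (\<theta> / 2)) \<alpha> n (Suc p)) has_vector_derivative
      su_mul K (transfer (cis (\<theta> / 2)) \<alpha> n (Suc p))) (at \<theta>)"
    if K: "K \<in> su_cone" "((\<lambda>\<theta>. transfer (cis (\<theta> / 2)) \<alpha> n p) has_vector_derivative
      su_mul K (transfer (cis (\<theta> / 2)) \<alpha> n p)) (at \<theta>)" for K p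
  proof -
    let ?t = "szego (cis (\<theta> / 2)) (\<alpha> (n + int p))" and ?M = "transfer (cis (\<theta> / 2)) \<alpha> n p"
    obtain K0 where K0: "K0 \<in> su_open_cone"
      "((\<lambda>\<theta>. szego (cis (\<theta> / 2)) (\<alpha> (n + int p))) has_vector_derivative su_mul K0 ?t) (at \<theta>)"
      using szego_has_derivative a by blast
    obtain K1 where K1: "K1 \<in> su_cone" "su_mul ?t K = su_mul K1 ?t"
      using su_cone_conjugate[OF szego_SU11 K(1), of "cis (\<theta> / 2)"] a by (metis norm_cis)
    have "((\<lambda>\<theta>. transfer (cis (\<theta> / 2)) \<alpha> n (Suc p)) has_vector_derivative
        (su_mul ?t (su_mul K ?M) + su_mul (su_mul K0 ?t) ?M)) (at \<theta>)"
      using bounded_bilinear.has_vector_derivative[OF bounded_bilinear_su_mul K0(2) K(2)] by simp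
    moreover have "su_mul ?t (su_mul K ?M) = su_mul K1 (su_mul ?t ?M)"
      unfolding su_mul_assoc[symmetric] K1(2) ..
    ultimately have "((\<lambda>\<theta>. transfer (cis (\<theta> / 2)) \<alpha> n (Suc p)) has_vector_derivative
        su_mul (K1 + K0) (transfer (cis (\<theta> / 2)) \<alpha> n (Suc p))) (at \<theta>)"
      by (simp add: bounded_bilinear.add_left[OF bounded_bilinear_su_mul] su_mul_assoc)
    then show ?thesis using su_cone_add[OF K1(1) K0(1)] by blast
  qed
  have "\<exists>K\<in>su_open_cone. ((\<lambda>\<theta>. transfer (cis (\<theta> / 2)) \<alpha> n (Suc k)) has_vector_derivative
      su_mul K (transfer (cis (\<theta> / 2)) \<alpha> n (Suc k))) (at \<theta>)" for k
  proof (induction k)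
    case 0
    \<comment> \<open>The empty product has logarithmic derivative 0, which lies in the closed cone
      only; this is why \<open>step\<close> starts from the closed cone.\<close>
    have "(0, 0) \<in> su_cone" unfolding su_cone_def by (auto intro!: exI[of _ 0])
    then show ?case by (rule step) (simp add: su_mul_def flip: zero_prod_def)
  next
    case (Suc k)
    then show ?case using step su_open_cone_subset by blast
  qed
  then show thesis using p that by (metis gr0_conv_Suc)
qed

section \<open>Monotonicity of the discriminant and behaviour at its edges\<close>

text \<open>The spectral parameter is \<open>cis \<theta>\<close>; the half angle avoids a branch of the square root at the
  price of the period \<open>4 * pi\<close>.\<close>

definition disc :: "(int \<Rightarrow> complex) \<Rightarrow> nat \<Rightarrow> real \<Rightarrow> real" where
  "disc \<alpha> p \<theta> = discriminant (cis (\<theta> / 2)) \<alpha> p"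

lemma transfer_derivatives:
  assumes a: "\<forall>n. cmod (\<alpha> n) < 1" and p: "0 < p"
  obtains \<kappa> \<beta> where "cmod \<beta> < - \<kappa>"
    "((\<lambda>\<theta>. fst (transfer (cis (\<theta> / 2)) \<alpha> 0 p)) has_vector_derivative
      (\<i> * of_real \<kappa> * fst (transfer (cis (\<theta> / 2)) \<alpha> 0 p) + \<beta> * cnj (snd (transfer (cis (\<theta> / 2)) \<alpha> 0 p)))) (at \<theta>)"
    "((\<lambda>\<theta>. snd (transfer (cis (\<theta> / 2)) \<alpha> 0 p)) has_vector_derivative
      (\<i> * of_real \<kappa> * snd (transfer (cis (\<theta> / 2)) \<alpha> 0 p) + \<beta> * cnj (fst (transfer (cis (\<theta> / 2)) \<alpha> 0 p)))) (at \<theta>)"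
proof -
  obtain K where K: "K \<in> su_open_cone"
    "((\<lambda>\<theta>. transfer (cis (\<theta> / 2)) \<alpha> 0 p) has_vector_derivative su_mul K (transfer (cis (\<theta> / 2)) \<alpha> 0 p)) (at \<theta>)"
    using transfer_has_derivative[OF assms] by blast
  obtain \<kappa> \<beta> where kb: "K = (\<i> * of_real \<kappa>, \<beta>)" "cmod \<beta> < - \<kappa>" using K(1) unfolding su_open_cone_def by blast
  show thesis
    using that[OF kb(2)] bounded_linear.has_vector_derivative[OF bounded_linear_fst K(2)]
      bounded_linear.has_vector_derivative[OF bounded_linear_snd K(2)] by (simp add: kb su_mul_def)
qed

lemma disc_has_derivative:
  assumes "((\<lambda>\<theta>. fst (transfer (cis (\<theta> / 2)) \<alpha> 0 p)) has_vector_derivative D) (at \<theta>)"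
  shows "(disc \<alpha> p has_real_derivative 2 * Re D) (at \<theta>)"
proof -
  have "((\<lambda>\<theta>. Re (fst (transfer (cis (\<theta> / 2)) \<alpha> 0 p))) has_vector_derivative Re D) (at \<theta>)"
    by (rule bounded_linear.has_vector_derivative[OF bounded_linear_Re assms])
  then have "((\<lambda>\<theta>. Re (fst (transfer (cis (\<theta> / 2)) \<alpha> 0 p))) has_real_derivative Re D) (at \<theta>)"
    by (simp add: has_real_derivative_iff_has_vector_derivative)
  from DERIV_cmult[OF this, of 2] show ?thesis
    by (simp add: disc_def[abs_def] discriminant_def)
qed

lemma transfer_det_parts:
  fixes p :: nat
  assumes a: "\<forall>n. cmod (\<alpha> n) < 1"
  defines "A \<equiv> \<lambda>\<theta>. fst (transfer (cis (\<theta> / 2)) \<alpha> 0 p)" and "B \<equiv> \<lambda>\<theta>. snd (transfer (cis (\<theta> / 2)) \<alpha> 0 p)"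
  shows "(Re (A \<theta>))\<^sup>2 + (Im (A \<theta>))\<^sup>2 = 1 + (cmod (B \<theta>))\<^sup>2" "disc \<alpha> p \<theta> = 2 * Re (A \<theta>)"
proof -
  have "A \<theta> * cnj (A \<theta>) - B \<theta> * cnj (B \<theta>) = 1"
    using transfer_SU11[of "cis (\<theta> / 2)" \<alpha> 0 p] a by (simp add: SU11_def A_def B_def)
  then have "complex_of_real ((cmod (A \<theta>))\<^sup>2 - (cmod (B \<theta>))\<^sup>2) = of_real 1"
    by (simp add: complex_norm_square del: of_real_power)
  then have "(cmod (A \<theta>))\<^sup>2 - (cmod (B \<theta>))\<^sup>2 = 1" using of_real_eq_iff by blast
  then show "(Re (A \<theta>))\<^sup>2 + (Im (A \<theta>))\<^sup>2 = 1 + (cmod (B \<theta>))\<^sup>2" by (simp add: cmod_power2)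
  show "disc \<alpha> p \<theta> = 2 * Re (A \<theta>)" by (simp add: disc_def discriminant_def A_def)
qed

lemma continuous_disc:
  assumes "\<forall>n. cmod (\<alpha> n) < 1"
  shows "continuous_on S (disc \<alpha> p)"
proof (cases "p = 0")
  case True
  then show ?thesis by (simp add: disc_def[abs_def] discriminant_def)
next
  case False
  have "isCont (disc \<alpha> p) \<theta>" for \<theta>
    using transfer_derivatives[OF assms, of p \<theta>] False disc_has_derivative DERIV_isCont
    by (metis bot_nat_0.not_eq_extremum)
  then show ?thesis by (simp add: continuous_at_imp_continuous_on)
qed

text \<open>Half the derivative is \<open>Re (\<beta> * cnj B) - \<kappa> * Im A\<close>. For
  |\<Delta>| < 2 the determinant gives |B| < |Im A|, and |\<beta>| < -\<kappa> lets the second term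
  dominate. At |\<Delta>| = 2 the moduli of \<open>B\<close> and \<open>Im A\<close> agree, and for
  nonzero \<open>B\<close> the strictness of the cone decides.\<close>

lemma disc_deriv_nonzero:
  assumes a: "\<forall>n. cmod (\<alpha> n) < 1" and p: "0 < p"
    and d: "\<bar>disc \<alpha> p \<theta>\<bar> < 2 \<or> \<bar>disc \<alpha> p \<theta>\<bar> = 2 \<and> snd (transfer (cis (\<theta> / 2)) \<alpha> 0 p) \<noteq> 0"
  obtains D where "D \<noteq> 0" "(disc \<alpha> p has_real_derivative D) (at \<theta>)"
proof -
  define A B where "A = fst (transfer (cis (\<theta> / 2)) \<alpha> 0 p)" and "B = snd (transfer (cis (\<theta> / 2)) \<alpha> 0 p)"
  obtain \<kappa> \<beta> where kb: "cmod \<beta> < - \<kappa>"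
    "((\<lambda>\<theta>. fst (transfer (cis (\<theta> / 2)) \<alpha> 0 p)) has_vector_derivative (\<i> * of_real \<kappa> * A + \<beta> * cnj B)) (at \<theta>)"
    using transfer_derivatives[OF a p, of \<theta>] unfolding A_def B_def by metis
  note D = disc_has_derivative[OF kb(2)]
  have det: "(Re A)\<^sup>2 + (Im A)\<^sup>2 = 1 + (cmod B)\<^sup>2" and dA: "disc \<alpha> p \<theta> = 2 * Re A"
    using transfer_det_parts[OF a] by (simp_all add: A_def B_def)
  have "cmod (\<beta> * cnj B) < \<bar>\<kappa> * Im A\<bar>"
  proof -
    have k0: "0 < - \<kappa>" using kb(1) norm_ge_zero[of \<beta>] by linarith
    from d show ?thesis
    proof
      assume "\<bar>disc \<alpha> p \<theta>\<bar> < 2"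
      then have "(Re A)\<^sup>2 < 1" by (simp add: dA abs_square_less_1)
      then have "(cmod B)\<^sup>2 < (\<bar>Im A\<bar>)\<^sup>2" using det by simp
      then have "cmod B < \<bar>Im A\<bar>" by (rule power_less_imp_less_base) simp
      then have "(- \<kappa>) * cmod B < (- \<kappa>) * \<bar>Im A\<bar>" using k0 by (intro mult_strict_left_mono)
      moreover have "cmod \<beta> * cmod B \<le> (- \<kappa>) * cmod B" using kb(1) by (intro mult_right_mono) auto
      ultimately have "cmod \<beta> * cmod B < (- \<kappa>) * \<bar>Im A\<bar>" by linarith
      then show ?thesis using k0 by (simp add: norm_mult abs_mult)
    next
      assume "\<bar>disc \<alpha> p \<theta>\<bar> = 2 \<and> snd (transfer (cis (\<theta> / 2)) \<alpha> 0 p) \<noteq> 0"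
      then have "\<bar>Re A\<bar> = 1" and B: "B \<noteq> 0" using dA by (linarith, simp add: B_def)
      then have "(Re A)\<^sup>2 = 1" by (metis power2_abs one_power2)
      then have "(cmod B)\<^sup>2 = (\<bar>Im A\<bar>)\<^sup>2" using det by simp
      then have eq: "cmod B = \<bar>Im A\<bar>" by (rule power2_eq_imp_eq) simp_all
      have "cmod \<beta> * cmod B < (- \<kappa>) * cmod B"
        by (rule mult_strict_right_mono[OF kb(1)]) (use B in simp)
      then have "cmod \<beta> * cmod B < (- \<kappa>) * \<bar>Im A\<bar>" unfolding eq .
      then show ?thesis using k0 by (simp add: norm_mult abs_mult)
    qed
  qed
  moreover have "\<bar>Re (\<beta> * cnj B)\<bar> \<le> cmod (\<beta> * cnj B)" by (rule abs_Re_le_cmod)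
  ultimately have "Re (\<i> * of_real \<kappa> * A + \<beta> * cnj B) \<noteq> 0" by auto
  then show thesis by (intro that[OF _ D]) simp
qed

text \<open>The monodromy is 1 or -1 here, so the derivative of \<Delta> vanishes. To first order
  \<open>Im A\<close> and \<open>B\<close> have slopes of modulus -\<kappa> and |\<beta>|, hence |Im
  A| > |B| nearby, and the determinant gives |Re A| < 1: the discriminant touches the edge from
  inside.\<close>

lemma disc_gap_closed:
  assumes a: "\<forall>n. cmod (\<alpha> n) < 1" and p: "0 < p"
    and d: "\<bar>disc \<alpha> p \<theta>\<bar> = 2" and B0: "snd (transfer (cis (\<theta> / 2)) \<alpha> 0 p) = 0"
  shows "\<forall>\<^sub>F y in at \<theta>. \<bar>disc \<alpha> p y\<bar> < 2"
proof -
  define A B where "A = (\<lambda>\<theta>. fst (transfer (cis (\<theta> / 2)) \<alpha> 0 p))" and "B = (\<lambda>\<theta>. snd (transfer (cis (\<theta> / 2)) \<alpha> 0 p))"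
  obtain \<kappa> \<beta> where kb: "cmod \<beta> < - \<kappa>"
    "(A has_vector_derivative (\<i> * of_real \<kappa> * A \<theta> + \<beta> * cnj (B \<theta>))) (at \<theta>)"
    "(B has_vector_derivative (\<i> * of_real \<kappa> * B \<theta> + \<beta> * cnj (A \<theta>))) (at \<theta>)"
    using transfer_derivatives[OF a p, of \<theta>] unfolding A_def B_def by metis
  have det: "(Re (A y))\<^sup>2 + (Im (A y))\<^sup>2 = 1 + (cmod (B y))\<^sup>2" and dA: "disc \<alpha> p y = 2 * Re (A y)" for y
    using transfer_det_parts[OF a] by (simp_all add: A_def B_def)
  have B0': "B \<theta> = 0" using B0 by (simp add: B_def)
  have R1: "\<bar>Re (A \<theta>)\<bar> = 1" using d by (simp add: dA)
  then have "(Re (A \<theta>))\<^sup>2 = 1" by (metis power2_abs one_power2)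
  then have I0: "Im (A \<theta>) = 0" using det[of \<theta>] by (simp add: B0')
  have A1: "cmod (A \<theta>) = 1" using R1 I0 by (simp add: cmod_def)
  have Ad: "((\<lambda>y. Im (A y)) has_real_derivative \<kappa> * Re (A \<theta>)) (at \<theta>)"
    using bounded_linear.has_vector_derivative[OF bounded_linear_Im kb(2)]
    by (simp add: B0' has_real_derivative_iff_has_vector_derivative)
  have "((\<lambda>y. (Im (A y) - Im (A \<theta>)) / (y - \<theta>)) \<longlongrightarrow> \<kappa> * Re (A \<theta>)) (at \<theta>)"
    using Ad unfolding has_field_derivative_iff .
  then have l1: "((\<lambda>y. Im (A y) / (y - \<theta>)) \<longlongrightarrow> \<kappa> * Re (A \<theta>)) (at \<theta>)"
    unfolding I0 by simp
  define \<beta>' where "\<beta>' = \<beta> * cnj (A \<theta>)"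
  have "((\<lambda>y. Re (B y)) has_real_derivative Re \<beta>') (at \<theta>)" "((\<lambda>y. Im (B y)) has_real_derivative Im \<beta>') (at \<theta>)"
    using kb(3) unfolding has_vector_derivative_complex_iff B0' \<beta>'_def by simp_all
  then have l2: "((\<lambda>y. Re (B y) / (y - \<theta>)) \<longlongrightarrow> Re \<beta>') (at \<theta>)" "((\<lambda>y. Im (B y) / (y - \<theta>)) \<longlongrightarrow> Im \<beta>') (at \<theta>)"
    unfolding has_field_derivative_iff B0' by simp_all
  have "((\<lambda>y. (Im (A y) / (y - \<theta>))\<^sup>2 - (Re (B y) / (y - \<theta>))\<^sup>2 - (Im (B y) / (y - \<theta>))\<^sup>2) \<longlongrightarrow>
      (\<kappa> * Re (A \<theta>))\<^sup>2 - (Re \<beta>')\<^sup>2 - (Im \<beta>')\<^sup>2) (at \<theta>)"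
    by (intro tendsto_intros l1 l2)
  moreover have "0 < (\<kappa> * Re (A \<theta>))\<^sup>2 - (Re \<beta>')\<^sup>2 - (Im \<beta>')\<^sup>2"
  proof -
    have "(Re \<beta>')\<^sup>2 + (Im \<beta>')\<^sup>2 = (cmod \<beta>')\<^sup>2" by (rule cmod_power2[symmetric])
    also have "\<dots> = (cmod \<beta>)\<^sup>2" using A1 by (simp add: \<beta>'_def norm_mult)
    finally have "(Re \<beta>')\<^sup>2 + (Im \<beta>')\<^sup>2 = (cmod \<beta>)\<^sup>2" .
    moreover have "(cmod \<beta>)\<^sup>2 < (- \<kappa>)\<^sup>2" using kb(1) by (intro power_strict_mono) auto
    moreover have "(\<kappa> * Re (A \<theta>))\<^sup>2 = \<kappa>\<^sup>2" using \<open>(Re (A \<theta>))\<^sup>2 = 1\<close> by (simp add: power_mult_distrib)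
    ultimately show ?thesis by simp
  qed
  ultimately have "\<forall>\<^sub>F y in at \<theta>. 0 < (Im (A y) / (y - \<theta>))\<^sup>2 - (Re (B y) / (y - \<theta>))\<^sup>2 - (Im (B y) / (y - \<theta>))\<^sup>2"
    by (rule order_tendstoD)
  moreover have "\<forall>\<^sub>F y in at \<theta>. y \<noteq> \<theta>" by (simp add: eventually_at_filter)
  ultimately show ?thesis
  proof eventually_elim
    case (elim y)
    then have "0 < ((Im (A y))\<^sup>2 - (Re (B y))\<^sup>2 - (Im (B y))\<^sup>2) / (y - \<theta>)\<^sup>2"
      by (simp add: power_divide diff_divide_distrib)
    then have "(cmod (B y))\<^sup>2 < (Im (A y))\<^sup>2"
      by (simp add: cmod_power2 zero_less_divide_iff)
    then have "(Re (A y))\<^sup>2 < 1" using det[of y] by linarith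
    then show ?case by (simp add: dA abs_square_less_1)
  qed
qed

text \<open>At an open gap \<Delta> crosses the edge transversally; at a closed one the previous
  lemma applies. In both cases the edge is isolated and a limit of interior points of a
  band.\<close>

lemma disc_edge:
  assumes a: "\<forall>n. cmod (\<alpha> n) < 1" and p: "0 < p" and d: "\<bar>disc \<alpha> p \<theta>\<bar> = 2"
  shows "\<forall>\<^sub>F y in at \<theta>. \<bar>disc \<alpha> p y\<bar> \<noteq> 2" "\<exists>\<^sub>F y in at \<theta>. \<bar>disc \<alpha> p y\<bar> < 2"
proof -
  have "(\<forall>\<^sub>F y in at \<theta>. \<bar>disc \<alpha> p y\<bar> \<noteq> 2) \<and> (\<exists>\<^sub>F y in at \<theta>. \<bar>disc \<alpha> p y\<bar> < 2)"
  proof (cases "snd (transfer (cis (\<theta> / 2)) \<alpha> 0 p) = 0")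
    case True
    have ev: "\<forall>\<^sub>F y in at \<theta>. \<bar>disc \<alpha> p y\<bar> < 2" by (rule disc_gap_closed[OF a p d True])
    then have "\<forall>\<^sub>F y in at \<theta>. \<bar>disc \<alpha> p y\<bar> \<noteq> 2" by eventually_elim simp
    moreover have "\<exists>\<^sub>F y in at \<theta>. \<bar>disc \<alpha> p y\<bar> < 2" using ev by (intro eventually_frequently) simp_all
    ultimately show ?thesis by blast
  next
    case False
    obtain D where D: "D \<noteq> 0" "(disc \<alpha> p has_real_derivative D) (at \<theta>)"
      using disc_deriv_nonzero[OF a p] d False by blast
    \<comment> \<open>The sign that turns the edge value into \<open>f \<theta> = 2\<close>, so that
      one argument covers both edges.\<close>
    define s where "s = disc \<alpha> p \<theta> / 2"
    define f where "f = (\<lambda>y. s * disc \<alpha> p y)"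
    have s1: "\<bar>s\<bar> = 1" using d by (simp add: s_def)
    have fabs: "\<bar>f y\<bar> = \<bar>disc \<alpha> p y\<bar>" for y using s1 by (simp add: f_def abs_mult)
    have "disc \<alpha> p \<theta> = 2 \<or> disc \<alpha> p \<theta> = - 2" using d by linarith
    then have f2: "f \<theta> = 2" by (auto simp: f_def s_def)
    have fD: "(f has_real_derivative s * D) (at \<theta>)" unfolding f_def by (rule DERIV_cmult[OF D(2)])
    have sD: "s * D \<noteq> 0" using s1 D(1) by auto
    have "(f \<longlongrightarrow> 2) (at \<theta>)" using DERIV_isCont[OF fD] f2 by (simp add: isCont_def)
    then have pos: "\<forall>\<^sub>F y in at \<theta>. -2 < f y" by (rule order_tendstoD) simp
    have "((\<lambda>y. (f y - f \<theta>) / (y - \<theta>)) \<longlongrightarrow> s * D) (at \<theta>)" using fD unfolding has_field_derivative_iff .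
    \<comment> \<open>The difference quotient has the sign of the nonzero derivative; hence
      \<open>f y \<noteq> 2\<close> nearby, and \<open>f\<close> cannot stay at or above 2 on both
      sides.\<close>
    then have q: "\<forall>\<^sub>F y in at \<theta>. (f y - 2) / (y - \<theta>) * (s * D) > 0"
    proof -
      assume l: "((\<lambda>y. (f y - f \<theta>) / (y - \<theta>)) \<longlongrightarrow> s * D) (at \<theta>)"
      have "((\<lambda>y. (f y - 2) / (y - \<theta>) * (s * D)) \<longlongrightarrow> (s * D) * (s * D)) (at \<theta>)"
        using l unfolding f2 by (intro tendsto_intros)
      then show ?thesis using sD by (intro order_tendstoD) (auto simp: not_square_less_zero less_le)
    qed
    have ev: "\<forall>\<^sub>F y in at \<theta>. \<bar>disc \<alpha> p y\<bar> \<noteq> 2"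
      using pos q unfolding fabs[symmetric]
      by eventually_elim (smt (verit) divide_eq_0_iff mult_eq_0_iff)
    have "\<exists>\<^sub>F y in at \<theta>. \<bar>disc \<alpha> p y\<bar> < 2"
    proof (rule ccontr)
      assume "\<not> (\<exists>\<^sub>F y in at \<theta>. \<bar>disc \<alpha> p y\<bar> < 2)"
      then have "\<forall>\<^sub>F y in at \<theta>. \<not> \<bar>disc \<alpha> p y\<bar> < 2" by (simp add: not_frequently)
      with pos q have "\<forall>\<^sub>F y in at \<theta>. (y - \<theta>) * (s * D) > 0"
      proof eventually_elim
        case (elim y)
        then have "f y \<ge> 2" using fabs[of y] by auto
        have "(f y - 2) / (y - \<theta>) * (s * D) = (f y - 2) * ((y - \<theta>) * (s * D)) / (y - \<theta>)\<^sup>2"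
          by (cases "y = \<theta>") (auto simp: power2_eq_square)
        then have "0 < (f y - 2) * ((y - \<theta>) * (s * D))"
          using elim(2) by (auto simp: zero_less_divide_iff)
        then show ?case using \<open>f y \<ge> 2\<close> by (meson diff_ge_0_iff_ge leD mult_nonneg_nonpos not_le)
      qed
      then obtain d where d: "d > 0" "\<And>y. y \<noteq> \<theta> \<Longrightarrow> dist y \<theta> < d \<Longrightarrow> (y - \<theta>) * (s * D) > 0"
        unfolding eventually_at by auto
      have "(d / 2) * (s * D) > 0" "- (d / 2) * (s * D) > 0"
        using d(2)[of "\<theta> + d / 2"] d(2)[of "\<theta> - d / 2"] d(1) by (auto simp: dist_real_def simp del: mult_minus_left)
      then show False by simp
    qed
    with ev show ?thesis by blast
  qed
  then show "\<forall>\<^sub>F y in at \<theta>. \<bar>disc \<alpha> p y\<bar> \<noteq> 2" "\<exists>\<^sub>F y in at \<theta>. \<bar>disc \<alpha> p y\<bar> < 2" by auto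
qed

lemma disc_periodic: "disc \<alpha> p (\<theta> + 4 * pi) = disc \<alpha> p \<theta>"
proof -
  have "cis ((\<theta> + 4 * pi) / 2) = cis (\<theta> / 2)"
    by (simp add: add_divide_distrib cis_mult[symmetric])
  then show ?thesis by (simp add: disc_def)
qed

text \<open>If the discriminant avoided \<open>[-2, 2]\<close>, then the quotient of the imaginary and the real part of the
  upper left entry would be a strictly decreasing periodic function.\<close>

lemma disc_nonempty:
  assumes a: "\<forall>n. cmod (\<alpha> n) < 1" and p: "0 < p"
  shows "\<exists>\<theta>. \<bar>disc \<alpha> p \<theta>\<bar> \<le> 2"
proof (rule ccontr)
  assume "\<not> ?thesis"
  then have gt: "2 < \<bar>disc \<alpha> p \<theta>\<bar>" for \<theta> by (meson not_le)
  define A B where "A = (\<lambda>\<theta>. fst (transfer (cis (\<theta> / 2)) \<alpha> 0 p))" and "B = (\<lambda>\<theta>. snd (transfer (cis (\<theta> / 2)) \<alpha> 0 p))"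
  have det: "(Re (A y))\<^sup>2 + (Im (A y))\<^sup>2 = 1 + (cmod (B y))\<^sup>2" and dA: "disc \<alpha> p y = 2 * Re (A y)" for y
    using transfer_det_parts[OF a] by (simp_all add: A_def B_def)
  have R0: "Re (A \<theta>) \<noteq> 0" for \<theta> using gt[of \<theta>] by (auto simp: dA)
  have der: "\<exists>D. ((\<lambda>y. Im (A y) / Re (A y)) has_real_derivative D) (at \<theta>) \<and> D < 0" for \<theta>
  proof -
    obtain \<kappa> \<beta> where kb: "cmod \<beta> < - \<kappa>"
      "(A has_vector_derivative (\<i> * of_real \<kappa> * A \<theta> + \<beta> * cnj (B \<theta>))) (at \<theta>)"
      using transfer_derivatives[OF a p, of \<theta>] unfolding A_def B_def by metis
    define A' where "A' = \<i> * of_real \<kappa> * A \<theta> + \<beta> * cnj (B \<theta>)"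
    have d: "((\<lambda>y. Re (A y)) has_real_derivative Re A') (at \<theta>)" "((\<lambda>y. Im (A y)) has_real_derivative Im A') (at \<theta>)"
      using kb(2) unfolding has_vector_derivative_complex_iff A'_def by simp_all
    have "((\<lambda>y. Im (A y) / Re (A y)) has_real_derivative
        (Im A' * Re (A \<theta>) - Im (A \<theta>) * Re A') / (Re (A \<theta>) * Re (A \<theta>))) (at \<theta>)"
      by (rule DERIV_divide[OF d(2,1) R0])
    moreover have "Im A' * Re (A \<theta>) - Im (A \<theta>) * Re A' < 0"
    proof -
      have "Im A' * Re (A \<theta>) - Im (A \<theta>) * Re A' = \<kappa> * (cmod (A \<theta>))\<^sup>2 + Im (\<beta> * cnj (B \<theta>) * cnj (A \<theta>))"
        unfolding cmod_power2 by (simp add: A'_def power2_eq_square algebra_simps)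
      also have "Im (\<beta> * cnj (B \<theta>) * cnj (A \<theta>)) \<le> cmod (\<beta> * cnj (B \<theta>) * cnj (A \<theta>))"
        using abs_Im_le_cmod[of "\<beta> * cnj (B \<theta>) * cnj (A \<theta>)"] by linarith
      also have "\<dots> = cmod \<beta> * (cmod (B \<theta>) * cmod (A \<theta>))" by (simp add: norm_mult)
      also have "\<dots> \<le> cmod \<beta> * (cmod (A \<theta>) * cmod (A \<theta>))"
      proof (intro mult_left_mono mult_right_mono)
        have "(cmod (B \<theta>))\<^sup>2 \<le> (cmod (A \<theta>))\<^sup>2" using det[of \<theta>] by (simp add: cmod_power2)
        then show "cmod (B \<theta>) \<le> cmod (A \<theta>)" by (rule power2_le_imp_le) simp
      qed auto
      also have "\<kappa> * (cmod (A \<theta>))\<^sup>2 + cmod \<beta> * (cmod (A \<theta>) * cmod (A \<theta>)) = (\<kappa> + cmod \<beta>) * (cmod (A \<theta>))\<^sup>2"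
        by (simp add: power2_eq_square algebra_simps)
      also have "\<dots> < 0" using kb(1) R0[of \<theta>] by (intro mult_neg_pos) auto
      finally show ?thesis by simp
    qed
    moreover have "0 < Re (A \<theta>) * Re (A \<theta>)" using R0[of \<theta>] by (simp add: zero_less_mult_iff) linarith
    ultimately show ?thesis using divide_neg_pos by blast
  qed
  have "Im (A (4 * pi)) / Re (A (4 * pi)) < Im (A 0) / Re (A 0)"
    by (rule DERIV_neg_imp_decreasing) (use der in auto)
  moreover have "A (4 * pi) = A 0" by (simp add: A_def)
  ultimately show False by simp
qed

text \<open>Points with |\<Delta>| < 2 are not critical, so by Rolle's theorem two equal values are
  separated by a point where |\<Delta>| \<ge> 2.\<close>

lemma disc_rolle:
  assumes a: "\<forall>n. cmod (\<alpha> n) < 1" and p: "0 < p"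
    and xy: "x < y" "disc \<alpha> p x = disc \<alpha> p y"
  obtains z where "x < z" "z < y" "2 \<le> \<bar>disc \<alpha> p z\<bar>"
proof (rule ccontr)
  assume no: "\<not> thesis"
  have lt: "\<bar>disc \<alpha> p z\<bar> < 2" if "x < z" "z < y" for z
    using no that \<open>\<And>z. x < z \<Longrightarrow> z < y \<Longrightarrow> 2 \<le> \<bar>disc \<alpha> p z\<bar> \<Longrightarrow> thesis\<close> by (meson not_le)
  have D: "\<exists>D. D \<noteq> 0 \<and> (disc \<alpha> p has_real_derivative D) (at z)" if "x < z" "z < y" for z
    using disc_deriv_nonzero[OF a p, of z] lt[OF that] by blast
  have "\<exists>z. x < z \<and> z < y \<and> DERIV (disc \<alpha> p) z :> 0"
    by (rule Rolle[OF xy continuous_disc[OF a]]) (use D real_differentiable_def in blast)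
  with D show False using DERIV_unique by metis
qed

lemma last_level_point:
  fixes f :: "real \<Rightarrow> real"
  assumes f: "continuous_on {x..y} f" and "x \<le> y" "c \<le> f x" "f y < c"
  obtains s where "x \<le> s" "s < y" "f s = c" "\<And>z. s < z \<Longrightarrow> z \<le> y \<Longrightarrow> f z < c"
proof -
  define L where "L = {x..y} \<inter> f -` {c..}"
  have "closed L" unfolding L_def by (rule continuous_closed_preimage[OF f]) auto
  moreover have "bounded L" unfolding L_def by (rule bounded_subset[of "{x..y}"]) auto
  moreover have "x \<in> L" using assms by (simp add: L_def)
  ultimately obtain s where s: "s \<in> L" "\<And>t. t \<in> L \<Longrightarrow> t \<le> s"
    using compact_attains_sup[of L] by (auto simp: compact_eq_bounded_closed)
  have s': "x \<le> s" "s \<le> y" "c \<le> f s" using s(1) by (auto simp: L_def)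
  have "continuous_on {s..y} f" by (rule continuous_on_subset[OF f]) (use s' in auto)
  then obtain z where z: "s \<le> z" "z \<le> y" "f z = c"
    using IVT2'[of f y c s] s' assms(4) by auto
  then have "z \<le> s" using s(2) s' by (auto simp: L_def)
  then have "f s = c" using z by simp
  moreover have "s < y" using s' assms(4) by (cases "s = y") auto
  moreover have "f z < c" if "s < z" "z \<le> y" for z
    using s(2)[of z] that s' by (auto simp: L_def not_le[symmetric])
  ultimately show thesis using that s' by blast
qed

text \<open>The maximal interval around \<theta> with |\<Delta>| < 2 ends at values 2 or -2. Equal
  end values are excluded by \<open>disc_rolle\<close>, so they differ by 4.\<close>

lemma disc_band:
  assumes a: "\<forall>n. cmod (\<alpha> n) < 1" and p: "0 < p" and d: "\<bar>disc \<alpha> p \<theta>\<bar> < 2"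
  obtains s t where "s < \<theta>" "\<theta> < t" "\<And>y. s \<le> y \<Longrightarrow> y \<le> t \<Longrightarrow> \<bar>disc \<alpha> p y\<bar> \<le> 2"
    "\<bar>disc \<alpha> p s - disc \<alpha> p t\<bar> = 4"
proof -
  define f where "f = (\<lambda>y. \<bar>disc \<alpha> p y\<bar>)"
  have cf: "continuous_on S f" for S unfolding f_def by (intro continuous_intros continuous_disc a)
  have cf': "continuous_on S (\<lambda>y. f (- y))" for S
    by (rule continuous_on_compose2[OF cf[of UNIV]]) (auto intro: continuous_intros)
  \<comment> \<open>Periodicity provides equal values at distance \<open>4 * pi\<close>, so Rolle's
    theorem yields a point outside the open band on either side.\<close>
  obtain x where x: "x < \<theta>" "2 \<le> f x"
    using disc_rolle[OF a p, of "\<theta> - 4 * pi" \<theta>] disc_periodic[of \<alpha> p "\<theta> - 4 * pi"] by (auto simp: f_def)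
  obtain x' where x': "\<theta> < x'" "2 \<le> f x'"
    using disc_rolle[OF a p, of \<theta> "\<theta> + 4 * pi"] disc_periodic[of \<alpha> p \<theta>] by (auto simp: f_def)
  obtain s where s: "s < \<theta>" "f s = 2" "\<And>z. s < z \<Longrightarrow> z \<le> \<theta> \<Longrightarrow> f z < 2"
    using last_level_point[OF cf, of x \<theta> 2] x d unfolding f_def by (metis less_imp_le)
  \<comment> \<open>The right end, obtained from the reflected function.\<close>
  obtain t' where t': "t' < - \<theta>" "f (- t') = 2" "\<And>z. t' < z \<Longrightarrow> z \<le> - \<theta> \<Longrightarrow> f (- z) < 2"
    using last_level_point[OF cf', of "- x'" "- \<theta>" 2] x' d unfolding f_def by (metis less_imp_le minus_minus neg_less_iff_less)
  define t where "t = - t'"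
  have t: "\<theta> < t" "f t = 2" "\<And>z. \<theta> \<le> z \<Longrightarrow> z < t \<Longrightarrow> f z < 2"
    using t'(1,2) t'(3)[of "- z" for z] unfolding t_def by auto
  have in_band: "f y \<le> 2" if "s \<le> y" "y \<le> t" for y
    using s t that by (smt (verit))
  have "disc \<alpha> p s \<noteq> disc \<alpha> p t"
  proof
    assume "disc \<alpha> p s = disc \<alpha> p t"
    then obtain z where z: "s < z" "z < t" "2 \<le> f z"
      using disc_rolle[OF a p, of s t] s(1) t(1) unfolding f_def by (metis less_trans)
    then show False using s(3)[of z] t(3)[of z] by linarith
  qed
  then have "\<bar>disc \<alpha> p s - disc \<alpha> p t\<bar> = 4"
    using s(2) t(2) unfolding f_def by (auto simp: abs_if split: if_splits)
  then show thesis using that s(1) t(1) in_band unfolding f_def by blast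
qed

lemma periodic_uniform:
  fixes f :: "real \<Rightarrow> real"
  assumes f: "continuous_on UNIV f" and T: "0 < T" and per: "\<And>x. f (x + T) = f x" and e: "0 < e"
  obtains d where "0 < d" "\<And>x y. \<bar>x - y\<bar> < d \<Longrightarrow> \<bar>f x - f y\<bar> < e"
proof -
  have "uniformly_continuous_on {0..2 * T} f"
    by (intro compact_uniformly_continuous continuous_on_subset[OF f]) auto
  then obtain d where d: "0 < d" "\<And>x y. x \<in> {0..2 * T} \<Longrightarrow> y \<in> {0..2 * T} \<Longrightarrow> \<bar>y - x\<bar> < d \<Longrightarrow> \<bar>f y - f x\<bar> < e"
    unfolding uniformly_continuous_on_def dist_real_def using e by metis
  have pern: "f (x + of_int k * T) = f x" for x k
  proof (induction k arbitrary: x rule: int_induct[where k = 0])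
    case (step1 i)
    have "f (x + of_int (i + 1) * T) = f ((x + of_int i * T) + T)" by (simp add: algebra_simps)
    then show ?case using step1 per by simp
  next
    case (step2 i)
    have "f (x + of_int (i - 1) * T) = f ((x + of_int (i - 1) * T) + T)" by (simp add: per)
    also have "(x + of_int (i - 1) * T) + T = x + of_int i * T" by (simp add: algebra_simps)
    finally show ?case using step2 by simp
  qed simp
  have main: "\<bar>f x - f y\<bar> < e" if xy: "\<bar>x - y\<bar> < min d T" "x \<le> y" for x y
  proof -
    \<comment> \<open>Translation by a multiple of the period brings \<open>x\<close> into
      \<open>{0..<T}\<close>; then \<open>y\<close>, at distance less than \<open>T\<close>, lies in
      \<open>{0..2 * T}\<close>.\<close>
    define k where "k = - \<lfloor>x / T\<rfloor>"
    have "of_int \<lfloor>x / T\<rfloor> \<le> x / T" "x / T < of_int \<lfloor>x / T\<rfloor> + 1" by linarith+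
    then have "of_int \<lfloor>x / T\<rfloor> * T \<le> x / T * T" and "x / T * T < (of_int \<lfloor>x / T\<rfloor> + 1) * T"
      using mult_right_mono[of "of_int \<lfloor>x / T\<rfloor>" "x / T" T] mult_strict_right_mono[OF _ T, of "x / T" "of_int \<lfloor>x / T\<rfloor> + 1"] T
      by (auto simp del: floor_le_iff)
    then have "0 \<le> x + of_int k * T" "x + of_int k * T < T"
      using T by (simp_all add: k_def algebra_simps)
    then have "\<bar>f (x + of_int k * T) - f (y + of_int k * T)\<bar> < e"
      using d(2)[of "y + of_int k * T" "x + of_int k * T"] xy by (simp add: abs_if split: if_splits)
    then show ?thesis by (simp add: pern)
  qed
  show thesis
  proof (rule that[of "min d T"])
    fix x y :: real assume "\<bar>x - y\<bar> < min d T"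
    then show "\<bar>f x - f y\<bar> < e" using main[of x y] main[of y x] by (cases "x \<le> y") (auto simp: abs_minus_commute)
  qed (use d T in simp)
qed

section \<open>Arc length of periodic spectra\<close>

lemma cis_lipschitz: "cmod (cis a - cis b) \<le> \<bar>a - b\<bar>"
proof -
  have "cis a - cis b = cis b * (cis (a - b) - 1)" by (simp add: algebra_simps cis_mult)
  then have "cmod (cis a - cis b) = cmod (cis (a - b) - 1)" by (simp add: norm_mult)
  also have "\<dots> = 2 * \<bar>sin ((a - b) / 2)\<bar>" unfolding cis_conv_exp by (rule dist_exp_i_1)
  also have "\<dots> \<le> \<bar>a - b\<bar>" using abs_sin_x_le_abs_x[of "(a - b) / 2"] by simp
  finally show ?thesis .
qed

section \<open>Arc length as transported Lebesgue measure\<close>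

definition circle_lborel :: "real measure" where
  "circle_lborel = restrict_space lborel {0..<2 * pi}"

lemma space_circle_lborel [simp]: "space circle_lborel = {0..<2 * pi}"
  by (simp add: circle_lborel_def space_restrict_space)

lemma sets_circle_lborel: "A \<in> sets circle_lborel \<longleftrightarrow> A \<subseteq> {0..<2 * pi} \<and> A \<in> sets borel"
  by (simp add: circle_lborel_def sets_restrict_space_iff)

lemma measure_circle_lborel: "A \<subseteq> {0..<2 * pi} \<Longrightarrow> measure circle_lborel A = measure lborel A"
  by (simp add: circle_lborel_def measure_restrict_space)

lemma finite_measure_circle_lborel: "finite_measure circle_lborel"
  by (rule finite_measureI) (simp add: circle_lborel_def emeasure_restrict_space space_restrict_space)

lemma continuous_cis: "continuous_on S cis"
proof -
  have "continuous_on S (\<lambda>x. exp (\<i> * of_real x))" by (intro continuous_intros)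
  then show ?thesis by (simp add: cis_conv_exp[abs_def])
qed

lemma measurable_cis: "cis \<in> measurable circle_lborel borel"
  unfolding circle_lborel_def
  by (intro measurable_restrict_space1) (simp add: borel_measurable_continuous_onI continuous_cis)

lemma arc_length_eq: "arc_length = distr circle_lborel borel cis"
  by (simp add: arc_length_def circle_lborel_def)

lemma sets_arc_length [simp]: "sets arc_length = sets borel"
  by (simp add: arc_length_def)

lemma finite_measure_arc_length: "finite_measure arc_length"
  unfolding arc_length_eq by (rule finite_measure.finite_measure_distr[OF finite_measure_circle_lborel measurable_cis])

lemma measure_arc_length:
  assumes "S \<in> sets borel"
  shows "measure arc_length S = measure circle_lborel {\<theta>\<in>{0..<2 * pi}. cis \<theta> \<in> S}"
proof -
  have "measure arc_length S = measure circle_lborel (cis -` S \<inter> space circle_lborel)"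
    unfolding arc_length_eq by (rule measure_distr[OF measurable_cis assms])
  also have "cis -` S \<inter> space circle_lborel = {\<theta>\<in>{0..<2 * pi}. cis \<theta> \<in> S}" by auto
  finally show ?thesis .
qed

lemma preimage_circle_sets:
  assumes "S \<in> sets borel"
  shows "{\<theta>\<in>{0..<2 * pi}. cis \<theta> \<in> S} \<in> sets circle_lborel"
proof -
  have "cis -` S \<inter> space circle_lborel \<in> sets circle_lborel" by (rule measurable_sets[OF measurable_cis assms])
  also have "cis -` S \<inter> space circle_lborel = {\<theta>\<in>{0..<2 * pi}. cis \<theta> \<in> S}" by auto
  finally show ?thesis .
qed

lemma cis_add_2pi_int: "cis (x + 2 * pi * of_int k) = cis x"
  by (simp add: cis_mult[symmetric] cis_multiple_2pi)

text \<open>The arc may straddle the cut at angle 0, in which case its preimage splits into two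
  pieces; \<open>t - s \<le> 2 * pi\<close> keeps them disjoint.\<close>

lemma arc_length_ge_arc:
  assumes S: "S \<in> sets borel" and st: "s \<le> t" "t - s \<le> 2 * pi"
    and arc: "\<And>y. s \<le> y \<Longrightarrow> y \<le> t \<Longrightarrow> cis y \<in> S"
  shows "t - s \<le> measure arc_length S"
proof -
  interpret finite_measure circle_lborel by (rule finite_measure_circle_lborel)
  define k where "k = \<lfloor>s / (2 * pi)\<rfloor>"
  define s' where "s' = s - 2 * pi * of_int k"
  define t' where "t' = t - 2 * pi * of_int k"
  have "of_int k \<le> s / (2 * pi)" "s / (2 * pi) < of_int k + 1" unfolding k_def by linarith+
  then have s': "0 \<le> s'" "s' < 2 * pi" unfolding s'_def by (simp_all add: field_simps)
  have t': "t' - s' = t - s" by (simp add: s'_def t'_def)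
  have arc': "cis y \<in> S" if "s' \<le> y" "y \<le> t'" for y
    using arc[of "y + 2 * pi * of_int k"] that by (simp add: s'_def t'_def cis_add_2pi_int)
  define P where "P = {\<theta>\<in>{0..<2 * pi}. cis \<theta> \<in> S}"
  have P: "P \<in> sets circle_lborel" unfolding P_def by (rule preimage_circle_sets[OF S])
  have "t' - s' \<le> measure circle_lborel P"
  proof (cases "t' \<le> 2 * pi")
    case True
    have "{s'..<t'} \<subseteq> P" using True s' arc' by (auto simp: P_def)
    then have "measure circle_lborel {s'..<t'} \<le> measure circle_lborel P" by (rule finite_measure_mono[OF _ P])
    moreover have "measure circle_lborel {s'..<t'} = t' - s'"
      using True s' st t' by (subst measure_circle_lborel) auto
    ultimately show ?thesis by simp
  next
    case False
    define A where "A = {s'..<2 * pi}"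
    define B where "B = {0..<t' - 2 * pi}"
    have "t' - 2 * pi \<le> s'" using t' st by linarith
    then have AB: "A \<inter> B = {}" "A \<subseteq> {0..<2 * pi}" "B \<subseteq> {0..<2 * pi}" using s' by (auto simp: A_def B_def)
    have "A \<subseteq> P" using False s' arc' by (auto simp: A_def P_def)
    moreover have "B \<subseteq> P"
    proof
      fix y assume y: "y \<in> B"
      have "cis (y + 2 * pi) \<in> S" using y s' by (intro arc') (auto simp: B_def)
      then have "cis y \<in> S" using cis_add_2pi_int[of y 1] by simp
      then show "y \<in> P" using y AB(3) by (auto simp: P_def)
    qed
    ultimately have "measure circle_lborel (A \<union> B) \<le> measure circle_lborel P"
      by (intro finite_measure_mono[OF _ P]) auto
    moreover have "measure circle_lborel (A \<union> B) = measure circle_lborel A + measure circle_lborel B"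
      using AB by (intro finite_measure_Union) (auto simp: sets_circle_lborel A_def B_def)
    moreover have "measure circle_lborel A = 2 * pi - s'" "measure circle_lborel B = t' - 2 * pi"
      using AB s' False by (simp_all add: measure_circle_lborel A_def B_def)
    ultimately show ?thesis by simp
  qed
  then show ?thesis unfolding measure_arc_length[OF S] P_def[symmetric] t' .
qed

text \<open>The radius \<open>\<delta>\<^sub>0\<close> is an argument, unlike in
  \<open>homogeneous\<close>, because one and the same value has to serve all stages of the
  construction and their limit.\<close>

definition homogeneous_upto :: "real \<Rightarrow> real \<Rightarrow> complex set \<Rightarrow> bool" where
  "homogeneous_upto \<delta>\<^sub>0 \<tau> K \<longleftrightarrow>
     (\<forall>x\<in>K. \<forall>\<delta>. 0 < \<delta> \<and> \<delta> \<le> \<delta>\<^sub>0 \<longrightarrow> \<tau> * \<delta> \<le> measure arc_length (ball x \<delta> \<inter> K))"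

section \<open>Homogeneity of periodic spectra\<close>

definition periodic_coeffs :: "nat \<Rightarrow> (int \<Rightarrow> complex) \<Rightarrow> bool" where
  "periodic_coeffs p \<alpha> \<longleftrightarrow> 0 < p \<and> (\<forall>n. \<alpha> (n + int p) = \<alpha> n) \<and> (\<forall>n. cmod (\<alpha> n) < 1)"

abbreviation cmv_spectrum :: "(int \<Rightarrow> complex) \<Rightarrow> complex set" where
  "cmv_spectrum \<alpha> \<equiv> approx_spectrum (cmv_operator \<alpha>)"

lemma periodic_coeffsD:
  assumes "periodic_coeffs p \<alpha>"
  shows "0 < p" "\<forall>n. \<alpha> (n + int p) = \<alpha> n" "\<forall>n. cmod (\<alpha> n) < 1" "\<forall>n. cmod (\<alpha> n) \<le> 1"
  using assms by (auto simp: periodic_coeffs_def less_imp_le)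

lemma cis_in_cmv_spectrum:
  assumes "periodic_coeffs p \<alpha>"
  shows "cis \<theta> \<in> cmv_spectrum \<alpha> \<longleftrightarrow> \<bar>disc \<alpha> p \<theta>\<bar> \<le> 2"
proof -
  have "(cis (\<theta> / 2))\<^sup>2 = cis \<theta>" by (simp add: power2_eq_square cis_mult)
  then show ?thesis using periodic_spectrum[of "cis (\<theta> / 2)" \<alpha> p] periodic_coeffsD[OF assms]
    by (simp add: disc_def)
qed

lemma circle_cis:
  assumes "z \<in> sphere 0 1"
  obtains \<theta> where "0 \<le> \<theta>" "\<theta> < 2 * pi" "z = cis \<theta>"
  using assms by (metis Arg2pi_eq Arg2pi_ge_0 Arg2pi_lt_2pi cis_conv_exp mem_sphere_0 mult.left_neutral of_real_1)

lemma cmv_spectrumE: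
  assumes "periodic_coeffs p \<alpha>" "z \<in> cmv_spectrum \<alpha>"
  obtains \<theta> where "z = cis \<theta>" "\<bar>disc \<alpha> p \<theta>\<bar> \<le> 2"
proof -
  have "z \<in> sphere 0 1" using approx_spectrum_circle[OF periodic_coeffsD(4)[OF assms(1)]] assms(2) by blast
  then obtain \<theta> where "z = cis \<theta>" using circle_cis by metis
  then show thesis using that cis_in_cmv_spectrum[OF assms(1)] assms(2) by blast
qed

lemma borel_cmv_spectrum:
  assumes "\<forall>n. cmod (\<alpha> n) \<le> 1"
  shows "cmv_spectrum \<alpha> \<in> sets borel"
  by (rule borel_closed[OF closed_approx_spectrum[OF assms]])

text \<open>A band of length at least \<open>2 * \<delta>\<close> contains an interval of length
  \<delta> on one side of each of its points. At a band edge there is only this one side, whence the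
  constant 1.\<close>

lemma small_scale_homogeneous:
  assumes per: "periodic_coeffs p \<alpha>" and d: "0 < \<delta>" "\<delta> \<le> 2 * pi"
    and band: "\<And>\<theta>. \<bar>disc \<alpha> p \<theta>\<bar> < 2 \<Longrightarrow> \<exists>s t. s \<le> \<theta> \<and> \<theta> \<le> t \<and> 2 * \<delta> \<le> t - s \<and> (\<forall>y. s \<le> y \<and> y \<le> t \<longrightarrow> \<bar>disc \<alpha> p y\<bar> \<le> 2)"
    and x: "x \<in> cmv_spectrum \<alpha>"
  shows "\<delta> \<le> measure arc_length (ball x \<delta> \<inter> cmv_spectrum \<alpha>)"
proof (rule dense_le_bounded[OF d(1)])
  fix w :: real assume w: "0 < w" "w < \<delta>"
  \<comment> \<open>Room for moving from a band edge \<theta> to an interior point \<open>y\<close>,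
    for which \<open>band\<close> is available; it shrinks to 0 as \<open>w\<close> tends to
    \<delta>.\<close>
  define e where "e = \<delta> - w"
  note perD = periodic_coeffsD[OF per]
  obtain \<theta> where \<theta>: "x = cis \<theta>" "\<bar>disc \<alpha> p \<theta>\<bar> \<le> 2" using cmv_spectrumE[OF per x] .
  have "\<exists>y. \<bar>disc \<alpha> p y\<bar> < 2 \<and> \<bar>y - \<theta>\<bar> < e"
  proof (cases "\<bar>disc \<alpha> p \<theta>\<bar> < 2")
    case True
    then show ?thesis using w by (intro exI[of _ \<theta>]) (simp add: e_def)
  next
    case False
    then have "\<bar>disc \<alpha> p \<theta>\<bar> = 2" using \<theta>(2) by simp
    then have "\<exists>\<^sub>F y in at \<theta>. \<bar>disc \<alpha> p y\<bar> < 2" using disc_edge(2) perD by blast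
    moreover have "\<forall>\<^sub>F y in at \<theta>. \<bar>disc \<alpha> p y\<bar> < 2 \<longrightarrow> \<bar>disc \<alpha> p y\<bar> < 2 \<and> \<bar>y - \<theta>\<bar> < e"
      using w by (auto simp: eventually_at dist_real_def e_def intro!: exI[of _ e])
    ultimately have "\<exists>\<^sub>F y in at \<theta>. \<bar>disc \<alpha> p y\<bar> < 2 \<and> \<bar>y - \<theta>\<bar> < e" by (rule frequently_rev_mp)
    then show ?thesis by (rule frequently_ex)
  qed
  then obtain y where y: "\<bar>disc \<alpha> p y\<bar> < 2" "\<bar>y - \<theta>\<bar> < e" by blast
  obtain s t where st: "s \<le> y" "y \<le> t" "2 * \<delta> \<le> t - s" "\<And>v. s \<le> v \<Longrightarrow> v \<le> t \<Longrightarrow> \<bar>disc \<alpha> p v\<bar> \<le> 2"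
    using band[OF y(1)] by blast
  define K where "K = ball x \<delta> \<inter> cmv_spectrum \<alpha>"
  have K: "K \<in> sets borel" unfolding K_def by (intro sets.Int borel_cmv_spectrum perD(4)) auto
  have inK: "cis v \<in> K" if "s \<le> v" "v \<le> t" "\<bar>v - y\<bar> \<le> w" for v
  proof -
    have "dist x (cis v) \<le> \<bar>\<theta> - v\<bar>" using cis_lipschitz[of \<theta> v] by (simp add: \<theta> dist_norm)
    also have "\<dots> < \<delta>" using that(3) y(2) by (simp add: e_def)
    finally show ?thesis unfolding K_def using st(4) that cis_in_cmv_spectrum[OF per] by simp
  qed
  \<comment> \<open>If the part of the band to the right of \<open>y\<close> is too short, the part
    to the left is long enough.\<close>
  show "w \<le> measure arc_length (ball x \<delta> \<inter> cmv_spectrum \<alpha>)"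
  proof (cases "y + \<delta> \<le> t")
    case True
    have "(y + w) - y \<le> measure arc_length K"
      by (rule arc_length_ge_arc[OF K]) (use w d inK st True in auto)
    then show ?thesis by (simp add: K_def)
  next
    case False
    have "y - (y - w) \<le> measure arc_length K"
      by (rule arc_length_ge_arc[OF K]) (use w d inK st False in auto)
    then show ?thesis by (simp add: K_def)
  qed
qed

text \<open>Across a band the discriminant changes by 4, hence \<open>f\<close> changes by at least
  3. Taking for \<open>f\<close> the discriminant before a perturbation makes \<open>L\<close>
  independent of the perturbation.\<close>

lemma long_bands:
  assumes per: "periodic_coeffs p \<alpha>" and f: "\<And>\<theta>. \<bar>disc \<alpha> p \<theta> - f \<theta>\<bar> \<le> 1 / 2"
    and L: "\<And>x y. \<bar>x - y\<bar> < L \<Longrightarrow> \<bar>f x - f y\<bar> < (3 :: real)" and d: "\<bar>disc \<alpha> p \<theta>\<bar> < 2"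
  shows "\<exists>s t. s \<le> \<theta> \<and> \<theta> \<le> t \<and> L \<le> t - s \<and> (\<forall>y. s \<le> y \<and> y \<le> t \<longrightarrow> \<bar>disc \<alpha> p y\<bar> \<le> 2)"
proof -
  obtain s t where st: "s < \<theta>" "\<theta> < t" "\<And>y. s \<le> y \<Longrightarrow> y \<le> t \<Longrightarrow> \<bar>disc \<alpha> p y\<bar> \<le> 2"
    "\<bar>disc \<alpha> p s - disc \<alpha> p t\<bar> = 4"
    using disc_band[OF periodic_coeffsD(3,1)[OF per] d] by metis
  have "\<not> \<bar>s - t\<bar> < L" using L[of s t] f[of s] f[of t] st(4) by linarith
  then have "L \<le> t - s" using st(1,2) by linarith
  then show ?thesis using st less_imp_le by blast
qed

text \<open>Here \<open>long_bands\<close> is used with the discriminant itself as \<open>f\<close>.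
  The resulting constant 1 is the one with which the iteration starts.\<close>

lemma periodic_homogeneous:
  assumes per: "periodic_coeffs p \<alpha>"
  obtains \<delta>\<^sub>0 where "0 < \<delta>\<^sub>0" "homogeneous_upto \<delta>\<^sub>0 1 (cmv_spectrum \<alpha>)"
proof -
  note perD = periodic_coeffsD[OF per]
  obtain L where L: "0 < L" "\<And>x y. \<bar>x - y\<bar> < L \<Longrightarrow> \<bar>disc \<alpha> p x - disc \<alpha> p y\<bar> < 3"
    using periodic_uniform[OF continuous_disc[OF perD(3)] _ disc_periodic, of 3 p] by auto
  define \<delta>\<^sub>0 where "\<delta>\<^sub>0 = min (L / 2) (2 * pi)"
  have "homogeneous_upto \<delta>\<^sub>0 1 (cmv_spectrum \<alpha>)"
    unfolding homogeneous_upto_def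
  proof (intro ballI allI impI)
    fix x \<delta> assume x: "x \<in> cmv_spectrum \<alpha>" and \<delta>: "0 < \<delta> \<and> \<delta> \<le> \<delta>\<^sub>0"
    have "\<delta> \<le> measure arc_length (ball x \<delta> \<inter> cmv_spectrum \<alpha>)"
    proof (rule small_scale_homogeneous[OF per _ _ _ x])
      fix \<theta> assume "\<bar>disc \<alpha> p \<theta>\<bar> < 2"
      from long_bands[OF per, of "disc \<alpha> p" L, OF _ L(2) this]
      obtain s t where "s \<le> \<theta>" "\<theta> \<le> t" "L \<le> t - s" "\<forall>y. s \<le> y \<and> y \<le> t \<longrightarrow> \<bar>disc \<alpha> p y\<bar> \<le> 2" by auto
      then show "\<exists>s t. s \<le> \<theta> \<and> \<theta> \<le> t \<and> 2 * \<delta> \<le> t - s \<and> (\<forall>y. s \<le> y \<and> y \<le> t \<longrightarrow> \<bar>disc \<alpha> p y\<bar> \<le> 2)"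
        using \<delta> by (intro exI[of _ s] exI[of _ t]) (auto simp: \<delta>\<^sub>0_def)
    qed (use \<delta> in \<open>auto simp: \<delta>\<^sub>0_def\<close>)
    then show "1 * \<delta> \<le> measure arc_length (ball x \<delta> \<inter> cmv_spectrum \<alpha>)" by simp
  qed
  moreover have "0 < \<delta>\<^sub>0" using L(1) by (simp add: \<delta>\<^sub>0_def)
  ultimately show thesis using that by blast
qed

lemma disc_edges_finite:
  assumes per: "periodic_coeffs p \<alpha>"
  shows "finite {\<theta>\<in>{0..2 * pi}. \<bar>disc \<alpha> p \<theta>\<bar> = 2}"
proof (rule ccontr)
  note perD = periodic_coeffsD[OF per]
  let ?E = "{\<theta>. \<bar>disc \<alpha> p \<theta>\<bar> = 2}"
  have cl: "closed ?E"
    by (intro closed_Collect_eq continuous_intros continuous_disc perD)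
  assume "infinite {\<theta>\<in>{0..2 * pi}. \<bar>disc \<alpha> p \<theta>\<bar> = 2}"
  from Heine_Borel_imp_Bolzano_Weierstrass[OF compact_Icc this]
  obtain x where x: "x islimpt {\<theta>\<in>{0..2 * pi}. \<bar>disc \<alpha> p \<theta>\<bar> = 2}" by blast
  then have xE: "x islimpt ?E" by (rule islimpt_subset) auto
  then have "\<bar>disc \<alpha> p x\<bar> = 2" using cl closed_limpt by blast
  then have "\<forall>\<^sub>F y in at x. y \<notin> ?E" using disc_edge(1) perD by simp
  then show False using xE by (simp add: islimpt_iff_eventually)
qed

text \<open>The sets shrink to the finitely many edges, a null set. Spectrum can be lost only this
  close to an edge when the discriminant moves by less than \<eta>.\<close>

lemma disc_edge_measure:
  assumes per: "periodic_coeffs p \<alpha>" and e: "0 < e"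
  obtains \<eta> where "0 < \<eta>" "measure circle_lborel {\<theta>\<in>{0..<2 * pi}. 2 - \<eta> \<le> \<bar>disc \<alpha> p \<theta>\<bar> \<and> \<bar>disc \<alpha> p \<theta>\<bar> \<le> 2} < e"
proof -
  note perD = periodic_coeffsD[OF per]
  interpret finite_measure circle_lborel by (rule finite_measure_circle_lborel)
  define D where "D k = {\<theta>\<in>{0..<2 * pi}. 2 - inverse (real (Suc k)) \<le> \<bar>disc \<alpha> p \<theta>\<bar> \<and> \<bar>disc \<alpha> p \<theta>\<bar> \<le> 2}" for k
  have D: "range D \<subseteq> sets circle_lborel"
  proof
    fix A assume "A \<in> range D"
    then obtain k where A: "A = D k" by auto
    have "closed {\<theta>. 2 - inverse (real (Suc k)) \<le> \<bar>disc \<alpha> p \<theta>\<bar> \<and> \<bar>disc \<alpha> p \<theta>\<bar> \<le> 2}"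
      by (intro closed_Collect_conj closed_Collect_le continuous_intros continuous_disc perD)
    then have "{\<theta>. 2 - inverse (real (Suc k)) \<le> \<bar>disc \<alpha> p \<theta>\<bar> \<and> \<bar>disc \<alpha> p \<theta>\<bar> \<le> 2} \<in> sets borel"
      by (rule borel_closed)
    then have "{0..<2 * pi} \<inter> {\<theta>. 2 - inverse (real (Suc k)) \<le> \<bar>disc \<alpha> p \<theta>\<bar> \<and> \<bar>disc \<alpha> p \<theta>\<bar> \<le> 2} \<in> sets borel"
      by (rule sets.Int[rotated]) simp
    moreover have "A = {0..<2 * pi} \<inter> {\<theta>. 2 - inverse (real (Suc k)) \<le> \<bar>disc \<alpha> p \<theta>\<bar> \<and> \<bar>disc \<alpha> p \<theta>\<bar> \<le> 2}"
      unfolding A D_def by (rule set_eqI) (simp only: mem_Collect_eq Int_iff)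
    ultimately show "A \<in> sets circle_lborel" unfolding sets_circle_lborel by simp
  qed
  have dec: "decseq D"
  proof (rule decseq_SucI)
    fix k
    have le: "inverse (real (Suc (Suc k))) \<le> inverse (real (Suc k))" by (rule le_imp_inverse_le) auto
    show "D (Suc k) \<subseteq> D k"
    proof
      fix x assume "x \<in> D (Suc k)"
      then show "x \<in> D k" using le unfolding D_def mem_Collect_eq by linarith
    qed
  qed
  have "(\<Inter>k. D k) = {\<theta>\<in>{0..<2 * pi}. \<bar>disc \<alpha> p \<theta>\<bar> = 2}"
  proof (intro equalityI subsetI)
    fix \<theta> assume \<theta>: "\<theta> \<in> (\<Inter>k. D k)"
    have "2 - inverse (real (Suc k)) \<le> \<bar>disc \<alpha> p \<theta>\<bar>" for k using \<theta> by (auto simp: D_def)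
    moreover have "(\<lambda>k. 2 - inverse (real (Suc k))) \<longlonglongrightarrow> 2 - 0"
      by (intro tendsto_intros LIMSEQ_inverse_real_of_nat)
    ultimately have "2 - 0 \<le> \<bar>disc \<alpha> p \<theta>\<bar>" by (intro LIMSEQ_le_const2) auto
    then show "\<theta> \<in> {\<theta>\<in>{0..<2 * pi}. \<bar>disc \<alpha> p \<theta>\<bar> = 2}" using \<theta> by (auto simp: D_def)
  qed (auto simp: D_def)
  moreover have "finite {\<theta>\<in>{0..<2 * pi}. \<bar>disc \<alpha> p \<theta>\<bar> = 2}"
    by (rule finite_subset[OF _ disc_edges_finite[OF per]]) auto
  ultimately have "measure circle_lborel (\<Inter>k. D k) = 0"
    by (subst measure_circle_lborel) (auto simp: measure_def emeasure_lborel_countable countable_finite)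
  then have "(\<lambda>k. measure circle_lborel (D k)) \<longlonglongrightarrow> 0"
    using finite_Lim_measure_decseq[OF D dec] by simp
  then have "\<forall>\<^sub>F k in sequentially. measure circle_lborel (D k) < e" using e by (rule order_tendstoD)
  then obtain k where "measure circle_lborel (D k) < e" by (auto simp: eventually_sequentially)
  then show thesis using that[of "inverse (real (Suc k))"] by (simp add: D_def)
qed

section \<open>Opening gaps by a one-site perturbation\<close>

text \<open>Uniformity over the unit circle makes the perturbation estimate uniform in the
  angle.\<close>

lemma transfer_bounded:
  "\<exists>C. \<forall>\<zeta>. cmod \<zeta> = 1 \<longrightarrow> cmod (fst (transfer \<zeta> \<alpha> n k)) \<le> C \<and> cmod (snd (transfer \<zeta> \<alpha> n k)) \<le> C"
proof (induction k)
  case 0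
  show ?case by (rule exI[of _ 1]) simp
next
  case (Suc k)
  then obtain C where C: "\<And>\<zeta>. cmod \<zeta> = 1 \<Longrightarrow> cmod (fst (transfer \<zeta> \<alpha> n k)) \<le> C \<and> cmod (snd (transfer \<zeta> \<alpha> n k)) \<le> C"
    by blast
  define b c where "b = cmod (1 / szego_\<rho> (\<alpha> (n + int k)))" and "c = cmod (\<alpha> (n + int k) / szego_\<rho> (\<alpha> (n + int k)))"
  show ?case
  proof (intro exI allI impI)
    fix \<zeta> :: complex assume z: "cmod \<zeta> = 1"
    have s: "cmod (fst (szego \<zeta> (\<alpha> (n + int k)))) = b" "cmod (snd (szego \<zeta> (\<alpha> (n + int k)))) = c"
      using z by (simp_all add: szego_def b_def c_def norm_divide)
    note Cz = C[OF z]
    have bc: "0 \<le> b" "0 \<le> c" by (simp_all add: b_def c_def)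
    have "cmod (fst (szego \<zeta> (\<alpha> (n + int k))) * u + snd (szego \<zeta> (\<alpha> (n + int k))) * cnj v) \<le> b * C + c * C"
      if "cmod u \<le> C" "cmod v \<le> C" for u v
      by (rule order_trans[OF norm_triangle_ineq]) (auto simp: norm_mult s intro!: add_mono mult_left_mono bc that)
    then show "cmod (fst (transfer \<zeta> \<alpha> n (Suc k))) \<le> b * C + c * C \<and> cmod (snd (transfer \<zeta> \<alpha> n (Suc k))) \<le> b * C + c * C"
      using Cz by (simp add: su_mul_def)
  qed
qed

text \<open>The perturbed value is moved along the ray through \<open>a\<close>, so that \<open>a * cnj b\<close> is real; this is
  what makes the perturbation open every closed gap at once.\<close>

definition radial_shift :: "complex \<Rightarrow> real \<Rightarrow> complex" where
  "radial_shift a s = a + of_real s * (if a = 0 then 1 else sgn a)"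

lemma radial_shift:
  "cmod (radial_shift a s - a) = \<bar>s\<bar>" "a * cnj (radial_shift a s) \<in> \<real>"
proof -
  show "cmod (radial_shift a s - a) = \<bar>s\<bar>"
    by (simp add: radial_shift_def norm_mult norm_sgn)
  have h1: "a * cnj (sgn a) = of_real (cmod a)"
  proof (cases "a = 0")
    case False
    have "a * cnj (sgn a) = (a * cnj a) / of_real (cmod a)" by (simp add: sgn_div_norm scaleR_conv_of_real divide_inverse mult_ac)
    also have "\<dots> = of_real (cmod a)" using False by (simp add: complex_norm_square[symmetric] power2_eq_square)
    finally show ?thesis .
  qed simp
  have h2: "a * cnj a = of_real ((cmod a)\<^sup>2)" by (rule complex_norm_square[symmetric])
  have "a * cnj (a + of_real s * sgn a) = a * cnj a + of_real s * (a * cnj (sgn a))"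
    by (simp add: algebra_simps)
  also have "\<dots> \<in> \<real>" unfolding h1 h2 by simp
  finally show "a * cnj (radial_shift a s) \<in> \<real>" by (cases "a = 0") (simp_all add: radial_shift_def)
qed

definition perturb :: "(int \<Rightarrow> complex) \<Rightarrow> nat \<Rightarrow> real \<Rightarrow> int \<Rightarrow> complex" where
  "perturb \<alpha> p s n = (if n mod int p = 0 then radial_shift (\<alpha> 0) s else \<alpha> n)"

lemma perturb_diff:
  assumes "periodic_coeffs p \<alpha>" "0 \<le> s"
  shows "cmod (perturb \<alpha> p s n - \<alpha> n) \<le> s"
proof (cases "n mod int p = 0")
  case True
  then have "\<alpha> n = \<alpha> 0" using periodic_mod[OF periodic_coeffsD(2)[OF assms(1)], of n] by simp
  then show ?thesis using True assms(2) radial_shift(1)[of "\<alpha> 0" s] by (simp add: perturb_def)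
qed (use assms in \<open>simp add: perturb_def\<close>)

lemma periodic_perturb:
  assumes "periodic_coeffs p \<alpha>" "0 \<le> s" "s < 1 - cmod (\<alpha> 0)"
  shows "periodic_coeffs p (perturb \<alpha> p s)"
proof -
  have "cmod (radial_shift (\<alpha> 0) s) \<le> cmod (\<alpha> 0) + s"
    using radial_shift(1)[of "\<alpha> 0" s] norm_triangle_sub[of "radial_shift (\<alpha> 0) s" "\<alpha> 0"] assms(2) by simp
  then show ?thesis using assms by (simp add: periodic_coeffs_def perturb_def)
qed

lemma perturb_transfer:
  assumes "0 < p"
  shows "transfer \<zeta> (perturb \<alpha> p s) 0 p = su_mul (transfer \<zeta> \<alpha> 1 (p - 1)) (szego \<zeta> (radial_shift (\<alpha> 0) s))"
proof -
  obtain q where q: "p = Suc q" using assms gr0_conv_Suc by blast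
  have "transfer \<zeta> (perturb \<alpha> p s) 1 q = transfer \<zeta> \<alpha> 1 q"
  proof (rule transfer_cong)
    fix j assume "j < q"
    then have "(1 + int j) mod int p = 1 + int j" by (intro mod_pos_pos_trivial) (auto simp: q)
    then show "perturb \<alpha> p s (1 + int j) = \<alpha> (1 + int j)" by (simp add: perturb_def)
  qed
  then show ?thesis by (simp add: q transfer_first perturb_def del: transfer.simps(2))
qed

lemma transfer_split_first:
  assumes "0 < p"
  shows "transfer \<zeta> \<alpha> 0 p = su_mul (transfer \<zeta> \<alpha> 1 (p - 1)) (szego \<zeta> (\<alpha> 0))"
  using transfer_first[of \<zeta> \<alpha> 0 "p - 1"] assms by simp

text \<open>Only one factor of the monodromy changes, and the product of the others is bounded
  uniformly in \<theta>.\<close>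

lemma perturb_disc_uniform:
  assumes per: "periodic_coeffs p \<alpha>" and \<eta>: "0 < \<eta>"
  shows "\<forall>\<^sub>F s in at_right 0. \<forall>\<theta>. \<bar>disc (perturb \<alpha> p s) p \<theta> - disc \<alpha> p \<theta>\<bar> < \<eta>"
proof -
  note perD = periodic_coeffsD[OF per]
  obtain C where C: "\<And>\<zeta>. cmod \<zeta> = 1 \<Longrightarrow> cmod (fst (transfer \<zeta> \<alpha> 1 (p - 1))) \<le> C \<and> cmod (snd (transfer \<zeta> \<alpha> 1 (p - 1))) \<le> C"
    using transfer_bounded[of \<alpha> 1 "p - 1"] by blast
  define a where "a = \<alpha> 0"
  define b where "b = radial_shift a"
  have a1: "cmod a < 1" using perD(3) by (simp add: a_def)
  have b: "(b \<longlongrightarrow> a) (at_right 0)"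
  proof -
    have "((\<lambda>s. a + of_real s * (if a = 0 then 1 else sgn a)) \<longlongrightarrow> a + of_real 0 * (if a = 0 then 1 else sgn a)) (at_right 0)"
      by (intro tendsto_intros)
    then show ?thesis by (simp add: b_def radial_shift_def[abs_def])
  qed
  have r: "((\<lambda>s. szego_\<rho> (b s)) \<longlongrightarrow> szego_\<rho> a) (at_right 0)"
    unfolding szego_\<rho>_def by (intro tendsto_intros b)
  have r0: "szego_\<rho> a \<noteq> 0" by (rule szego_\<rho>(1)[OF a1])
  have "((\<lambda>s. 2 * (C * cmod (1 / szego_\<rho> (b s) - 1 / szego_\<rho> a) + C * cmod (b s / szego_\<rho> (b s) - a / szego_\<rho> a)))
      \<longlongrightarrow> 2 * (C * cmod (1 / szego_\<rho> a - 1 / szego_\<rho> a) + C * cmod (a / szego_\<rho> a - a / szego_\<rho> a))) (at_right 0)"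
    by (intro tendsto_intros r b r0)
  then have "\<forall>\<^sub>F s in at_right 0. 2 * (C * cmod (1 / szego_\<rho> (b s) - 1 / szego_\<rho> a) + C * cmod (b s / szego_\<rho> (b s) - a / szego_\<rho> a)) < \<eta>"
    by (rule order_tendstoD) (use \<eta> in simp)
  then show ?thesis
  proof eventually_elim
    case (elim s)
    show ?case
    proof
      fix \<theta>
      define \<zeta> where "\<zeta> = cis (\<theta> / 2)"
      have z: "cmod \<zeta> = 1" by (simp add: \<zeta>_def)
      obtain A B where S: "transfer \<zeta> \<alpha> 1 (p - 1) = (A, B)" by (metis surj_pair)
      have AB: "cmod A \<le> C" "cmod B \<le> C" using C[OF z] unfolding S by simp_all
      have "disc (perturb \<alpha> p s) p \<theta> - disc \<alpha> p \<theta> =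
          2 * Re (A * (cnj \<zeta> * (1 / szego_\<rho> (b s) - 1 / szego_\<rho> a)) - B * cnj (b s / szego_\<rho> (b s) - a / szego_\<rho> a))"
        unfolding disc_def discriminant_def \<zeta>_def[symmetric] perturb_transfer[OF perD(1)] transfer_split_first[OF perD(1), of \<zeta> \<alpha>] S
          szego_def su_mul_def b_def[symmetric] a_def[symmetric]
        by (simp add: algebra_simps)
      also have "\<bar>\<dots>\<bar> \<le> 2 * cmod (A * (cnj \<zeta> * (1 / szego_\<rho> (b s) - 1 / szego_\<rho> a)) - B * cnj (b s / szego_\<rho> (b s) - a / szego_\<rho> a))"
        unfolding abs_mult by (intro mult_mono abs_Re_le_cmod) simp_all
      also have "\<dots> \<le> 2 * (C * cmod (1 / szego_\<rho> (b s) - 1 / szego_\<rho> a) + C * cmod (b s / szego_\<rho> (b s) - a / szego_\<rho> a))"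
      proof (intro mult_left_mono order_trans[OF norm_triangle_ineq4] add_mono)
        show "cmod (A * (cnj \<zeta> * (1 / szego_\<rho> (b s) - 1 / szego_\<rho> a))) \<le> C * cmod (1 / szego_\<rho> (b s) - 1 / szego_\<rho> a)"
          unfolding norm_mult complex_mod_cnj z using AB by (simp add: mult_right_mono)
        show "cmod (B * cnj (b s / szego_\<rho> (b s) - a / szego_\<rho> a)) \<le> C * cmod (b s / szego_\<rho> (b s) - a / szego_\<rho> a)"
          unfolding norm_mult complex_mod_cnj using AB by (simp add: mult_right_mono)
      qed simp
      finally show "\<bar>disc (perturb \<alpha> p s) p \<theta> - disc \<alpha> p \<theta>\<bar> < \<eta>" using elim by linarith
    qed
  qed
qed

text \<open>The new monodromy is \<sigma> times the inverse Szego matrix of \<open>a\<close> times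
  the Szego matrix of \<open>b\<close>, so its trace is governed by the real part of 1 - a cnj b.
  The identity |1 - a cnj b|^2 = (1 - |a|^2) (1 - |b|^2) + |a - b|^2 gives the strict inequality,
  since reality of \<open>a * cnj b\<close> makes the trace see the full modulus.\<close>

lemma perturb_opens_gap:
  assumes per: "periodic_coeffs p \<alpha>" and s: "0 < s" "s < 1 - cmod (\<alpha> 0)"
    and closed_gap: "transfer (cis (\<theta> / 2)) \<alpha> 0 p = (of_real \<sigma>, 0)" "\<bar>\<sigma>\<bar> = 1"
  shows "2 < \<bar>disc (perturb \<alpha> p s) p \<theta>\<bar>"
proof -
  note perD = periodic_coeffsD[OF per]
  define \<zeta> where "\<zeta> = cis (\<theta> / 2)"
  define a b where "a = \<alpha> 0" and "b = radial_shift (\<alpha> 0) s"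
  define r r' where "r = sqrt (1 - (cmod a)\<^sup>2)" and "r' = sqrt (1 - (cmod b)\<^sup>2)"
  have zz: "\<zeta> * cnj \<zeta> = 1" by (simp add: \<zeta>_def cis_cnj cis_mult)
  have a1: "cmod a < 1" using perD(3) by (simp add: a_def)
  have "cmod b \<le> cmod a + s"
    using radial_shift(1)[of "\<alpha> 0" s] norm_triangle_sub[of "radial_shift (\<alpha> 0) s" "\<alpha> 0"] s by (simp add: a_def b_def)
  then have b1: "cmod b < 1" using s by (simp add: a_def)
  have sq: "(cmod a)\<^sup>2 < 1" "(cmod b)\<^sup>2 < 1" using a1 b1 by (simp_all add: power_less_one_iff)
  have r: "0 < r" "0 < r'" "r\<^sup>2 = 1 - (cmod a)\<^sup>2" "r'\<^sup>2 = 1 - (cmod b)\<^sup>2" using sq by (simp_all add: r_def r'_def)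
  have sr: "szego_\<rho> a = of_real r" "szego_\<rho> b = of_real r'" by (simp_all add: szego_\<rho>_def r_def r'_def)
  define S where "S = transfer \<zeta> \<alpha> 1 (p - 1)"
  have "su_mul S (szego \<zeta> a) = (of_real \<sigma>, 0)"
    using closed_gap transfer_split_first[OF perD(1), of \<zeta> \<alpha>] by (simp add: S_def \<zeta>_def a_def)
  moreover have "su_mul (szego \<zeta> a) (\<zeta> / szego_\<rho> a, a / szego_\<rho> a) = (1, 0)"
  proof -
    have "cnj \<zeta> / of_real r * (\<zeta> / of_real r) + - a / of_real r * cnj (a / of_real r) = (\<zeta> * cnj \<zeta> - a * cnj a) / of_real (r\<^sup>2)"
      by (simp add: power2_eq_square diff_divide_distrib)
    also have "\<zeta> * cnj \<zeta> - a * cnj a = of_real (r\<^sup>2)"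
      unfolding zz r(3) of_real_diff complex_norm_square by simp
    finally have "cnj \<zeta> / of_real r * (\<zeta> / of_real r) + - a / of_real r * cnj (a / of_real r) = 1" using r(1) by simp
    then show ?thesis by (simp add: su_mul_def szego_def sr)
  qed
  \<comment> \<open>Solve for the remaining factors, because the perturbation exchanges just the
    factor of site 0.\<close>
  ultimately have S: "S = su_mul (of_real \<sigma>, 0) (\<zeta> / szego_\<rho> a, a / szego_\<rho> a)"
    by (metis su_mul_assoc su_mul_one(2))
  obtain x where x: "a * cnj b = of_real x" using radial_shift(2)[of "\<alpha> 0" s] unfolding a_def b_def by (auto elim: Reals_cases)
  have "fst (transfer \<zeta> (perturb \<alpha> p s) 0 p) = of_real \<sigma> * (\<zeta> * cnj \<zeta> - a * cnj b) / (of_real r * of_real r')"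
    unfolding perturb_transfer[OF perD(1)] S_def[symmetric] S b_def[symmetric] szego_def su_mul_def sr
    by (simp add: algebra_simps diff_divide_distrib)
  also have "\<dots> = of_real (\<sigma> * (1 - x) / (r * r'))" unfolding zz x by simp
  finally have fst_eq: "disc (perturb \<alpha> p s) p \<theta> = 2 * (\<sigma> * (1 - x) / (r * r'))"
    by (simp add: disc_def discriminant_def \<zeta>_def[symmetric] del: of_real_mult of_real_divide)
  have "complex_of_real (x\<^sup>2) = of_real ((cmod a)\<^sup>2 * (cmod b)\<^sup>2)"
  proof -
    have "complex_of_real (x\<^sup>2) = of_real x * cnj (of_real x)" by (simp add: power2_eq_square)
    also have "\<dots> = (a * cnj a) * (b * cnj b)" unfolding x[symmetric] by simp
    finally show ?thesis unfolding of_real_mult complex_norm_square .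
  qed
  then have x2: "x\<^sup>2 = (cmod a)\<^sup>2 * (cmod b)\<^sup>2" using of_real_eq_iff by blast
  have "complex_of_real (s\<^sup>2) = of_real ((cmod a)\<^sup>2 + (cmod b)\<^sup>2 - 2 * x)"
  proof -
    have "s\<^sup>2 = (cmod (b - a))\<^sup>2" using radial_shift(1)[of "\<alpha> 0" s] by (simp add: a_def b_def)
    then have "complex_of_real (s\<^sup>2) = (b - a) * cnj (b - a)" by (simp only: complex_norm_square)
    also have "\<dots> = a * cnj a + b * cnj b - (a * cnj b + cnj (a * cnj b))" by (simp add: algebra_simps)
    also have "\<dots> = of_real ((cmod a)\<^sup>2 + (cmod b)\<^sup>2 - 2 * x)"
      unfolding x of_real_diff of_real_add complex_norm_square by simp
    finally show ?thesis .
  qed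
  then have "s\<^sup>2 = (cmod a)\<^sup>2 + (cmod b)\<^sup>2 - 2 * x" using of_real_eq_iff by blast
  then have "(1 - x)\<^sup>2 = (r * r')\<^sup>2 + s\<^sup>2"
    unfolding power_mult_distrib r(3,4) by (simp add: power2_diff x2 algebra_simps)
  then have "(r * r')\<^sup>2 < \<bar>1 - x\<bar>\<^sup>2" using s(1) by simp
  then have "r * r' < \<bar>1 - x\<bar>" by (rule power_less_imp_less_base) simp
  then have "1 < \<bar>1 - x\<bar> / (r * r')" using r(1,2) by simp
  moreover have "\<bar>disc (perturb \<alpha> p s) p \<theta>\<bar> = 2 * (\<bar>1 - x\<bar> / (r * r'))"
    using closed_gap(2) r(1,2) by (simp add: fst_eq abs_mult)
  ultimately show ?thesis by linarith
qed

section \<open>Closed gaps for multiples of the period\<close>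

lemma transfer_power:
  assumes per: "\<forall>n. \<alpha> (n + int p) = \<alpha> n"
  shows "transfer \<zeta> \<alpha> 0 (Suc m * p) = su_mul (transfer \<zeta> \<alpha> 0 p) (transfer \<zeta> \<alpha> 0 (m * p))"
proof -
  have "transfer \<zeta> \<alpha> (0 + int (m * p)) p = transfer \<zeta> \<alpha> 0 p"
  proof (rule transfer_cong)
    fix j
    have "\<alpha> (int (m * p) + int j) = \<alpha> ((int (m * p) + int j) mod int p)"
      by (rule periodic_mod[OF per, symmetric])
    also have "(int (m * p) + int j) mod int p = int j mod int p" by simp
    also have "\<alpha> \<dots> = \<alpha> (int j)" by (rule periodic_mod[OF per])
    finally show "\<alpha> (0 + int (m * p) + int j) = \<alpha> (0 + int j)" unfolding add_0_left .
  qed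
  then show ?thesis using transfer_add[of \<zeta> \<alpha> 0 "m * p" p] by (simp add: add.commute)
qed

lemma su_mul_cayley_hamilton:
  assumes "X \<in> SU11"
  shows "su_mul X X = (2 * Re (fst X)) *\<^sub>R X - (1, 0)"
proof -
  obtain a b where X: "X = (a, b)" by (metis surj_pair)
  have d: "b * cnj b = a * cnj a - 1" using assms by (simp add: SU11_def X algebra_simps)
  define \<tau> where "\<tau> = 2 * Re (fst X)"
  have t: "complex_of_real \<tau> = a + cnj a" by (simp add: X \<tau>_def complex_add_cnj)
  show ?thesis unfolding \<tau>_def[symmetric]
    by (simp add: X su_mul_def scaleR_conv_of_real t d algebra_simps)
qed

text \<open>With trace 2 cos \<phi> and \<phi> = pi j / m, the one-period monodromy has the
  eigenvalues exp (i \<phi>) and exp (- i \<phi>), distinct since 0 < j < m; its power m is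
  therefore (-1)^j times the identity.\<close>

lemma transfer_closed_gap:
  assumes per: "periodic_coeffs p \<alpha>" and j: "0 < j" "j < m"
    and d: "disc \<alpha> p \<theta> = 2 * cos (pi * real j / real m)"
  obtains \<sigma> where "transfer (cis (\<theta> / 2)) \<alpha> 0 (m * p) = (of_real \<sigma>, 0)" "\<bar>\<sigma>\<bar> = 1"
proof -
  note perD = periodic_coeffsD[OF per]
  define \<phi> where "\<phi> = pi * real j / real m"
  define T where "T = transfer (cis (\<theta> / 2)) \<alpha> 0 p"
  have T: "T \<in> SU11" unfolding T_def by (rule transfer_SU11) (use perD in auto)
  have ch: "su_mul T T = (2 * cos \<phi>) *\<^sub>R T - (1, 0)"
    using su_mul_cayley_hamilton[OF T] d by (simp add: T_def disc_def discriminant_def \<phi>_def)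
  have sp: "0 < sin \<phi>" using j by (intro sin_gt_zero) (auto simp: \<phi>_def field_simps)
  \<comment> \<open>The Chebyshev formula for powers, multiplied through by
    \<open>sin \<phi>\<close>. Writing the angle as \<open>real k * \<phi> - \<phi>\<close> lets the
    formula start at \<open>k = 0\<close>.\<close>
  have pow: "sin \<phi> *\<^sub>R transfer (cis (\<theta> / 2)) \<alpha> 0 (k * p) = sin (real k * \<phi>) *\<^sub>R T - sin (real k * \<phi> - \<phi>) *\<^sub>R (1, 0)" for k
  proof (induction k)
    case (Suc k)
    have "sin \<phi> *\<^sub>R transfer (cis (\<theta> / 2)) \<alpha> 0 (Suc k * p) = su_mul T (sin \<phi> *\<^sub>R transfer (cis (\<theta> / 2)) \<alpha> 0 (k * p))"
      unfolding transfer_power[OF perD(2)] T_def bounded_bilinear.scaleR_right[OF bounded_bilinear_su_mul] ..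
    also have "\<dots> = sin (real k * \<phi>) *\<^sub>R su_mul T T - sin (real k * \<phi> - \<phi>) *\<^sub>R T"
      unfolding Suc bounded_bilinear.diff_right[OF bounded_bilinear_su_mul]
        bounded_bilinear.scaleR_right[OF bounded_bilinear_su_mul] by simp
    also have "\<dots> = (2 * cos \<phi> * sin (real k * \<phi>) - sin (real k * \<phi> - \<phi>)) *\<^sub>R T - sin (real k * \<phi>) *\<^sub>R (1, 0)"
      unfolding ch by (simp add: algebra_simps)
    also have "2 * cos \<phi> * sin (real k * \<phi>) - sin (real k * \<phi> - \<phi>) = sin (real (Suc k) * \<phi>)"
      by (simp add: sin_diff sin_add algebra_simps)
    also have "real k * \<phi> = real (Suc k) * \<phi> - \<phi>" by (simp add: algebra_simps)
    finally show ?case .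
  qed (simp add: zero_prod_def)
  have mphi: "real m * \<phi> = real j * pi" using j by (simp add: \<phi>_def)
  have "sin \<phi> *\<^sub>R transfer (cis (\<theta> / 2)) \<alpha> 0 (m * p) = (cos (real j * pi) * sin \<phi>) *\<^sub>R (1, 0)"
    unfolding pow mphi by (simp add: sin_diff zero_prod_def[symmetric])
  also have "\<dots> = sin \<phi> *\<^sub>R (of_real (cos (real j * pi)), 0)"
    by (simp add: scaleR_conv_of_real mult.commute)
  finally have "transfer (cis (\<theta> / 2)) \<alpha> 0 (m * p) = (of_real (cos (real j * pi)), 0)"
    by (rule scaleR_left_imp_eq[rotated]) (use sp in simp)
  moreover have "\<bar>cos (real j * pi)\<bar> = 1" by (simp only: cos_npi power_abs) simp
  ultimately show thesis by (rule that)
qed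

lemma cos_grid_dense:
  fixes lo hi :: real
  assumes "-2 \<le> lo" "lo < hi" "hi \<le> 2"
  obtains m0 where "\<And>m. m0 \<le> m \<Longrightarrow> \<exists>j. 0 < j \<and> j < m \<and> lo < 2 * cos (pi * real j / real m) \<and> 2 * cos (pi * real j / real m) < hi"
proof -
  define u v where "u = arccos (hi / 2)" and "v = arccos (lo / 2)"
  have uv: "0 \<le> u" "v \<le> pi" "u < v"
    using assms unfolding u_def v_def by (auto intro: arccos_lbound arccos_ubound arccos_less_arccos)
  obtain m0 :: nat where m0: "2 * pi / (v - u) < real m0" using reals_Archimedean2 by blast
  have "\<exists>j. 0 < j \<and> j < m \<and> lo < 2 * cos (pi * real j / real m) \<and> 2 * cos (pi * real j / real m) < hi" if m: "m0 \<le> m" for m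
  proof -
    have mpos: "0 < real m" using m0 m uv by (smt (verit) divide_pos_pos pi_gt_zero of_nat_le_iff)
    have step: "2 * pi / real m < v - u"
    proof -
      have "2 * pi / (v - u) < real m" using m0 m by (smt (verit) of_nat_le_iff)
      then show ?thesis using mpos uv by (simp add: field_simps)
    qed
    \<comment> \<open>The first grid point to the right of \<open>u\<close>; the mesh
      \<open>pi / real m\<close> is below \<open>v - u\<close>, so it also lies to the left of
      \<open>v\<close>.\<close>
    define j where "j = nat (\<lfloor>u * real m / pi\<rfloor> + 1)"
    have fl: "0 \<le> \<lfloor>u * real m / pi\<rfloor>" using uv by simp
    have jr: "real j = of_int \<lfloor>u * real m / pi\<rfloor> + 1" using fl by (simp add: j_def)
    have "u * real m / pi < real j" "real j \<le> u * real m / pi + 1" unfolding jr by linarith+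
    then have "u < pi * real j / real m" "pi * real j / real m \<le> u + pi / real m"
      using mpos by (simp_all add: field_simps)
    moreover have "pi / real m < v - u"
    proof -
      have "0 < pi / real m" using mpos by simp
      then show ?thesis using step by simp
    qed
    ultimately have x: "u < pi * real j / real m" "pi * real j / real m < v" by linarith+
    have "0 < j" using fl by (simp add: j_def)
    have "pi * real j / real m < pi" using x uv by linarith
    then have "j < m" using mpos by (simp add: field_simps)
    have "cos (pi * real j / real m) < cos u" using x uv by (intro cos_monotone_0_pi) auto
    moreover have "cos v < cos (pi * real j / real m)" using x uv by (intro cos_monotone_0_pi) auto
    moreover have "cos u = hi / 2" "cos v = lo / 2" using assms by (simp_all add: u_def v_def)
    ultimately show ?thesis using \<open>0 < j\<close> \<open>j < m\<close> by auto
  qed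
  then show thesis using that by blast
qed

section \<open>Porous perturbations of periodic spectra\<close>

lemma periodic_coeffs_mult:
  assumes "periodic_coeffs p \<alpha>" "0 < m"
  shows "periodic_coeffs (m * p) \<alpha>"
proof -
  note perD = periodic_coeffsD[OF assms(1)]
  have "\<alpha> (n + int (m * p)) = \<alpha> n" for n
  proof -
    have "\<alpha> (n + int (m * p)) = \<alpha> ((n + int (m * p)) mod int p)" by (rule periodic_mod[OF perD(2), symmetric])
    also have "(n + int (m * p)) mod int p = n mod int p" by simp
    also have "\<alpha> (n mod int p) = \<alpha> n" by (rule periodic_mod[OF perD(2)])
    finally show ?thesis .
  qed
  then show ?thesis using perD assms(2) by (simp add: periodic_coeffs_def)
qed

definition closed_gap_point :: "(int \<Rightarrow> complex) \<Rightarrow> nat \<Rightarrow> real \<Rightarrow> bool" where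
  "closed_gap_point \<alpha> q y \<longleftrightarrow> (\<exists>\<sigma>. transfer (cis (y / 2)) \<alpha> 0 q = (of_real \<sigma>, 0) \<and> \<bar>\<sigma>\<bar> = 1)"

text \<open>Near \<theta> there is either a gap already or an arc on which |\<Delta>| \<le> 2. On
  such an arc \<Delta> is not constant, so it takes a value 2 cos (pi j / m) once m is large. All
  large \<open>m\<close> are covered because the group decides which multiples of the period
  occur.\<close>

lemma gap_points_dense:
  assumes per: "periodic_coeffs p \<alpha>" and e: "0 < e"
  obtains m0 where "\<And>m. m0 \<le> m \<Longrightarrow> 0 < m \<and> (\<exists>y. \<bar>y - \<theta>\<bar> < e \<and> (2 < \<bar>disc \<alpha> (m * p) y\<bar> \<or> closed_gap_point \<alpha> (m * p) y))"
proof (cases "\<exists>y. \<bar>y - \<theta>\<bar> < e \<and> 2 < \<bar>disc \<alpha> p y\<bar>")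
  case True
  then obtain y where y: "\<bar>y - \<theta>\<bar> < e" "2 < \<bar>disc \<alpha> p y\<bar>" by blast
  show thesis
  proof (rule that[of 1])
    fix m :: nat assume "1 \<le> m"
    then have m: "0 < m" by simp
    \<comment> \<open>The discriminants for both periods describe the same spectrum.\<close>
    have "2 < \<bar>disc \<alpha> (m * p) y\<bar>"
      using cis_in_cmv_spectrum[OF per, of y] cis_in_cmv_spectrum[OF periodic_coeffs_mult[OF per m], of y] y(2) by simp
    then show "0 < m \<and> (\<exists>y. \<bar>y - \<theta>\<bar> < e \<and> (2 < \<bar>disc \<alpha> (m * p) y\<bar> \<or> closed_gap_point \<alpha> (m * p) y))" using m y(1) by blast
  qed
next
  case False
  note perD = periodic_coeffsD[OF per]
  have le: "\<bar>disc \<alpha> p y\<bar> \<le> 2" if "\<bar>y - \<theta>\<bar> < e" for y using False that by (meson not_le)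
  obtain u where u: "\<bar>u - \<theta>\<bar> < e" "\<bar>disc \<alpha> p u\<bar> < 2"
  proof (cases "\<bar>disc \<alpha> p \<theta>\<bar> < 2")
    case True
    then show thesis using that[of \<theta>] e by simp
  next
    case False
    then have "\<bar>disc \<alpha> p \<theta>\<bar> = 2" using le[of \<theta>] e by simp
    then have "\<exists>\<^sub>F y in at \<theta>. \<bar>disc \<alpha> p y\<bar> < 2" using disc_edge(2) perD by blast
    moreover have "\<forall>\<^sub>F y in at \<theta>. \<bar>disc \<alpha> p y\<bar> < 2 \<longrightarrow> \<bar>y - \<theta>\<bar> < e \<and> \<bar>disc \<alpha> p y\<bar> < 2"
      using e by (auto simp: eventually_at dist_real_def intro!: exI[of _ e])
    ultimately have "\<exists>\<^sub>F y in at \<theta>. \<bar>y - \<theta>\<bar> < e \<and> \<bar>disc \<alpha> p y\<bar> < 2" by (rule frequently_rev_mp)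
    then show thesis using that frequently_ex by blast
  qed
  have "\<exists>v. \<bar>v - \<theta>\<bar> < e \<and> disc \<alpha> p v \<noteq> disc \<alpha> p u"
  proof (rule ccontr)
    assume "\<nexists>v. \<bar>v - \<theta>\<bar> < e \<and> disc \<alpha> p v \<noteq> disc \<alpha> p u"
    then have const: "disc \<alpha> p v = disc \<alpha> p u" if "\<bar>v - \<theta>\<bar> < e" for v using that by blast
    define v where "v = (u + (\<theta> + e)) / 2"
    have v: "u < v" "\<bar>v - \<theta>\<bar> < e" using u(1) by (auto simp: v_def abs_if field_simps split: if_splits)
    obtain z where z: "u < z" "z < v" "2 \<le> \<bar>disc \<alpha> p z\<bar>"
      using disc_rolle[OF perD(3,1) v(1)] const[OF v(2)] by metis
    then have "\<bar>z - \<theta>\<bar> < e" using u(1) v by linarith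
    then show False using const z(3) u(2) by simp
  qed
  then obtain v where v: "\<bar>v - \<theta>\<bar> < e" "disc \<alpha> p v \<noteq> disc \<alpha> p u" by blast
  define lo hi where "lo = min (disc \<alpha> p u) (disc \<alpha> p v)" and "hi = max (disc \<alpha> p u) (disc \<alpha> p v)"
  have lh: "-2 \<le> lo" "lo < hi" "hi \<le> 2" using v(2) le[OF u(1)] le[OF v(1)] by (auto simp: lo_def hi_def)
  define I where "I = {min u v..max u v}"
  have "connected (disc \<alpha> p ` I)" unfolding I_def by (intro connected_continuous_image continuous_disc perD connected_Icc)
  moreover have "lo \<in> disc \<alpha> p ` I" "hi \<in> disc \<alpha> p ` I" by (auto simp: lo_def hi_def I_def min_def max_def)
  ultimately have sub: "{lo..hi} \<subseteq> disc \<alpha> p ` I" by (rule connected_contains_Icc)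
  obtain m0 where m0: "\<And>m. m0 \<le> m \<Longrightarrow> \<exists>j. 0 < j \<and> j < m \<and> lo < 2 * cos (pi * real j / real m) \<and> 2 * cos (pi * real j / real m) < hi"
    using cos_grid_dense[OF lh] by blast
  show thesis
  proof (rule that[of m0])
    fix m assume "m0 \<le> m"
    then obtain j where j: "0 < j" "j < m" "lo < 2 * cos (pi * real j / real m)" "2 * cos (pi * real j / real m) < hi"
      using m0 by blast
    then have "2 * cos (pi * real j / real m) \<in> {lo..hi}" by simp
    then obtain y where y: "y \<in> I" "disc \<alpha> p y = 2 * cos (pi * real j / real m)" using sub by (metis imageE subsetD)
    have "\<bar>y - \<theta>\<bar> < e" using y(1) u(1) v(1) by (auto simp: I_def min_def max_def split: if_splits)
    moreover have "closed_gap_point \<alpha> (m * p) y"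
      using transfer_closed_gap[OF per j(1,2) y(2)] unfolding closed_gap_point_def by metis
    ultimately show "0 < m \<and> (\<exists>y. \<bar>y - \<theta>\<bar> < e \<and> (2 < \<bar>disc \<alpha> (m * p) y\<bar> \<or> closed_gap_point \<alpha> (m * p) y))" using j by auto
  qed
qed

text \<open>An open gap persists by uniform closeness of the discriminants; a closed one opens by
  \<open>perturb_opens_gap\<close>.\<close>

lemma eventually_gap_open:
  assumes per: "periodic_coeffs q \<alpha>" and y: "2 < \<bar>disc \<alpha> q y\<bar> \<or> closed_gap_point \<alpha> q y"
  shows "\<forall>\<^sub>F s in at_right 0. 2 < \<bar>disc (perturb \<alpha> q s) q y\<bar>"
  using y
proof
  assume gt: "2 < \<bar>disc \<alpha> q y\<bar>"
  have "\<forall>\<^sub>F s in at_right 0. \<forall>\<theta>. \<bar>disc (perturb \<alpha> q s) q \<theta> - disc \<alpha> q \<theta>\<bar> < \<bar>disc \<alpha> q y\<bar> - 2"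
    by (rule perturb_disc_uniform[OF per]) (use gt in simp)
  then show ?thesis
  proof eventually_elim
    case (elim s)
    then have "\<bar>disc (perturb \<alpha> q s) q y - disc \<alpha> q y\<bar> < \<bar>disc \<alpha> q y\<bar> - 2" by blast
    then show ?case by linarith
  qed
next
  assume "closed_gap_point \<alpha> q y"
  then obtain \<sigma> where \<sigma>: "transfer (cis (y / 2)) \<alpha> 0 q = (of_real \<sigma>, 0)" "\<bar>\<sigma>\<bar> = 1" unfolding closed_gap_point_def by blast
  have "\<forall>\<^sub>F s in at_right 0. 0 < s \<and> s < 1 - cmod (\<alpha> 0)"
    using periodic_coeffsD(3)[OF per] unfolding eventually_at_right_field
    by (intro exI[of _ "1 - cmod (\<alpha> 0)"]) simp
  then show ?thesis
    by eventually_elim (use perturb_opens_gap[OF per _ _ \<sigma>] in blast)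
qed

lemma eventually_periodic_perturb:
  assumes per: "periodic_coeffs q \<alpha>"
  shows "\<forall>\<^sub>F s in at_right 0. periodic_coeffs q (perturb \<alpha> q s)"
proof -
  have "\<forall>\<^sub>F s in at_right 0. 0 < s \<and> s < 1 - cmod (\<alpha> 0)"
    using periodic_coeffsD(3)[OF per] unfolding eventually_at_right_field
    by (intro exI[of _ "1 - cmod (\<alpha> 0)"]) simp
  then show ?thesis by eventually_elim (use periodic_perturb[OF per] in simp)
qed

text \<open>A quantitative form of containing no arc, suited to stability under small changes of the
  set.\<close>

definition porous :: "real \<Rightarrow> complex set \<Rightarrow> bool" where
  "porous e K \<longleftrightarrow> (\<forall>x\<in>sphere 0 1. \<exists>y\<in>sphere 0 1. dist x y < e \<and> y \<notin> K)"

lemma circle_net: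
  assumes "0 < e"
  obtains \<Theta> :: "real set" where "finite \<Theta>" "\<And>x. x \<in> sphere 0 1 \<Longrightarrow> \<exists>\<theta>\<in>\<Theta>. dist x (cis \<theta>) < e"
proof -
  have cov: "sphere (0::complex) 1 \<subseteq> (\<Union>\<theta>\<in>UNIV. ball (cis \<theta>) e)"
  proof
    fix x :: complex assume "x \<in> sphere 0 1"
    then obtain \<theta> where "x = cis \<theta>" by (rule circle_cis)
    then show "x \<in> (\<Union>\<theta>\<in>UNIV. ball (cis \<theta>) e)" using assms by (intro UN_I[of \<theta>]) simp_all
  qed
  obtain \<Theta> where \<Theta>: "finite \<Theta>" "sphere (0::complex) 1 \<subseteq> (\<Union>\<theta>\<in>\<Theta>. ball (cis \<theta>) e)"
    by (rule compactE_image[OF compact_sphere _ cov]) auto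
  show thesis
  proof (rule that[OF \<Theta>(1)])
    fix x :: complex assume "x \<in> sphere 0 1"
    then obtain \<theta> where "\<theta> \<in> \<Theta>" "x \<in> ball (cis \<theta>) e" using \<Theta>(2) by blast
    then show "\<exists>\<theta>\<in>\<Theta>. dist x (cis \<theta>) < e" by (auto simp: dist_commute)
  qed
qed

text \<open>A finite net of the circle reduces the claim to finitely many gaps, so one
  \<open>m0\<close> and, for each \<open>m\<close>, one range of \<open>s\<close> suffice.\<close>

lemma eventually_porous:
  assumes per: "periodic_coeffs p \<alpha>" and e: "0 < e"
  obtains m0 where "\<And>m. m0 \<le> m \<Longrightarrow> 0 < m \<and> (\<forall>\<^sub>F s in at_right 0. porous e (cmv_spectrum (perturb \<alpha> (m * p) s)))"
proof -
  obtain \<Theta> :: "real set" where \<Theta>: "finite \<Theta>" "\<And>x. x \<in> sphere 0 1 \<Longrightarrow> \<exists>\<theta>\<in>\<Theta>. dist x (cis \<theta>) < e / 2"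
    using circle_net[of "e / 2"] e by auto
  have "\<exists>m0. \<forall>m. m0 \<le> m \<longrightarrow> 0 < m \<and> (\<exists>y. \<bar>y - \<theta>\<bar> < e / 2 \<and> (2 < \<bar>disc \<alpha> (m * p) y\<bar> \<or> closed_gap_point \<alpha> (m * p) y))" for \<theta>
  proof -
    obtain m0 where "\<And>m. m0 \<le> m \<Longrightarrow> 0 < m \<and> (\<exists>y. \<bar>y - \<theta>\<bar> < e / 2 \<and> (2 < \<bar>disc \<alpha> (m * p) y\<bar> \<or> closed_gap_point \<alpha> (m * p) y))"
      using gap_points_dense[OF per, of "e / 2" \<theta>] e by auto
    then show ?thesis by blast
  qed
  then obtain m0 where m0: "\<And>\<theta> m. m0 \<theta> \<le> m \<Longrightarrow> 0 < m \<and> (\<exists>y. \<bar>y - \<theta>\<bar> < e / 2 \<and> (2 < \<bar>disc \<alpha> (m * p) y\<bar> \<or> closed_gap_point \<alpha> (m * p) y))"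
    by metis
  define M where "M = Max (insert 1 (m0 ` \<Theta>))"
  have M: "1 \<le> M" "\<And>\<theta>. \<theta> \<in> \<Theta> \<Longrightarrow> m0 \<theta> \<le> M" using \<Theta>(1) by (auto simp: M_def)
  show thesis
  proof (rule that[of M])
    fix m assume m: "M \<le> m"
    have mpos: "0 < m" using M m by simp
    note perm = periodic_coeffs_mult[OF per mpos]
    have "\<forall>\<theta>\<in>\<Theta>. \<exists>y. \<bar>y - \<theta>\<bar> < e / 2 \<and> (2 < \<bar>disc \<alpha> (m * p) y\<bar> \<or> closed_gap_point \<alpha> (m * p) y)"
      using m0 M(2) m order_trans by blast
    then obtain y where y: "\<And>\<theta>. \<theta> \<in> \<Theta> \<Longrightarrow> \<bar>y \<theta> - \<theta>\<bar> < e / 2 \<and> (2 < \<bar>disc \<alpha> (m * p) (y \<theta>)\<bar> \<or> closed_gap_point \<alpha> (m * p) (y \<theta>))"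
      by metis
    have "\<forall>\<^sub>F s in at_right 0. \<forall>\<theta>\<in>\<Theta>. 2 < \<bar>disc (perturb \<alpha> (m * p) s) (m * p) (y \<theta>)\<bar>"
      by (rule eventually_ball_finite[OF \<Theta>(1)]) (use eventually_gap_open[OF perm] y in blast)
    with eventually_periodic_perturb[OF perm]
    have "\<forall>\<^sub>F s in at_right 0. porous e (cmv_spectrum (perturb \<alpha> (m * p) s))"
    proof eventually_elim
      case (elim s)
      show ?case unfolding porous_def
      proof
        fix x :: complex assume "x \<in> sphere 0 1"
        then obtain \<theta> where \<theta>: "\<theta> \<in> \<Theta>" "dist x (cis \<theta>) < e / 2" using \<Theta>(2) by blast
        have "dist (cis \<theta>) (cis (y \<theta>)) < e / 2"
          using cis_lipschitz[of \<theta> "y \<theta>"] y[OF \<theta>(1)] by (simp add: dist_norm abs_minus_commute)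
        then have "dist x (cis (y \<theta>)) < e" using \<theta>(2) dist_triangle[of x "cis (y \<theta>)" "cis \<theta>"] by simp
        moreover have "cis (y \<theta>) \<notin> cmv_spectrum (perturb \<alpha> (m * p) s)"
          using elim \<theta>(1) cis_in_cmv_spectrum[OF elim(1), of "y \<theta>"] by fastforce
        ultimately show "\<exists>y\<in>sphere 0 1. dist x y < e \<and> y \<notin> cmv_spectrum (perturb \<alpha> (m * p) s)"
          by (intro bexI[of _ "cis (y \<theta>)"]) simp_all
      qed
    qed
    then show "0 < m \<and> (\<forall>\<^sub>F s in at_right 0. porous e (cmv_spectrum (perturb \<alpha> (m * p) s)))" using mpos by blast
  qed
qed

section \<open>Stability of homogeneity under the perturbation\<close>

lemma eventually_small_perturb:
  fixes d :: real
  assumes "0 < d"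
  shows "\<forall>\<^sub>F s in at_right 0. 0 < s \<and> s \<le> d"
  unfolding eventually_at_right_field using assms by (intro exI[of _ d]) simp

text \<open>A lost point has |\<Delta>| \<le> 2 before and > 2 after the change, so its discriminant
  was within \<eta> of an edge value.\<close>

lemma measure_lost_spectrum:
  assumes per: "periodic_coeffs q \<alpha>" and per': "periodic_coeffs q \<beta>"
    and \<eta>: "\<And>\<theta>. \<bar>disc \<beta> q \<theta> - disc \<alpha> q \<theta>\<bar> < \<eta>"
  shows "measure arc_length (cmv_spectrum \<alpha> - cmv_spectrum \<beta>) \<le>
    measure circle_lborel {\<theta>\<in>{0..<2 * pi}. 2 - \<eta> \<le> \<bar>disc \<alpha> q \<theta>\<bar> \<and> \<bar>disc \<alpha> q \<theta>\<bar> \<le> 2}"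
proof -
  interpret finite_measure circle_lborel by (rule finite_measure_circle_lborel)
  have b: "cmv_spectrum \<alpha> - cmv_spectrum \<beta> \<in> sets borel"
    by (intro sets.Diff borel_cmv_spectrum periodic_coeffsD(4)[OF per] periodic_coeffsD(4)[OF per'])
  have c: "closed {\<theta>. 2 - \<eta> \<le> \<bar>disc \<alpha> q \<theta>\<bar> \<and> \<bar>disc \<alpha> q \<theta>\<bar> \<le> 2}"
    by (intro closed_Collect_conj closed_Collect_le continuous_intros continuous_disc periodic_coeffsD[OF per])
  have eq: "{\<theta>\<in>{0..<2 * pi}. 2 - \<eta> \<le> \<bar>disc \<alpha> q \<theta>\<bar> \<and> \<bar>disc \<alpha> q \<theta>\<bar> \<le> 2} =
      {0..<2 * pi} \<inter> {\<theta>. 2 - \<eta> \<le> \<bar>disc \<alpha> q \<theta>\<bar> \<and> \<bar>disc \<alpha> q \<theta>\<bar> \<le> 2}"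
    by (rule set_eqI) (simp only: mem_Collect_eq Int_iff)
  have m: "{\<theta>\<in>{0..<2 * pi}. 2 - \<eta> \<le> \<bar>disc \<alpha> q \<theta>\<bar> \<and> \<bar>disc \<alpha> q \<theta>\<bar> \<le> 2} \<in> sets circle_lborel"
    unfolding sets_circle_lborel eq by (intro conjI sets.Int[OF _ borel_closed[OF c]]) auto
  show ?thesis unfolding measure_arc_length[OF b]
  proof (rule finite_measure_mono[OF _ m], intro subsetI, elim CollectE conjE, intro CollectI conjI)
    fix \<theta> assume \<theta>: "\<theta> \<in> {0..<2 * pi}" "cis \<theta> \<in> cmv_spectrum \<alpha> - cmv_spectrum \<beta>"
    then have d: "\<bar>disc \<alpha> q \<theta>\<bar> \<le> 2" "2 < \<bar>disc \<beta> q \<theta>\<bar>"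
      using cis_in_cmv_spectrum[OF per] cis_in_cmv_spectrum[OF per'] by (simp_all add: not_le)
    then show "\<bar>disc \<alpha> q \<theta>\<bar> \<le> 2" by simp
    show "2 - \<eta> \<le> \<bar>disc \<alpha> q \<theta>\<bar>" using d(2) \<eta>[of \<theta>] by linarith
  qed
qed

text \<open>Radii up to \<open>L / 2\<close> are handled by a single band, since the perturbed bands
  keep length \<open>L\<close>. For larger radii the centre is replaced by a nearby point
  \<open>x1\<close> of the old spectrum, and both this displacement and the lost measure are charged
  to \<sigma> - \<sigma>'.\<close>

lemma eventually_homogeneous:
  assumes per: "periodic_coeffs q \<alpha>" and hom: "homogeneous_upto \<delta>\<^sub>0 \<sigma> (cmv_spectrum \<alpha>)"
    and \<sigma>: "0 \<le> \<sigma>'" "\<sigma>' < \<sigma>" "\<sigma> \<le> 1"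
  shows "\<forall>\<^sub>F s in at_right 0. homogeneous_upto \<delta>\<^sub>0 \<sigma>' (cmv_spectrum (perturb \<alpha> q s))"
proof -
  note perD = periodic_coeffsD[OF per]
  interpret finite_measure arc_length by (rule finite_measure_arc_length)
  obtain L0 where L0: "0 < L0" "\<And>x y. \<bar>x - y\<bar> < L0 \<Longrightarrow> \<bar>disc \<alpha> q x - disc \<alpha> q y\<bar> < 3"
    using periodic_uniform[OF continuous_disc[OF perD(3)] _ disc_periodic, of 3 q] by auto
  \<comment> \<open>The cap keeps radii up to \<open>L / 2\<close> within one full turn, as
    \<open>small_scale_homogeneous\<close> requires.\<close>
  define L where "L = min L0 (4 * pi)"
  have L: "0 < L" "L \<le> 4 * pi" "\<And>x y. \<bar>x - y\<bar> < L \<Longrightarrow> \<bar>disc \<alpha> q x - disc \<alpha> q y\<bar> < 3"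
    using L0 by (auto simp: L_def)
  \<comment> \<open>Displacement and lost measure cost at most \<open>\<gamma>\<close> each, while
    for \<open>\<delta> > L / 2\<close> the reserve \<open>(\<sigma> - \<sigma>') * \<delta>\<close>
    exceeds \<open>(\<sigma> - \<sigma>') * L / 2 = 2 * \<gamma>\<close>.\<close>
  define \<gamma> where "\<gamma> = (\<sigma> - \<sigma>') * L / 4"
  have \<gamma>: "0 < \<gamma>" "\<gamma> \<le> L / 4"
  proof -
    show "0 < \<gamma>" using \<sigma> L by (simp add: \<gamma>_def)
    have "(\<sigma> - \<sigma>') * L \<le> 1 * L" using \<sigma> L by (intro mult_right_mono) auto
    then show "\<gamma> \<le> L / 4" by (simp add: \<gamma>_def)
  qed
  obtain \<eta> where \<eta>: "0 < \<eta>" "measure circle_lborel {\<theta>\<in>{0..<2 * pi}. 2 - \<eta> \<le> \<bar>disc \<alpha> q \<theta>\<bar> \<and> \<bar>disc \<alpha> q \<theta>\<bar> \<le> 2} < \<gamma>"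
    using disc_edge_measure[OF per \<gamma>(1)] .
  obtain d where d: "0 < d" "\<And>\<beta>. (\<forall>n. cmod (\<beta> n) \<le> 1) \<Longrightarrow> (\<forall>n. cmod (\<beta> n - \<alpha> n) \<le> d) \<Longrightarrow>
     cmv_spectrum \<beta> \<subseteq> (\<Union>x\<in>cmv_spectrum \<alpha>. ball x \<gamma>)"
    using approx_spectrum_upper_semicontinuous[OF perD(4) \<gamma>(1)] by metis
  have "\<forall>\<^sub>F s in at_right 0. \<forall>\<theta>. \<bar>disc (perturb \<alpha> q s) q \<theta> - disc \<alpha> q \<theta>\<bar> < min \<eta> (1 / 2)"
    by (rule perturb_disc_uniform[OF per]) (use \<eta> in simp)
  with eventually_periodic_perturb[OF per] eventually_small_perturb[OF d(1)]
  show ?thesis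
  proof eventually_elim
    case (elim s)
    define \<beta> where "\<beta> = perturb \<alpha> q s"
    have per': "periodic_coeffs q \<beta>" using elim(1) by (simp add: \<beta>_def)
    have cl: "\<bar>disc \<beta> q \<theta> - disc \<alpha> q \<theta>\<bar> < \<eta>" "\<bar>disc \<beta> q \<theta> - disc \<alpha> q \<theta>\<bar> \<le> 1 / 2" for \<theta>
      using elim(3) by (auto simp: \<beta>_def less_imp_le)
    have near: "cmv_spectrum \<beta> \<subseteq> (\<Union>x\<in>cmv_spectrum \<alpha>. ball x \<gamma>)"
    proof (rule d(2)[OF periodic_coeffsD(4)[OF per']])
      show "\<forall>n. cmod (\<beta> n - \<alpha> n) \<le> d"
        using perturb_diff[OF per, of s] elim(2) unfolding \<beta>_def by (meson less_imp_le order_trans)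
    qed
    have lost: "measure arc_length (cmv_spectrum \<alpha> - cmv_spectrum \<beta>) \<le> \<gamma>"
      using measure_lost_spectrum[OF per per' cl(1)] \<eta>(2) by linarith
    have bor: "cmv_spectrum \<alpha> \<in> sets borel" "cmv_spectrum \<beta> \<in> sets borel"
      using borel_cmv_spectrum periodic_coeffsD(4) per per' by blast+
    show ?case unfolding homogeneous_upto_def \<beta>_def[symmetric]
    proof (intro ballI allI impI)
      fix x \<delta> assume x: "x \<in> cmv_spectrum \<beta>" and \<delta>: "0 < \<delta> \<and> \<delta> \<le> \<delta>\<^sub>0"
      show "\<sigma>' * \<delta> \<le> measure arc_length (ball x \<delta> \<inter> cmv_spectrum \<beta>)"
      proof (cases "\<delta> \<le> L / 2")
        case True
        have "\<delta> \<le> measure arc_length (ball x \<delta> \<inter> cmv_spectrum \<beta>)"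
        proof (rule small_scale_homogeneous[OF per' _ _ _ x])
          fix \<theta> assume "\<bar>disc \<beta> q \<theta>\<bar> < 2"
          from long_bands[OF per', of "disc \<alpha> q" L, OF cl(2) L(3) this]
          obtain s t where "s \<le> \<theta>" "\<theta> \<le> t" "L \<le> t - s" "\<forall>y. s \<le> y \<and> y \<le> t \<longrightarrow> \<bar>disc \<beta> q y\<bar> \<le> 2" by blast
          then show "\<exists>s t. s \<le> \<theta> \<and> \<theta> \<le> t \<and> 2 * \<delta> \<le> t - s \<and> (\<forall>y. s \<le> y \<and> y \<le> t \<longrightarrow> \<bar>disc \<beta> q y\<bar> \<le> 2)"
            using True by (intro exI[of _ s] exI[of _ t]) auto
        qed (use \<delta> True L in auto)
        moreover have "\<sigma>' * \<delta> \<le> 1 * \<delta>" using \<sigma> \<delta> by (intro mult_right_mono) auto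
        ultimately show ?thesis by simp
      next
        case False
        obtain x1 where x1: "x1 \<in> cmv_spectrum \<alpha>" "dist x1 x < \<gamma>" using near x by auto
        have "\<gamma> < \<delta>" using False \<gamma> L by linarith
        then have "\<sigma> * (\<delta> - \<gamma>) \<le> measure arc_length (ball x1 (\<delta> - \<gamma>) \<inter> cmv_spectrum \<alpha>)"
          using hom x1(1) \<delta> \<gamma>(1) unfolding homogeneous_upto_def by simp
        also have "\<dots> \<le> measure arc_length ((ball x \<delta> \<inter> cmv_spectrum \<beta>) \<union> (cmv_spectrum \<alpha> - cmv_spectrum \<beta>))"
        proof (rule finite_measure_mono)
          show "ball x1 (\<delta> - \<gamma>) \<inter> cmv_spectrum \<alpha> \<subseteq> (ball x \<delta> \<inter> cmv_spectrum \<beta>) \<union> (cmv_spectrum \<alpha> - cmv_spectrum \<beta>)"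
          proof
            fix y assume y: "y \<in> ball x1 (\<delta> - \<gamma>) \<inter> cmv_spectrum \<alpha>"
            then have "dist x y < \<delta>" using x1(2) dist_triangle[of x y x1] by (simp add: dist_commute)
            then show "y \<in> (ball x \<delta> \<inter> cmv_spectrum \<beta>) \<union> (cmv_spectrum \<alpha> - cmv_spectrum \<beta>)" using y by auto
          qed
        qed (use bor in auto)
        also have "\<dots> \<le> measure arc_length (ball x \<delta> \<inter> cmv_spectrum \<beta>) + measure arc_length (cmv_spectrum \<alpha> - cmv_spectrum \<beta>)"
          by (rule measure_Un_le) (use bor in auto)
        finally have "\<sigma> * (\<delta> - \<gamma>) - \<gamma> \<le> measure arc_length (ball x \<delta> \<inter> cmv_spectrum \<beta>)" using lost by linarith
        moreover have "\<sigma>' * \<delta> \<le> \<sigma> * (\<delta> - \<gamma>) - \<gamma>"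
        proof -
          have "\<sigma> * \<gamma> \<le> 1 * \<gamma>" using \<sigma> \<gamma> by (intro mult_right_mono) auto
          moreover have "(\<sigma> - \<sigma>') * (L / 2) \<le> (\<sigma> - \<sigma>') * \<delta>" using \<sigma> False by (intro mult_left_mono) auto
          moreover have "(\<sigma> - \<sigma>') * (L / 2) = 2 * \<gamma>" by (simp add: \<gamma>_def)
          ultimately show ?thesis by (simp add: algebra_simps)
        qed
        ultimately show ?thesis by linarith
      qed
    qed
  qed
qed

text \<open>The order of choices matters: \<open>m0\<close> depends on the required porosity, any
  larger multiple may then be prescribed, and \<eta> can still be arbitrarily small. The radius
  \<open>\<delta>\<^sub>0\<close> is kept.\<close>

theorem periodic_step:
  assumes per: "periodic_coeffs p \<alpha>" and hom: "homogeneous_upto \<delta>\<^sub>0 \<sigma> (cmv_spectrum \<alpha>)"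
    and \<sigma>: "0 \<le> \<sigma>'" "\<sigma>' < \<sigma>" "\<sigma> \<le> 1" and e: "0 < e"
  obtains m0 where "\<And>m \<eta>. m0 \<le> m \<Longrightarrow> 0 < \<eta> \<Longrightarrow> \<exists>\<beta>. periodic_coeffs (m * p) \<beta> \<and> (\<forall>n. cmod (\<beta> n - \<alpha> n) \<le> \<eta>) \<and>
     homogeneous_upto \<delta>\<^sub>0 \<sigma>' (cmv_spectrum \<beta>) \<and> porous e (cmv_spectrum \<beta>)"
proof -
  obtain m0 where m0: "\<And>m. m0 \<le> m \<Longrightarrow> 0 < m \<and> (\<forall>\<^sub>F s in at_right 0. porous e (cmv_spectrum (perturb \<alpha> (m * p) s)))"
    using eventually_porous[OF per e] by blast
  show thesis
  proof (rule that[of m0])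
    fix m and \<eta> :: real assume m: "m0 \<le> m" and \<eta>: "0 < \<eta>"
    have mpos: "0 < m" using m0[OF m] by blast
    note perm = periodic_coeffs_mult[OF per mpos]
    have "\<forall>\<^sub>F s in at_right 0. porous e (cmv_spectrum (perturb \<alpha> (m * p) s)) \<and> periodic_coeffs (m * p) (perturb \<alpha> (m * p) s)
        \<and> homogeneous_upto \<delta>\<^sub>0 \<sigma>' (cmv_spectrum (perturb \<alpha> (m * p) s)) \<and> 0 < s \<and> s \<le> \<eta>"
      using m0[OF m] by (intro eventually_conj eventually_periodic_perturb[OF perm] eventually_homogeneous[OF perm hom \<sigma>]
        eventually_small_perturb[OF \<eta>]) blast
    then obtain s where s: "porous e (cmv_spectrum (perturb \<alpha> (m * p) s))" "periodic_coeffs (m * p) (perturb \<alpha> (m * p) s)"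
        "homogeneous_upto \<delta>\<^sub>0 \<sigma>' (cmv_spectrum (perturb \<alpha> (m * p) s))" "0 < s" "s \<le> \<eta>"
      using eventually_happens'[OF trivial_limit_at_right_real] by (metis (no_types, lifting))
    have "\<forall>n. cmod (perturb \<alpha> (m * p) s n - \<alpha> n) \<le> \<eta>"
      using perturb_diff[OF perm less_imp_le[OF s(4)]] s(5) order_trans by blast
    then show "\<exists>\<beta>. periodic_coeffs (m * p) \<beta> \<and> (\<forall>n. cmod (\<beta> n - \<alpha> n) \<le> \<eta>) \<and>
     homogeneous_upto \<delta>\<^sub>0 \<sigma>' (cmv_spectrum \<beta>) \<and> porous e (cmv_spectrum \<beta>)" using s by blast
  qed
qed

section \<open>Cyclic quotients of a monothetic Cantor group\<close>

lemma int_multiple_0 [simp]: "int_multiple 0 x = 0"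
  by (simp add: int_multiple_def)

lemma int_multiple_add_1: "int_multiple (n + 1) x = int_multiple n x + x"
proof (cases "0 \<le> n")
  case True
  then have "nat (n + 1) = Suc (nat n)" by simp
  then show ?thesis using True by (simp add: int_multiple_def)
next
  case False
  then have "nat (- n) = Suc (nat (- (n + 1)))" by simp
  then have "int_multiple n x = - ((\<Sum>i<nat (- (n + 1)). x) + x)"
    using False by (simp add: int_multiple_def)
  then show ?thesis using False by (cases "n = -1") (simp_all add: int_multiple_def)
qed

lemma int_multiple_add: "int_multiple (m + n) x = int_multiple m x + int_multiple n x"
proof (induction n rule: int_induct[where k = 0])
  case (step1 i)
  then show ?case using int_multiple_add_1[of "m + i" x] int_multiple_add_1[of i x] by (simp add: algebra_simps)
next
  case (step2 i)
  then show ?case using int_multiple_add_1[of "m + i - 1" x] int_multiple_add_1[of "i - 1" x]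
    by (simp add: algebra_simps)
qed simp

lemma int_multiple_minus: "int_multiple (- n) x = - int_multiple n x"
  using int_multiple_add[of n "- n" x] by (simp add: eq_neg_iff_add_eq_0 add.commute)

lemma int_multiple_diff: "int_multiple (m - n) x = int_multiple m x - int_multiple n x"
  using int_multiple_add[of m "- n" x] by (simp add: int_multiple_minus)

text \<open>Openness of the fibres, with no topology on the codomain, so that the notion applies
  equally to residues and to finite families of sets.\<close>

definition locally_constant :: "('a::topological_space \<Rightarrow> 'b) \<Rightarrow> bool" where
  "locally_constant \<phi> \<longleftrightarrow> (\<forall>x. open {y. \<phi> y = \<phi> x})"

lemma locally_constant_Pair:
  assumes "locally_constant \<phi>" "locally_constant \<psi>"
  shows "locally_constant (\<lambda>x. (\<phi> x, \<psi> x))"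
  unfolding locally_constant_def
proof
  fix x
  have "{y. (\<phi> y, \<psi> y) = (\<phi> x, \<psi> x)} = {y. \<phi> y = \<phi> x} \<inter> {y. \<psi> y = \<psi> x}" by auto
  then show "open {y. (\<phi> y, \<psi> y) = (\<phi> x, \<psi> x)}" using assms by (simp add: locally_constant_def open_Int)
qed

lemma locally_constant_open_vimage:
  assumes "locally_constant \<phi>"
  shows "open {y. P (\<phi> y)}"
proof -
  have "{y. P (\<phi> y)} = (\<Union>z\<in>{z. P (\<phi> z)}. {y. \<phi> y = \<phi> z})" by auto
  then show ?thesis using assms unfolding locally_constant_def by (metis (no_types, lifting) open_UN)
qed

lemma locally_constant_comp:
  assumes "locally_constant \<phi>"
  shows "locally_constant (\<lambda>x. f (\<phi> x))"
  unfolding locally_constant_def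
proof
  fix x
  show "open {y. f (\<phi> y) = f (\<phi> x)}"
    by (rule locally_constant_open_vimage[OF assms, of "\<lambda>z. f z = f (\<phi> x)"])
qed

text \<open>The fibres are the atoms of the finite Boolean algebra generated by the family.\<close>

lemma locally_constant_family:
  assumes "finite \<V>" "\<And>V. V \<in> \<V> \<Longrightarrow> open V \<and> open (- V)"
  shows "locally_constant (\<lambda>x. {V\<in>\<V>. x \<in> V})"
  unfolding locally_constant_def
proof
  fix x
  have "{y. {V\<in>\<V>. y \<in> V} = {V\<in>\<V>. x \<in> V}} = (\<Inter>V\<in>\<V>. if x \<in> V then V else - V)"
    by (auto split: if_splits)
  moreover have "open (\<Inter>V\<in>\<V>. if x \<in> V then V else - V)" using assms by (intro open_INT) auto
  ultimately show "open {y. {V\<in>\<V>. y \<in> V} = {V\<in>\<V>. x \<in> V}}" by simp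
qed

text \<open>In a locally compact Hausdorff space a compact component has a base of clopen
  neighbourhoods, and here the components are points.\<close>

lemma clopen_base:
  fixes x :: "'a::t2_space"
  assumes comp: "compact (UNIV :: 'a set)" and td: "totally_disconnected (UNIV :: 'a set)"
    and W: "open W" "x \<in> W"
  obtains U where "open U" "open (- U)" "x \<in> U" "U \<subseteq> W"
proof -
  have haus: "Hausdorff_space (euclidean :: 'a topology)"
    unfolding Hausdorff_space_def disjnt_def
  proof (intro allI impI, elim conjE)
    fix a b :: 'a assume "a \<noteq> b"
    then obtain U V where "open U" "open V" "a \<in> U" "b \<in> V" "U \<inter> V = {}" using hausdorff by metis
    then show "\<exists>U V. openin euclidean U \<and> openin euclidean V \<and> a \<in> U \<and> b \<in> V \<and> U \<inter> V = {}" by auto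
  qed
  have lc: "locally_compact_space (euclidean :: 'a topology)"
    by (rule compact_imp_locally_compact_space) (use comp in \<open>simp add: compact_space_def\<close>)
  have "connected_component_of_set euclidean x = {x}"
  proof -
    have "connected_component_of_set euclidean x = connected_component_set UNIV x"
      by (auto simp: connected_component_of_def connected_component_def)
    then show ?thesis using td by (simp add: totally_disconnected_def)
  qed
  then have C: "{x} \<in> connected_components_of (euclidean :: 'a topology)"
    unfolding connected_components_of_def by (auto intro: image_eqI[of _ _ x])
  obtain U V where "openin euclidean U" "openin euclidean V" "disjnt U V" "U \<union> V = topspace euclidean" "{x} \<subseteq> U" "U \<subseteq> W"
    by (rule wilder_locally_compact_component_thm[OF lc haus C, of W]) (use W in auto)
  moreover from this have "- U = V" by (auto simp: disjnt_def)
  ultimately show thesis using that by auto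
qed

text \<open>Every atom of a finite clopen cover receives the value of \<open>g\<close> at a
  representative. The values stay in the range of \<open>g\<close>, hence in the disk when
  \<open>g\<close> maps there.\<close>

lemma locally_constant_approx:
  fixes g :: "'a::t2_space \<Rightarrow> complex"
  assumes comp: "compact (UNIV :: 'a set)" and td: "totally_disconnected (UNIV :: 'a set)"
    and g: "continuous_on UNIV g" and e: "0 < e"
  obtains \<phi> where "locally_constant \<phi>" "\<And>x. dist (\<phi> x) (g x) < e" "range \<phi> \<subseteq> range g"
proof -
  have "\<exists>U. open U \<and> open (- U) \<and> x \<in> U \<and> (\<forall>y\<in>U. dist (g x) (g y) < e / 2)" for x
  proof -
    have "open (g -` ball (g x) (e / 2))" using g by (simp add: open_vimage)
    then obtain U where "open U" "open (- U)" "x \<in> U" "U \<subseteq> g -` ball (g x) (e / 2)"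
      using clopen_base[OF comp td, of "g -` ball (g x) (e / 2)" x] e by auto
    then show ?thesis by (intro exI[of _ U]) auto
  qed
  then obtain U where U: "\<And>x. open (U x)" "\<And>x. open (- U x)" "\<And>x. x \<in> U x" "\<And>x y. y \<in> U x \<Longrightarrow> dist (g x) (g y) < e / 2"
    by metis
  obtain X where X: "finite X" "UNIV \<subseteq> (\<Union>x\<in>X. U x)"
    by (rule compactE_image[OF comp, of UNIV U]) (use U in auto)
  define \<kappa> where "\<kappa> = (\<lambda>x. {V\<in>U ` X. x \<in> V})"
  have \<kappa>: "locally_constant \<kappa>" unfolding \<kappa>_def by (rule locally_constant_family) (use X U in auto)
  define \<phi> where "\<phi> = (\<lambda>x. g (SOME z. \<kappa> z = \<kappa> x))"
  have \<phi>: "locally_constant \<phi>" unfolding \<phi>_def by (rule locally_constant_comp[OF \<kappa>, of "\<lambda>k. g (SOME z. \<kappa> z = k)"])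
  have "dist (\<phi> x) (g x) < e" for x
  proof -
    define z where "z = (SOME z. \<kappa> z = \<kappa> x)"
    have z: "\<kappa> z = \<kappa> x" unfolding z_def by (rule someI[of _ x]) simp
    obtain c where c: "c \<in> X" "x \<in> U c" using X(2) by blast
    then have "z \<in> U c" using z unfolding \<kappa>_def by blast
    then have "dist (g c) (g z) < e / 2" "dist (g c) (g x) < e / 2" using U(4) c(2) by blast+
    then show ?thesis unfolding \<phi>_def z_def[symmetric] by (metis dist_commute dist_triangle_half_l)
  qed
  moreover have "range \<phi> \<subseteq> range g" by (auto simp: \<phi>_def)
  ultimately show thesis using that \<phi> by blast
qed

text \<open>Clopen sets separate the points of a finite set of size \<open>N\<close>. This is how
  infinitude of the group produces large quotients.\<close>

lemma locally_constant_many_values: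
  assumes comp: "compact (UNIV :: 'a::t2_space set)" and td: "totally_disconnected (UNIV :: 'a::t2_space set)"
    and inf: "infinite (UNIV :: 'a::t2_space set)"
  obtains \<psi> :: "'a::t2_space \<Rightarrow> 'a set set" and F where "locally_constant \<psi>" "finite F" "card F = N" "inj_on \<psi> F"
proof -
  obtain F :: "'a set" where F: "finite F" "card F = N" using infinite_arbitrarily_large[OF inf] by blast
  have "\<exists>U. open U \<and> open (- U) \<and> x \<in> U \<and> y \<notin> U" if "x \<noteq> y" for x y :: 'a
  proof -
    have "open (- {y})" by auto
    then show ?thesis using clopen_base[OF comp td, of "- {y}" x] that by auto
  qed
  then obtain U where U: "\<And>x y :: 'a. x \<noteq> y \<Longrightarrow> open (U x y) \<and> open (- U x y) \<and> x \<in> U x y \<and> y \<notin> U x y" by metis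
  define \<V> where "\<V> = (\<lambda>(x, y). U x y) ` {(x, y) \<in> F \<times> F. x \<noteq> y}"
  have "finite \<V>" unfolding \<V>_def using F by (intro finite_imageI) (auto intro: finite_subset[of _ "F \<times> F"])
  then have lc: "locally_constant (\<lambda>x. {V\<in>\<V>. x \<in> V})"
    by (rule locally_constant_family) (use U in \<open>auto simp: \<V>_def\<close>)
  have "inj_on (\<lambda>x. {V\<in>\<V>. x \<in> V}) F"
  proof (rule inj_onI, rule ccontr)
    fix x y assume xy: "x \<in> F" "y \<in> F" "{V\<in>\<V>. x \<in> V} = {V\<in>\<V>. y \<in> V}" "x \<noteq> y"
    then have "U x y \<in> \<V>" by (auto simp: \<V>_def intro!: image_eqI[of _ _ "(x, y)"])
    then show False using U[OF xy(4)] xy(3) by blast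
  qed
  then show thesis using that[OF lc F] by blast
qed

section \<open>Finite cyclic quotients\<close>

text \<open>\<open>c\<close> is a continuous homomorphism onto the integers modulo \<open>p\<close>, represented by \<open>{0..<p}\<close>, that
  sends \<open>\<theta>\<close> to the class of 1.\<close>

definition cyclic_quotient :: "'a::topological_ab_group_add \<Rightarrow> nat \<Rightarrow> ('a \<Rightarrow> int) \<Rightarrow> bool" where
  "cyclic_quotient \<theta> p c \<longleftrightarrow> 0 < p \<and> locally_constant c \<and> (\<forall>x. 0 \<le> c x \<and> c x < int p) \<and>
     (\<forall>n x. c (int_multiple n \<theta> + x) = (n + c x) mod int p) \<and> c 0 = 0"

text \<open>A tube argument: around each \<open>x\<close> the function is invariant under all small
  shifts, and finitely many such neighbourhoods cover the group. The resulting neighbourhood of 0 is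
  moved to every point of the set by the group structure.\<close>

lemma invariance_group_open:
  fixes \<phi> :: "'a::{topological_ab_group_add, t2_space} \<Rightarrow> 'b"
  assumes comp: "compact (UNIV :: 'a set)" and \<phi>: "locally_constant \<phi>"
  shows "open {h. \<forall>x. \<phi> (h + x) = \<phi> x}"
proof -
  let ?H = "{h. \<forall>x. \<phi> (h + x) = \<phi> x}"
  have cont: "continuous_on UNIV (\<lambda>q::'a \<times> 'a. fst q + snd q)"
    unfolding continuous_on_def by (intro ballI tendsto_add tendsto_fst tendsto_snd tendsto_ident_at)
  have nbhd: "\<exists>A B. open A \<and> open B \<and> (0::'a) \<in> A \<and> x \<in> B \<and> (\<forall>a\<in>A. \<forall>b\<in>B. \<phi> (a + b) = \<phi> b)" for x
  proof -
    have o: "open {y. \<phi> y = \<phi> x}" using \<phi> by (simp add: locally_constant_def)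
    then have "open ((\<lambda>q::'a \<times> 'a. fst q + snd q) -` {y. \<phi> y = \<phi> x})"
      using cont by (intro open_vimage)
    moreover have "(0, x) \<in> (\<lambda>q::'a \<times> 'a. fst q + snd q) -` {y. \<phi> y = \<phi> x}" by simp
    ultimately obtain A B where AB: "open A" "open B" "(0, x) \<in> A \<times> B" "A \<times> B \<subseteq> (\<lambda>q. fst q + snd q) -` {y. \<phi> y = \<phi> x}"
      by (rule open_prod_elim)
    have "\<forall>a\<in>A. \<forall>b\<in>B \<inter> {y. \<phi> y = \<phi> x}. \<phi> (a + b) = \<phi> b" using AB(4) by force
    then show ?thesis using AB o by (intro exI[of _ A] exI[of _ "B \<inter> {y. \<phi> y = \<phi> x}"]) auto
  qed
  then obtain A B where AB: "\<And>x. open (A x)" "\<And>x. open (B x)" "\<And>x. (0::'a) \<in> A x" "\<And>x. x \<in> B x"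
    "\<And>x a b. a \<in> A x \<Longrightarrow> b \<in> B x \<Longrightarrow> \<phi> (a + b) = \<phi> b" by metis
  obtain X where X: "finite X" "UNIV \<subseteq> (\<Union>x\<in>X. B x)"
    by (rule compactE_image[OF comp, of UNIV B]) (use AB in auto)
  define W where "W = (\<Inter>x\<in>X. A x)"
  have W: "open W" "0 \<in> W" unfolding W_def using X(1) AB by auto
  have WH: "W \<subseteq> ?H"
  proof (intro subsetI CollectI allI)
    fix h x assume "h \<in> W"
    obtain z where "z \<in> X" "x \<in> B z" using X(2) by blast
    then show "\<phi> (h + x) = \<phi> x" using AB(5) \<open>h \<in> W\<close> by (auto simp: W_def)
  qed
  have add: "h + k \<in> ?H" if "h \<in> ?H" "k \<in> ?H" for h k using that by (simp add: add.assoc)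
  show ?thesis
    unfolding open_subopen[of ?H]
  proof
    fix h assume h: "h \<in> ?H"
    have "open ((\<lambda>y. y - h) -` W)"
      by (intro open_vimage W continuous_at_imp_continuous_on ballI) (simp add: isCont_def tendsto_diff)
    moreover have "h \<in> (\<lambda>y. y - h) -` W" using W(2) by simp
    moreover have "(\<lambda>y. y - h) -` W \<subseteq> ?H"
    proof
      fix y assume "y \<in> (\<lambda>y. y - h) -` W"
      then have "(y - h) + h \<in> ?H" using WH h by (intro add) auto
      then show "y \<in> ?H" by simp
    qed
    ultimately show "\<exists>T. open T \<and> h \<in> T \<and> T \<subseteq> ?H" by blast
  qed
qed

text \<open>The stabiliser \<open>H\<close> of \<phi> is an open subgroup. Compactness gives it
  finite index, and density of the multiples of \<theta> makes the quotient cyclic, generated by the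
  class of \<theta>; \<phi> is constant on the cosets.\<close>

lemma cyclic_quotient_exists:
  fixes \<theta> :: "'a::{topological_ab_group_add, t2_space}" and \<phi> :: "'a \<Rightarrow> 'b"
  assumes comp: "compact (UNIV :: 'a set)" and gen: "topological_generator \<theta>" and \<phi>: "locally_constant \<phi>"
  obtains p c \<beta> where "cyclic_quotient \<theta> p c" "\<And>x. \<phi> x = \<beta> (c x)"
proof -
  define H where "H = {h. \<forall>x. \<phi> (h + x) = \<phi> x}"
  have Hop: "open H" unfolding H_def by (rule invariance_group_open[OF comp \<phi>])
  have H0: "0 \<in> H" by (simp add: H_def)
  have Hadd: "h + k \<in> H" if "h \<in> H" "k \<in> H" for h k using that by (simp add: H_def add.assoc)
  have Hneg: "- h \<in> H" if "h \<in> H" for h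
  proof -
    have "\<phi> (- h + x) = \<phi> x" for x
    proof -
      have "\<phi> (h + (- h + x)) = \<phi> (- h + x)" using that unfolding H_def by blast
      then show ?thesis by simp
    qed
    then show ?thesis by (simp add: H_def)
  qed
  have Hdiff: "h - k \<in> H" if "h \<in> H" "k \<in> H" for h k using Hadd[OF that(1) Hneg[OF that(2)]] by simp
  have coset_open: "open {y. y - x \<in> H}" for x
  proof -
    have "open ((\<lambda>y. y - x) -` H)"
      by (intro open_vimage Hop continuous_at_imp_continuous_on ballI) (simp add: isCont_def tendsto_diff)
    then show ?thesis by (simp add: vimage_def)
  qed
  have dense: "\<exists>n. int_multiple n \<theta> - x \<in> H" for x
  proof -
    have "x \<in> closure (range (\<lambda>n. int_multiple n \<theta>))" using gen by (simp add: topological_generator_def)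
    moreover have "x \<in> {y. y - x \<in> H}" using H0 by simp
    ultimately have "{y. y - x \<in> H} \<inter> range (\<lambda>n. int_multiple n \<theta>) \<noteq> {}"
      using coset_open[of x] by (metis (no_types, lifting) IntI closure_iff_nhds_not_empty empty_iff inf_commute subset_refl)
    then show ?thesis by blast
  qed
  \<comment> \<open>Pigeonhole: finitely many cosets cover the group, so two multiples of \<theta>
    lie in the same one.\<close>
  have "\<exists>n>0. int_multiple (int n) \<theta> \<in> H"
  proof -
    obtain X where X: "finite X" "UNIV \<subseteq> (\<Union>x\<in>X. {y. y - x \<in> H})"
      by (rule compactE_image[OF comp, of UNIV "\<lambda>x. {y. y - x \<in> H}"]) (use coset_open H0 in auto)
    then have "\<forall>n::nat. \<exists>x\<in>X. int_multiple (int n) \<theta> - x \<in> H" by blast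
    then obtain f where f: "\<And>n::nat. f n \<in> X" "\<And>n::nat. int_multiple (int n) \<theta> - f n \<in> H" by metis
    have "\<not> inj f" using X(1) f(1) by (meson finite_imageD finite_subset image_subsetI infinite_UNIV_nat)
    then obtain a b where ab: "f a = f b" "a \<noteq> b" by (auto simp: inj_on_def)
    have mem: "int_multiple (int b - int a) \<theta> \<in> H" if "f a = f b" for a b
      using Hdiff[OF f(2)[of b] f(2)[of a]] that by (simp add: int_multiple_diff)
    show ?thesis
    proof (cases "a < b")
      case True
      then show ?thesis using mem[OF ab(1)] by (intro exI[of _ "b - a"]) (simp add: of_nat_diff)
    next
      case False
      then show ?thesis using mem[OF ab(1)[symmetric]] ab(2) by (intro exI[of _ "a - b"]) (simp add: of_nat_diff)
    qed
  qed
  then obtain p where p: "0 < p" "int_multiple (int p) \<theta> \<in> H" "\<And>n. 0 < n \<Longrightarrow> n < p \<Longrightarrow> int_multiple (int n) \<theta> \<notin> H"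
  proof -
    let ?P = "\<lambda>n. 0 < n \<and> int_multiple (int n) \<theta> \<in> H"
    assume "\<exists>n>0. int_multiple (int n) \<theta> \<in> H"
    then have "?P (LEAST n. ?P n)" by (rule LeastI_ex)
    moreover have "int_multiple (int n) \<theta> \<notin> H" if "0 < n" "n < (LEAST n. ?P n)" for n
      using not_less_Least[OF that(2)] that(1) by blast
    ultimately show thesis using that by blast
  qed
  have pk: "int_multiple (int p * k) \<theta> \<in> H" for k
  proof (induction k rule: int_induct[where k = 0])
    case (step1 i)
    then show ?case using Hadd[OF step1(2) p(2)] by (simp add: int_multiple_add distrib_left)
  next
    case (step2 i)
    then show ?case using Hdiff[OF step2(2) p(2)] by (simp add: int_multiple_diff right_diff_distrib)
  qed (simp add: H0)
  have Hmod: "int_multiple n \<theta> \<in> H \<longleftrightarrow> n mod int p = 0" for n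
  proof -
    have n: "int_multiple n \<theta> = int_multiple (int p * (n div int p)) \<theta> + int_multiple (n mod int p) \<theta>"
      by (simp add: int_multiple_add[symmetric])
    define r where "r = nat (n mod int p)"
    have r: "int r = n mod int p" "r < p" using p(1) by (simp_all add: r_def nat_less_iff)
    have "int_multiple n \<theta> \<in> H \<longleftrightarrow> int_multiple (int r) \<theta> \<in> H"
      using Hadd[OF pk[of "n div int p"], of "int_multiple (int r) \<theta>"] Hdiff[OF _ pk[of "n div int p"], of "int_multiple n \<theta>"]
      by (auto simp: n r(1))
    also have "\<dots> \<longleftrightarrow> r = 0" using p(3)[of r] r(2) H0 by (cases "r = 0") auto
    finally show ?thesis using r(1) by auto
  qed
  \<comment> \<open>Some multiple of \<theta> in the coset of \<open>x\<close>; its residue modulo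
    \<open>p\<close> is independent of the choice.\<close>
  define N where "N x = (SOME n. int_multiple n \<theta> - x \<in> H)" for x
  have N: "int_multiple (N x) \<theta> - x \<in> H" for x unfolding N_def using dense[of x] by (rule someI_ex)
  define c where "c x = N x mod int p" for x
  have c_eq: "c x = n mod int p" if "int_multiple n \<theta> - x \<in> H" for n x
  proof -
    have "int_multiple (N x - n) \<theta> \<in> H" using Hdiff[OF N[of x] that] by (simp add: int_multiple_diff)
    then have "(N x - n) mod int p = 0" by (simp add: Hmod)
    then show ?thesis unfolding c_def by (metis mod_eq_dvd_iff mod_0_imp_dvd)
  qed
  have c_mem: "int_multiple (c x) \<theta> - x \<in> H" for x
  proof -
    have "int_multiple (c x) \<theta> = int_multiple (N x) \<theta> - int_multiple (int p * (N x div int p)) \<theta>"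
      by (simp add: int_multiple_diff[symmetric] c_def minus_mult_div_eq_mod)
    then have "int_multiple (c x) \<theta> - x = (int_multiple (N x) \<theta> - x) - int_multiple (int p * (N x div int p)) \<theta>" by simp
    then show ?thesis using Hdiff[OF N[of x] pk[of "N x div int p"]] by (simp only:)
  qed
  have "cyclic_quotient \<theta> p c"
    unfolding cyclic_quotient_def
  proof (intro conjI allI)
    show "locally_constant c" unfolding locally_constant_def
    proof
      fix x
      have "{y. c y = c x} = {y. y - int_multiple (c x) \<theta> \<in> H}"
      proof (intro set_eqI iffI; elim CollectE; intro CollectI)
        fix y assume "c y = c x"
        then show "y - int_multiple (c x) \<theta> \<in> H" using Hneg[OF c_mem[of y]] by simp
      next
        fix y assume "y - int_multiple (c x) \<theta> \<in> H"
        from Hneg[OF this] have "c y = c x mod int p" by (intro c_eq) simp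
        then show "c y = c x" by (simp add: c_def)
      qed
      then show "open {y. c y = c x}" using coset_open by simp
    qed
    fix x n
    show "0 \<le> c x" "c x < int p" using p(1) by (simp_all add: c_def)
    have "int_multiple (n + c x) \<theta> - (int_multiple n \<theta> + x) = int_multiple (c x) \<theta> - x"
      by (simp add: int_multiple_add)
    then have "int_multiple (n + c x) \<theta> - (int_multiple n \<theta> + x) \<in> H" using c_mem[of x] by (simp only:)
    then show "c (int_multiple n \<theta> + x) = (n + c x) mod int p" by (rule c_eq)
    show "c 0 = 0" using c_eq[of 0 0] H0 by simp
  qed (rule p(1))
  moreover have "\<phi> x = \<phi> (int_multiple (c x) \<theta>)" for x
  proof -
    have "\<phi> ((int_multiple (c x) \<theta> - x) + x) = \<phi> x" using c_mem[of x] unfolding H_def by blast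
    then show ?thesis by simp
  qed
  ultimately show thesis using that[of p c "\<lambda>n. \<phi> (int_multiple n \<theta>)"] by blast
qed

text \<open>Pairing \<phi> with a function that separates \<open>N\<close> points forces the
  quotient to have at least \<open>N\<close> elements.\<close>

lemma cyclic_quotient_large:
  fixes \<theta> :: "'a::{topological_ab_group_add, t2_space}" and \<phi> :: "'a \<Rightarrow> 'b"
  assumes comp: "compact (UNIV :: 'a set)" and td: "totally_disconnected (UNIV :: 'a set)"
    and inf: "infinite (UNIV :: 'a set)" and gen: "topological_generator \<theta>" and \<phi>: "locally_constant \<phi>"
  obtains p c \<beta> where "cyclic_quotient \<theta> p c" "\<And>x. \<phi> x = \<beta> (c x)" "N \<le> p"
proof -
  obtain \<psi> :: "'a \<Rightarrow> 'a set set" and F where \<psi>: "locally_constant \<psi>" "finite F" "card F = N" "inj_on \<psi> F"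
    using locally_constant_many_values[OF comp td inf] by metis
  obtain p c \<beta> where c: "cyclic_quotient \<theta> p c" and \<beta>: "\<And>x. (\<phi> x, \<psi> x) = \<beta> (c x)"
    using cyclic_quotient_exists[OF comp gen locally_constant_Pair[OF \<phi> \<psi>(1)]] by metis
  have "inj_on c F"
  proof (rule inj_onI)
    fix x y assume xy: "x \<in> F" "y \<in> F" "c x = c y"
    then have "\<psi> x = \<psi> y" using \<beta>[of x] \<beta>[of y] by (metis snd_conv)
    then show "x = y" using \<psi>(4) xy by (auto dest: inj_onD)
  qed
  moreover have "c ` F \<subseteq> {0..<int p}" using c by (auto simp: cyclic_quotient_def)
  ultimately have "card F \<le> card {0..<int p}" using card_inj_on_le by blast
  then have "N \<le> p" using \<psi>(3) by simp
  moreover have "\<phi> x = fst (\<beta> (c x))" for x using \<beta>[of x] by (metis fst_conv)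
  ultimately show thesis using that[OF c, of "\<lambda>n. fst (\<beta> n)"] by blast
qed

text \<open>The old quotient factors through the new one, so \<open>p\<close> divides the new order
  \<open>q\<close>; requiring \<open>N * p \<le> q\<close> makes the ratio at least
  \<open>N\<close>.\<close>

lemma cyclic_quotient_refine:
  fixes \<theta> :: "'a::{topological_ab_group_add, t2_space}"
  assumes comp: "compact (UNIV :: 'a set)" and td: "totally_disconnected (UNIV :: 'a set)"
    and inf: "infinite (UNIV :: 'a set)" and gen: "topological_generator \<theta>" and c: "cyclic_quotient \<theta> p c"
  obtains m c' where "N \<le> m" "cyclic_quotient \<theta> (m * p) c'" "\<And>x. c x = c' x mod int p"
proof -
  have p: "0 < p" and lc: "locally_constant c" using c by (auto simp: cyclic_quotient_def)
  obtain q c' \<beta> where c': "cyclic_quotient \<theta> q c'" and \<beta>: "\<And>x. c x = \<beta> (c' x)" and q: "N * p \<le> q"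
    using cyclic_quotient_large[OF comp td inf gen lc] by metis
  have cn: "c (int_multiple n \<theta>) = n mod int p" for n
    using c unfolding cyclic_quotient_def by (metis add.right_neutral)
  have c'n: "c' (int_multiple n \<theta>) = n mod int q" for n
    using c' unfolding cyclic_quotient_def by (metis add.right_neutral)
  have "int q mod int p = 0"
  proof -
    have "int q mod int p = \<beta> (int q mod int q)" using cn[of "int q"] \<beta>[of "int_multiple (int q) \<theta>"] c'n[of "int q"] by simp
    also have "\<dots> = 0 mod int p" using cn[of 0] \<beta>[of "int_multiple 0 \<theta>"] c'n[of 0] by simp
    finally show ?thesis by simp
  qed
  then have "p dvd q" by (metis mod_0_imp_dvd of_nat_dvd_iff)
  then obtain m where m: "q = m * p" by (metis dvdE mult.commute)
  have "N \<le> m" using q p by (simp add: m)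
  moreover have "c x = c' x mod int p" for x
  proof -
    have "0 \<le> c' x" "c' x < int q" using c' by (auto simp: cyclic_quotient_def)
    then have "c' (int_multiple (c' x) \<theta>) = c' x" by (simp add: c'n)
    then have "c x = c (int_multiple (c' x) \<theta>)" using \<beta> by metis
    then show ?thesis by (simp add: cn)
  qed
  ultimately show thesis using that c' m by blast
qed

section \<open>Limits of homogeneous and porous sets\<close>

text \<open>Finitely many gap points serve a net of the circle, and each has positive distance to
  the closed set \<open>K\<close>. The factor 2 pays for passing to the net.\<close>

lemma porous_stable:
  assumes K: "closed K" and e: "0 < e" and por: "porous e K"
  obtains \<eta> where "0 < \<eta>" "\<And>K'. K' \<subseteq> (\<Union>x\<in>K. ball x \<eta>) \<Longrightarrow> porous (2 * e) K'"
proof -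
  obtain \<Theta> :: "real set" where \<Theta>: "finite \<Theta>" "\<And>x. x \<in> sphere 0 1 \<Longrightarrow> \<exists>\<theta>\<in>\<Theta>. dist x (cis \<theta>) < e"
    using circle_net[OF e] by metis
  have "\<exists>y r. y \<in> sphere 0 1 \<and> dist (cis \<theta>) y < e \<and> 0 < r \<and> (\<forall>x\<in>K. r \<le> dist x y)" for \<theta>
  proof -
    obtain y where y: "y \<in> sphere 0 1" "dist (cis \<theta>) y < e" "y \<notin> K" using por unfolding porous_def by force
    obtain r where r: "0 < r" "ball y r \<subseteq> - K"
      using K y(3) open_contains_ball[of "- K"] by (auto simp: open_Compl)
    have "r \<le> dist x y" if "x \<in> K" for x using r(2) that by (auto simp: subset_iff not_less[symmetric] dist_commute)
    then show ?thesis using y r by blast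
  qed
  then obtain y r where yr: "\<And>\<theta>. y \<theta> \<in> sphere 0 1" "\<And>\<theta>. dist (cis \<theta>) (y \<theta>) < e" "\<And>\<theta>. 0 < r \<theta>"
    "\<And>\<theta> x. x \<in> K \<Longrightarrow> r \<theta> \<le> dist x (y \<theta>)" by metis
  define \<eta> where "\<eta> = Min (insert 1 (r ` \<Theta>))"
  have \<eta>: "0 < \<eta>" "\<And>\<theta>. \<theta> \<in> \<Theta> \<Longrightarrow> \<eta> \<le> r \<theta>" using \<Theta>(1) yr(3) by (auto simp: \<eta>_def)
  show thesis
  proof (rule that[OF \<eta>(1)])
    fix K' assume K': "K' \<subseteq> (\<Union>x\<in>K. ball x \<eta>)"
    show "porous (2 * e) K'" unfolding porous_def
    proof
      fix x :: complex assume "x \<in> sphere 0 1"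
      then obtain \<theta> where \<theta>: "\<theta> \<in> \<Theta>" "dist x (cis \<theta>) < e" using \<Theta>(2) by blast
      have "y \<theta> \<notin> K'"
      proof
        assume "y \<theta> \<in> K'"
        then obtain z where "z \<in> K" "dist z (y \<theta>) < \<eta>" using K' by auto
        then show False using yr(4)[of z \<theta>] \<eta>(2)[OF \<theta>(1)] by simp
      qed
      moreover have "dist x (y \<theta>) < 2 * e" using \<theta>(2) yr(2)[of \<theta>] dist_triangle[of x "y \<theta>" "cis \<theta>"] by simp
      ultimately show "\<exists>y\<in>sphere 0 1. dist x y < 2 * e \<and> y \<notin> K'" using yr(1) by blast
    qed
  qed
qed

text \<open>The ball intersected with closed neighbourhoods of \<open>K\<close> decreases to
  \<open>ball x \<delta> \<inter> K\<close>, and each of these sets contains the part of some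
  \<open>S n\<close> in a slightly smaller ball; the bound passes to the intersection by continuity
  from above.\<close>

lemma homogeneous_limit:
  fixes K :: "complex set" and S :: "nat \<Rightarrow> complex set"
  assumes K: "closed K" and S: "\<And>n. S n \<in> sets borel" and \<tau>: "0 < \<tau>"
    and hom: "\<And>n. homogeneous_upto \<delta>\<^sub>0 \<tau> (S n)"
    and upper: "\<And>\<eta>. 0 < \<eta> \<Longrightarrow> \<forall>\<^sub>F n in sequentially. S n \<subseteq> (\<Union>x\<in>K. ball x \<eta>)"
    and lower: "\<And>\<eta>. 0 < \<eta> \<Longrightarrow> \<forall>\<^sub>F n in sequentially. K \<subseteq> (\<Union>x\<in>S n. ball x \<eta>)"
  shows "homogeneous_upto \<delta>\<^sub>0 \<tau> K"
  unfolding homogeneous_upto_def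
proof (intro ballI allI impI)
  interpret finite_measure arc_length by (rule finite_measure_arc_length)
  fix x \<delta> assume x: "x \<in> K" and \<delta>: "0 < \<delta> \<and> \<delta> \<le> \<delta>\<^sub>0"
  define C where "C k = ball x \<delta> \<inter> {y. infdist y K \<le> inverse (real (Suc k))}" for k
  have Cb: "C k \<in> sets borel" for k
  proof -
    have "closed {y. infdist y K \<le> inverse (real (Suc k))}" by (intro closed_Collect_le continuous_intros)
    then show ?thesis unfolding C_def by (intro sets.Int[OF _ borel_closed]) auto
  qed
  have low: "\<tau> * \<delta> \<le> measure arc_length (C k)" for k
  proof -
    \<comment> \<open>A radius \<open>w < \<delta>\<close> leaves the amount
      \<open>\<delta> - w\<close> for replacing the centre \<open>x\<close> by a point of
      \<open>S n\<close>.\<close>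
    have wl: "w \<le> measure arc_length (C k) / \<tau>" if w: "0 < w" "w < \<delta>" for w
    proof -
      have "\<forall>\<^sub>F n in sequentially. S n \<subseteq> (\<Union>x\<in>K. ball x (inverse (real (Suc k)))) \<and> K \<subseteq> (\<Union>x\<in>S n. ball x (\<delta> - w))"
        using w by (intro eventually_conj upper lower) auto
      then obtain n where n: "S n \<subseteq> (\<Union>x\<in>K. ball x (inverse (real (Suc k))))" "K \<subseteq> (\<Union>x\<in>S n. ball x (\<delta> - w))"
        using eventually_happens'[OF sequentially_bot] by blast
      obtain z where z: "z \<in> S n" "dist z x < \<delta> - w" using n(2) x by auto
      have "\<tau> * w \<le> measure arc_length (ball z w \<inter> S n)"
        using hom[of n] z(1) w \<delta> unfolding homogeneous_upto_def by simp
      also have "\<dots> \<le> measure arc_length (C k)"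
      proof (rule finite_measure_mono)
        show "ball z w \<inter> S n \<subseteq> C k"
        proof
          fix y assume y: "y \<in> ball z w \<inter> S n"
          obtain v where v: "v \<in> K" "dist v y < inverse (real (Suc k))" using n(1) y by auto
          have "infdist y K \<le> inverse (real (Suc k))" using infdist_le2[OF v(1), of y] v(2) by (simp add: dist_commute)
          moreover have "dist x y < \<delta>" using y z(2) dist_triangle[of x y z] by (simp add: dist_commute)
          ultimately show "y \<in> C k" by (simp add: C_def)
        qed
      qed (use Cb in simp)
      finally show ?thesis using \<tau> by (simp add: field_simps)
    qed
    have "\<delta> \<le> measure arc_length (C k) / \<tau>"
      using conjunct1[OF \<delta>] wl by (rule dense_le_bounded)
    then show ?thesis using \<tau> by (simp add: field_simps)
  qed
  have dec: "decseq C"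
  proof (rule decseq_SucI)
    fix k
    have le: "inverse (real (Suc (Suc k))) \<le> inverse (real (Suc k))" by (rule le_imp_inverse_le) auto
    show "C (Suc k) \<subseteq> C k"
    proof
      fix y assume "y \<in> C (Suc k)"
      then show "y \<in> C k" using le unfolding C_def Int_iff mem_Collect_eq by linarith
    qed
  qed
  have "(\<Inter>k. C k) = ball x \<delta> \<inter> K"
  proof (intro equalityI subsetI)
    fix y assume y: "y \<in> (\<Inter>k. C k)"
    have "infdist y K \<le> inverse (real (Suc k))" for k using y by (auto simp: C_def)
    then have "infdist y K \<le> 0"
      using LIMSEQ_le_const[OF LIMSEQ_inverse_real_of_nat] by blast
    then have "infdist y K = 0" using infdist_nonneg[of y K] by linarith
    then have "y \<in> K" using K x by (subst in_closed_iff_infdist_zero) auto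
    moreover have "y \<in> ball x \<delta>" using y by (auto simp: C_def)
    ultimately show "y \<in> ball x \<delta> \<inter> K" by blast
  qed (auto simp: C_def)
  moreover have "(\<lambda>k. measure arc_length (C k)) \<longlonglongrightarrow> measure arc_length (\<Inter>k. C k)"
    using Cb by (intro finite_Lim_measure_decseq dec) (simp add: image_subset_iff)
  ultimately have "(\<lambda>k. measure arc_length (C k)) \<longlonglongrightarrow> measure arc_length (ball x \<delta> \<inter> K)" by simp
  then show "\<tau> * \<delta> \<le> measure arc_length (ball x \<delta> \<inter> K)"
    by (rule tendsto_lowerbound[OF _ always_eventually trivial_limit_sequentially]) (intro allI low)
qed

section \<open>Isolated points and connected subsets of the limit set\<close>

lemma measure_arc_length_singleton: "measure arc_length {x} = 0"
proof -
  have "{\<theta>\<in>{0..<2 * pi}. cis \<theta> \<in> {x}} \<subseteq> {Arg2pi x}"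
  proof
    fix \<theta> assume "\<theta> \<in> {\<theta>\<in>{0..<2 * pi}. cis \<theta> \<in> {x}}"
    then have "0 \<le> \<theta>" "\<theta> < 2 * pi" "of_real 1 * exp (\<i> * of_real \<theta>) = x" by (simp_all add: cis_conv_exp)
    then have "Arg2pi x = \<theta>" by (intro Arg2pi_unique[of 1]) simp_all
    then show "\<theta> \<in> {Arg2pi x}" by simp
  qed
  then have "countable {\<theta>\<in>{0..<2 * pi}. cis \<theta> \<in> {x}}" by (rule countable_subset) simp
  then have "emeasure lborel {\<theta>\<in>{0..<2 * pi}. cis \<theta> \<in> {x}} = 0" by (rule emeasure_lborel_countable)
  then have "measure lborel {\<theta>\<in>{0..<2 * pi}. cis \<theta> \<in> {x}} = 0" by (simp only: measure_def enn2real_0)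
  moreover have "measure circle_lborel {\<theta>\<in>{0..<2 * pi}. cis \<theta> \<in> {x}} = measure lborel {\<theta>\<in>{0..<2 * pi}. cis \<theta> \<in> {x}}"
    by (rule measure_circle_lborel) blast
  ultimately show ?thesis by (subst measure_arc_length) simp_all
qed

text \<open>Single points have arc length 0, whereas homogeneity demands positive measure in every
  small ball.\<close>

lemma homogeneous_not_isolated:
  assumes hom: "homogeneous_upto \<delta>\<^sub>0 \<tau> K" and pos: "0 < \<delta>\<^sub>0" "0 < \<tau>"
  shows "\<not> x isolated_in K"
proof
  assume "x isolated_in K"
  then obtain T where T: "x \<in> K" "open T" "T \<inter> K = {x}" unfolding isolated_in_def by blast
  then obtain r where r: "0 < r" "ball x r \<subseteq> T" by (metis IntE insertI1 open_contains_ball)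
  define \<delta> where "\<delta> = min r \<delta>\<^sub>0"
  have "ball x \<delta> \<inter> K = {x}" using T r pos by (auto simp: \<delta>_def)
  moreover have "\<tau> * \<delta> \<le> measure arc_length (ball x \<delta> \<inter> K)"
    using hom T(1) r(1) pos unfolding homogeneous_upto_def by (simp add: \<delta>_def)
  ultimately have "\<tau> * \<delta> \<le> 0" by (simp add: measure_arc_length_singleton)
  then show False using pos r(1) by (simp add: \<delta>_def mult_le_0_iff)
qed

text \<open>Cutting the circle at a point outside \<open>K\<close> turns a connected subset of \<open>K\<close> into an interval.\<close>

lemma porous_totally_disconnected:
  assumes K: "K \<subseteq> sphere 0 1" and por: "\<And>e. 0 < e \<Longrightarrow> porous e K"
  shows "totally_disconnected K"
  unfolding totally_disconnected_def
proof (intro ballI set_eqI iffI)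
  fix x y assume x: "x \<in> K" and y: "y \<in> connected_component_set K x"
  show "y \<in> {x}"
  proof (rule ccontr)
    assume "y \<notin> {x}"
    then have ne: "y \<noteq> x" by simp
    obtain T where T: "connected T" "T \<subseteq> K" "x \<in> T" "y \<in> T" using y by (auto simp: connected_component_def)
    obtain w where w: "w \<in> sphere 0 1" "w \<notin> K" using por[of 1] K x unfolding porous_def by fastforce
    \<comment> \<open>The angle measured from the antipode of \<open>w\<close>, so that the branch
      cut of \<open>Arg\<close> falls on \<open>w\<close>.\<close>
    define k where "k z = Arg (- z / w)" for z
    have w1: "cmod w = 1" "w \<noteq> 0" using w(1) by auto
    have unit: "cmod (- z / w) = 1" if "cmod z = 1" for z using that w1 by (simp add: norm_divide)
    have cis_k: "cis (k z) = - z / w" if "cmod z = 1" for z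
    proof -
      have "- z / w \<noteq> 0" using unit[OF that] by (metis norm_zero zero_neq_one)
      then have "cis (k z) = sgn (- z / w)" unfolding k_def by (rule cis_Arg)
      then show ?thesis using unit[OF that] by (simp add: sgn_div_norm)
    qed
    have recov: "- w * cis (k z) = z" if "cmod z = 1" for z using cis_k[OF that] w1 by simp
    have T1: "cmod z = 1" "z \<noteq> w" if "z \<in> T" for z using that T(2) K w(2) by auto
    have kpi: "k z \<noteq> pi" if "z \<in> T" for z
    proof
      assume "k z = pi"
      then have "z = w" using recov[OF T1(1)[OF that]] by simp
      then show False using T1(2)[OF that] by simp
    qed
    have "continuous_on T k"
    proof (rule continuous_at_imp_continuous_on, rule ballI)
      fix z assume z: "z \<in> T"
      have "- z / w \<notin> \<real>\<^sub>\<le>\<^sub>0"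
      proof
        assume "- z / w \<in> \<real>\<^sub>\<le>\<^sub>0"
        then obtain r where r: "r \<le> 0" "- z / w = of_real r" by (rule nonpos_Reals_cases)
        then have "\<bar>r\<bar> = 1" using unit[OF T1(1)[OF z]] by (metis norm_of_real)
        then have "- z / w = -1" using r by simp
        then have "z = w" using w1 by (simp add: field_simps)
        then show False using T1(2)[OF z] by simp
      qed
      then have "isCont Arg (- z / w)" by (rule continuous_at_Arg)
      moreover have "isCont (\<lambda>z. - z / w) z" using w1 by (intro continuous_intros) auto
      ultimately show "isCont k z" unfolding k_def by (rule isCont_o2[rotated])
    qed
    then have conn: "connected (k ` T)" using T(1) by (rule connected_continuous_image)
    have kne: "k x \<noteq> k y" using recov T1 T(3,4) ne by metis
    define a b where "a = min (k x) (k y)" and "b = max (k x) (k y)"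
    have ab: "a < b" "a \<in> k ` T" "b \<in> k ` T" using kne T(3,4) by (auto simp: a_def b_def min_def max_def)
    have sub: "{a..b} \<subseteq> k ` T" using conn ab by (intro connected_contains_Icc)
    have Argb: "- pi < k z" "k z \<le> pi" for z unfolding k_def using Arg_bounded[of "- z / w"] by auto
    have arc: "- w * cis s \<in> K" if "a \<le> s" "s \<le> b" for s
    proof -
      have "s \<in> k ` T" using sub that by (meson atLeastAtMost_iff subsetD)
      then obtain z where z: "z \<in> T" "s = k z" by blast
      have "- w * cis s = z" unfolding z(2) by (rule recov[OF T1(1)[OF z(1)]])
      then show ?thesis using T(2) z(1) by (simp only: subsetD)
    qed
    \<comment> \<open>Porosity is applied at the midpoint: a missing point close to it still has its
      angle in \<open>{a..b}\<close>, contrary to \<open>arc\<close>.\<close>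
    define m where "m = (a + b) / 2"
    have abpi: "- pi < a" "b < pi" using Argb kpi T(3,4) by (auto simp: a_def b_def min_def max_def less_le)
    then have m: "a < m" "m < b" "- pi < m" "m < pi" using ab(1) by (auto simp: m_def)
    have Am: "Arg (cis m) = m" using m by (intro Arg_cis) auto
    have "cis m \<notin> \<real>\<^sub>\<le>\<^sub>0"
    proof
      assume "cis m \<in> \<real>\<^sub>\<le>\<^sub>0"
      then obtain r where r: "r \<le> 0" "cis m = of_real r" by (rule nonpos_Reals_cases)
      then have "\<bar>r\<bar> = 1" by (metis norm_cis norm_of_real)
      then have "cis m = cis pi" using r by (simp add: abs_if split: if_splits)
      then have "m = pi" using Am Arg_cis[of pi] by simp
      then show False using m by simp
    qed
    then have "isCont Arg (cis m)" by (rule continuous_at_Arg)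
    then obtain e where e: "0 < e" "\<And>u. dist u (cis m) < e \<Longrightarrow> dist (Arg u) (Arg (cis m)) < (b - a) / 2"
      unfolding continuous_at_eps_delta using ab(1) by (metis diff_gt_0_iff_gt half_gt_zero)
    have "- w * cis m \<in> sphere 0 1" using w1 by (simp add: norm_mult)
    then obtain v where v: "v \<in> sphere 0 1" "dist (- w * cis m) v < e" "v \<notin> K"
      using por[OF e(1)] unfolding porous_def by blast
    have "- v / w - cis m = (- w * cis m - v) / w" using w1 by (simp add: field_simps)
    then have "dist (- v / w) (cis m) < e" using v(2) w1 by (simp add: dist_norm norm_divide)
    then have "dist (k v) m < (b - a) / 2" using e(2) Am unfolding k_def by metis
    then have "a \<le> k v" "k v \<le> b" by (auto simp: dist_real_def m_def abs_if field_simps split: if_splits)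
    then have "- w * cis (k v) \<in> K" by (rule arc)
    then show False using recov[of v] v(1,3) by simp
  qed
qed (auto simp: connected_component_refl)

section \<open>Spectra of sampled coefficients\<close>

definition periodic_sampling ::
    "'a::topological_ab_group_add \<Rightarrow> ('a \<Rightarrow>\<^sub>C complex) \<Rightarrow> nat \<Rightarrow> ('a \<Rightarrow> int) \<Rightarrow> (int \<Rightarrow> complex) \<Rightarrow> bool" where
  "periodic_sampling \<theta> g p c \<alpha> \<longleftrightarrow> cyclic_quotient \<theta> p c \<and> periodic_coeffs p \<alpha> \<and> (\<forall>x. apply_bcontfun g x = \<alpha> (c x))"

lemma periodic_sampling_coefficients:
  assumes "periodic_sampling \<theta> g p c \<alpha>"
  shows "sampled_coefficients \<theta> g \<omega> = (\<lambda>n. \<alpha> (n + c \<omega>))"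
proof
  fix n
  have "sampled_coefficients \<theta> g \<omega> n = \<alpha> ((n + c \<omega>) mod int p)"
    using assms by (simp add: sampled_coefficients_def periodic_sampling_def cyclic_quotient_def)
  also have "\<dots> = \<alpha> (n + c \<omega>)"
    using assms by (intro periodic_mod) (simp add: periodic_sampling_def periodic_coeffs_def)
  finally show "sampled_coefficients \<theta> g \<omega> n = \<alpha> (n + c \<omega>)" .
qed

text \<open>An odd shift exchanges the roles of the two families of blocks, so it does not simply
  relabel the operator; the discriminant is insensitive to it.\<close>

lemma cmv_spectrum_shift:
  assumes per: "periodic_coeffs p \<alpha>"
  shows "periodic_coeffs p (\<lambda>n. \<alpha> (n + k))" "cmv_spectrum (\<lambda>n. \<alpha> (n + k)) = cmv_spectrum \<alpha>"
proof -
  note perD = periodic_coeffsD[OF per]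
  have "\<alpha> (n + int p + k) = \<alpha> (n + k)" for n using perD(2)[rule_format, of "n + k"] by (simp add: algebra_simps)
  then show per': "periodic_coeffs p (\<lambda>n. \<alpha> (n + k))" using perD by (simp add: periodic_coeffs_def)
  have "disc (\<lambda>n. \<alpha> (n + k)) p \<theta> = disc \<alpha> p \<theta>" for \<theta>
  proof -
    have "transfer (cis (\<theta> / 2)) (\<lambda>n. \<alpha> (n + k)) 0 p = transfer (cis (\<theta> / 2)) \<alpha> k p"
      by (rule transfer_cong) (simp add: add.commute)
    then show ?thesis using discriminant_shift[OF perD(2,1), of "cis (\<theta> / 2)" k]
      by (simp add: disc_def discriminant_def)
  qed
  then have "cis \<theta> \<in> cmv_spectrum (\<lambda>n. \<alpha> (n + k)) \<longleftrightarrow> cis \<theta> \<in> cmv_spectrum \<alpha>" for \<theta>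
    by (simp add: cis_in_cmv_spectrum[OF per] cis_in_cmv_spectrum[OF per'])
  then show "cmv_spectrum (\<lambda>n. \<alpha> (n + k)) = cmv_spectrum \<alpha>"
    by (metis (no_types, lifting) cmv_spectrumE per per' subsetI subset_antisym)
qed

lemma cmv_spectrum_nonempty:
  assumes "periodic_coeffs p \<alpha>"
  shows "cmv_spectrum \<alpha> \<noteq> {}"
  using disc_nonempty[OF periodic_coeffsD(3,1)[OF assms]] cis_in_cmv_spectrum[OF assms] by blast

text \<open>Sampling \<open>g\<close> at \<omega> gives one of \<open>p\<close> shifts of \<alpha>,
  all with the same spectrum. The minimum over these shifts is a radius uniform in \<omega>.\<close>

lemma sampled_spectrum_nearby:
  assumes samp: "periodic_sampling \<theta> g p c \<alpha>" and \<eta>: "0 < \<eta>"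
  obtains d where "0 < d" "\<And>h \<omega>. (\<forall>x. cmod (apply_bcontfun h x) \<le> 1) \<Longrightarrow> dist h g \<le> d \<Longrightarrow>
    cmv_spectrum (sampled_coefficients \<theta> h \<omega>) \<subseteq> (\<Union>x\<in>cmv_spectrum \<alpha>. ball x \<eta>)"
proof -
  have per: "periodic_coeffs p \<alpha>" and c: "\<And>x. 0 \<le> c x \<and> c x < int p" and p: "0 < p"
    using samp by (auto simp: periodic_sampling_def cyclic_quotient_def)
  have "\<exists>d>0. \<forall>\<beta>. (\<forall>n. cmod (\<beta> n) \<le> 1) \<longrightarrow> (\<forall>n. cmod (\<beta> n - \<alpha> (n + k)) \<le> d) \<longrightarrow>
      cmv_spectrum \<beta> \<subseteq> (\<Union>x\<in>cmv_spectrum \<alpha>. ball x \<eta>)" for k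
    using approx_spectrum_upper_semicontinuous[OF periodic_coeffsD(4)[OF cmv_spectrum_shift(1)[OF per, of k]] \<eta>]
    unfolding cmv_spectrum_shift(2)[OF per] by metis
  then obtain D where D: "\<And>k. 0 < D k" "\<And>k \<beta>. (\<forall>n. cmod (\<beta> n) \<le> 1) \<Longrightarrow> (\<forall>n. cmod (\<beta> n - \<alpha> (n + k)) \<le> D k) \<Longrightarrow>
      cmv_spectrum \<beta> \<subseteq> (\<Union>x\<in>cmv_spectrum \<alpha>. ball x \<eta>)" by metis
  define d where "d = Min (D ` {0..<int p})"
  have d: "0 < d" "\<And>k. 0 \<le> k \<Longrightarrow> k < int p \<Longrightarrow> d \<le> D k" using D(1) p by (auto simp: d_def)
  show thesis
  proof (rule that[OF d(1)])
    fix h \<omega> assume h: "\<forall>x. cmod (apply_bcontfun h x) \<le> 1" "dist h g \<le> d"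
    show "cmv_spectrum (sampled_coefficients \<theta> h \<omega>) \<subseteq> (\<Union>x\<in>cmv_spectrum \<alpha>. ball x \<eta>)"
    proof (rule D(2)[of _ "c \<omega>"]; intro allI)
      fix n
      show "cmod (sampled_coefficients \<theta> h \<omega> n) \<le> 1" using h(1) by (simp add: sampled_coefficients_def)
      have "cmod (sampled_coefficients \<theta> h \<omega> n - \<alpha> (n + c \<omega>)) =
          dist (apply_bcontfun h (int_multiple n \<theta> + \<omega>)) (apply_bcontfun g (int_multiple n \<theta> + \<omega>))"
        using fun_cong[OF periodic_sampling_coefficients[OF samp, of \<omega>], of n]
        by (simp add: sampled_coefficients_def dist_norm)
      also have "\<dots> \<le> dist h g" by (rule dist_bounded)
      also have "\<dots> \<le> D (c \<omega>)" using h(2) d(2) c[of \<omega>] by force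
      finally show "cmod (sampled_coefficients \<theta> h \<omega> n - \<alpha> (n + c \<omega>)) \<le> D (c \<omega>)" .
    qed
  qed
qed

lemma locally_constant_continuous:
  assumes "locally_constant \<phi>"
  shows "continuous_on UNIV (\<lambda>x. f (\<phi> x) :: 'b::topological_space)"
  unfolding continuous_on_open_vimage[OF open_UNIV]
proof (intro allI impI)
  fix B :: "'b set" assume "open B"
  have "(\<lambda>x. f (\<phi> x)) -` B \<inter> UNIV = {x. f (\<phi> x) \<in> B}" by auto
  also have "open \<dots>" by (rule locally_constant_open_vimage[OF assms, of "\<lambda>z. f z \<in> B"])
  finally show "open ((\<lambda>x. f (\<phi> x)) -` B \<inter> UNIV)" .
qed

lemma periodic_sampling_exists:
  assumes c: "cyclic_quotient \<theta> p c" and per: "periodic_coeffs p \<alpha>"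
  obtains g where "periodic_sampling \<theta> g p c \<alpha>"
proof -
  have "(\<lambda>x. \<alpha> (c x)) \<in> bcontfun"
    using c per by (intro bcontfun_normI[where b = 1] locally_constant_continuous)
      (auto simp: cyclic_quotient_def periodic_coeffs_def less_imp_le)
  then obtain g where "(\<lambda>x. \<alpha> (c x)) = apply_bcontfun g" by (rule bcontfunE)
  then show thesis using that[of g] c per by (simp add: periodic_sampling_def fun_eq_iff)
qed

lemma periodic_sampling_dense:
  fixes g :: "'a::{topological_ab_group_add, t2_space} \<Rightarrow>\<^sub>C complex"
  assumes comp: "compact (UNIV :: 'a set)" and td: "totally_disconnected (UNIV :: 'a set)"
    and gen: "topological_generator \<theta>" and g: "g \<in> continuous_into_disk" and e: "0 < e"
  obtains g' p c \<alpha> where "periodic_sampling \<theta> g' p c \<alpha>" "dist g' g \<le> e"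
proof -
  have "continuous_on UNIV (apply_bcontfun g)" by simp
  from locally_constant_approx[OF comp td this e]
  obtain \<phi> where \<phi>: "locally_constant \<phi>" "\<And>x. dist (\<phi> x) (apply_bcontfun g x) < e" "range \<phi> \<subseteq> range (apply_bcontfun g)"
    by metis
  obtain p c \<beta> where c: "cyclic_quotient \<theta> p c" and \<beta>: "\<And>x. \<phi> x = \<beta> (c x)"
    using cyclic_quotient_exists[OF comp gen \<phi>(1)] by metis
  \<comment> \<open>The map \<beta> matters only on the residues \<open>{0..<int p}\<close>; this
    extends it periodically.\<close>
  define \<alpha> where "\<alpha> n = \<beta> (n mod int p)" for n
  have "cmod (\<alpha> n) < 1" for n
  proof -
    have "c (int_multiple n \<theta> + 0) = n mod int p" using c unfolding cyclic_quotient_def by (metis add.right_neutral)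
    then have "\<alpha> n = \<phi> (int_multiple n \<theta>)" by (simp add: \<alpha>_def \<beta>)
    then have "\<alpha> n \<in> range (apply_bcontfun g)" using \<phi>(3) by auto
    then show ?thesis using g by (auto simp: continuous_into_disk_def)
  qed
  then have per: "periodic_coeffs p \<alpha>" using c by (simp add: periodic_coeffs_def \<alpha>_def cyclic_quotient_def)
  obtain g' where g': "periodic_sampling \<theta> g' p c \<alpha>" using periodic_sampling_exists[OF c per] .
  have "apply_bcontfun g' x = \<phi> x" for x
    using g' c by (simp add: periodic_sampling_def \<alpha>_def \<beta> cyclic_quotient_def)
  then have "dist g' g \<le> e" using \<phi>(2) by (intro dist_bound) (simp add: less_imp_le)
  then show thesis using that g' by blast
qed

text \<open>Compactness leaves a positive distance to the unit circle, which is the room for all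
  perturbations together.\<close>

lemma bcontfun_bounded_below_one:
  fixes g :: "'a::topological_space \<Rightarrow>\<^sub>C complex"
  assumes comp: "compact (UNIV :: 'a set)" and g: "g \<in> continuous_into_disk"
  obtains r where "r < 1" "\<And>x. cmod (apply_bcontfun g x) \<le> r"
proof -
  have "continuous_on UNIV (\<lambda>x. cmod (apply_bcontfun g x))" by (intro continuous_intros) simp
  from continuous_attains_sup[OF comp _ this] obtain z where "\<And>x. cmod (apply_bcontfun g x) \<le> cmod (apply_bcontfun g z)" by auto
  then show thesis using that[of "cmod (apply_bcontfun g z)"] g by (auto simp: continuous_into_disk_def)
qed

section \<open>Density\<close>

text \<open>Halving the radii places the limit within \<open>d n\<close> of every
  \<open>f n\<close>, so whatever stage \<open>n\<close> guarantees within its radius holds for the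
  limit.\<close>

lemma bcontfun_limit:
  fixes f :: "nat \<Rightarrow> 'a::topological_space \<Rightarrow>\<^sub>C complex" and d :: "nat \<Rightarrow> real"
  assumes d: "\<And>n. 0 < d n" "\<And>n. d (Suc n) \<le> d n / 2" and f: "\<And>n. dist (f (Suc n)) (f n) \<le> d n / 2"
  obtains h where "\<And>n. dist h (f n) \<le> d n" "d \<longlonglongrightarrow> 0"
proof -
  \<comment> \<open>The subtracted \<open>d (n + k)\<close> is a reserve: each step spends half of
    it, and the next radius is at most the other half.\<close>
  have tel: "dist (f (n + k)) (f n) \<le> d n - d (n + k)" for n k
  proof (induction k)
    case (Suc k)
    have "dist (f (n + Suc k)) (f n) \<le> dist (f (Suc (n + k))) (f (n + k)) + dist (f (n + k)) (f n)"
      using dist_triangle[of "f (Suc (n + k))" "f n" "f (n + k)"] by simp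
    also have "\<dots> \<le> d (n + k) / 2 + (d n - d (n + k))" using f[of "n + k"] Suc by (rule add_mono)
    also have "\<dots> \<le> d n - d (n + Suc k)" using d(2)[of "n + k"] by simp
    finally show ?case .
  qed simp
  then have near: "dist (f m) (f n) \<le> d n" if "n \<le> m" for m n
    using tel[of n "m - n"] d(1)[of m] that by simp
  have pow: "d n \<le> d 0 * (1 / 2) ^ n" for n
  proof (induction n)
    case (Suc n)
    then show ?case using d(2)[of n] by simp
  qed simp
  have "(\<lambda>n. d 0 * (1 / 2) ^ n) \<longlonglongrightarrow> d 0 * 0" by (intro tendsto_mult tendsto_const LIMSEQ_realpow_zero) auto
  then have lim: "(\<lambda>n. d 0 * (1 / 2) ^ n) \<longlonglongrightarrow> 0" by simp
  have d0: "d \<longlonglongrightarrow> 0"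
  proof (rule Lim_null_comparison[OF _ lim])
    show "\<forall>\<^sub>F n in sequentially. norm (d n) \<le> d 0 * (1 / 2) ^ n"
      using pow d(1) by (simp add: less_imp_le)
  qed
  have nearx: "dist (apply_bcontfun (f m) x) (apply_bcontfun (f n) x) \<le> d n" if "n \<le> m" for m n x
    using near[OF that] dist_bounded[of "f m" x "f n"] by linarith
  have "Cauchy (\<lambda>n. apply_bcontfun (f n) x)" for x
  proof (rule metric_CauchyI)
    fix e :: real assume "0 < e"
    then have "\<forall>\<^sub>F n in sequentially. d n < e / 2" using d0 by (intro order_tendstoD) auto
    then obtain N where N: "d N < e / 2" by (auto simp: eventually_sequentially)
    show "\<exists>M. \<forall>m\<ge>M. \<forall>n\<ge>M. dist (apply_bcontfun (f m) x) (apply_bcontfun (f n) x) < e"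
    proof (intro exI[of _ N] allI impI)
      fix m n assume mn: "N \<le> m" "N \<le> n"
      have a: "dist (apply_bcontfun (f m) x) (apply_bcontfun (f N) x) < e / 2"
        by (rule le_less_trans[OF nearx[OF mn(1)] N])
      have b: "dist (apply_bcontfun (f n) x) (apply_bcontfun (f N) x) < e / 2"
        by (rule le_less_trans[OF nearx[OF mn(2)] N])
      show "dist (apply_bcontfun (f m) x) (apply_bcontfun (f n) x) < e"
        by (rule dist_triangle_half_l[OF a b])
    qed
  qed
  then have "\<exists>l. (\<lambda>n. apply_bcontfun (f n) x) \<longlonglongrightarrow> l" for x
    unfolding convergent_def[symmetric] by (rule Cauchy_convergent)
  then obtain H where H: "\<And>x. (\<lambda>n. apply_bcontfun (f n) x) \<longlonglongrightarrow> H x" by metis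
  have Hn: "dist (H x) (apply_bcontfun (f n) x) \<le> d n" for x n
  proof (rule tendsto_upperbound[OF _ _ sequentially_bot])
    show "(\<lambda>m. dist (apply_bcontfun (f m) x) (apply_bcontfun (f n) x)) \<longlonglongrightarrow> dist (H x) (apply_bcontfun (f n) x)"
      by (intro tendsto_intros H)
    show "\<forall>\<^sub>F m in sequentially. dist (apply_bcontfun (f m) x) (apply_bcontfun (f n) x) \<le> d n"
      using nearx by (auto simp: eventually_sequentially)
  qed
  have "uniform_limit UNIV (\<lambda>n. apply_bcontfun (f n)) H sequentially"
  proof (rule uniform_limitI)
    fix e :: real assume "0 < e"
    then have "\<forall>\<^sub>F n in sequentially. d n < e" using d0 by (intro order_tendstoD) auto
    then show "\<forall>\<^sub>F n in sequentially. \<forall>x\<in>UNIV. dist (apply_bcontfun (f n) x) (H x) < e"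
    proof eventually_elim
      case (elim n)
      show ?case using le_less_trans[OF Hn elim] by (simp add: dist_commute)
    qed
  qed
  then have "continuous_on UNIV H" by (intro uniform_limit_theorem[of _ "\<lambda>n. apply_bcontfun (f n)"]) auto
  moreover have "cmod (H x) \<le> d 0 + norm (f 0)" for x
    using Hn[of x 0] norm_triangle_sub[of "H x" "apply_bcontfun (f 0) x"] norm_bounded[of "f 0" x] by (simp add: dist_norm)
  ultimately have "H \<in> bcontfun" by (rule bcontfun_normI)
  then obtain h where "H = apply_bcontfun h" by (rule bcontfunE)
  then have "dist h (f n) \<le> d n" for n using Hn by (intro dist_bound) simp
  then show thesis using that d0 by blast
qed

section \<open>The inductive construction\<close>

type_synonym 'a stage = "('a \<Rightarrow>\<^sub>C complex) \<times> nat \<times> ('a \<Rightarrow> int) \<times> (int \<Rightarrow> complex) \<times> real"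

text \<open>\<open>d\<close> is a radius within which the properties achieved at stage \<open>n\<close> survive all later perturbations;
  stage 0 makes no porosity claim.\<close>

definition valid_stage ::
    "'a::topological_ab_group_add \<Rightarrow> real \<Rightarrow> real \<Rightarrow> real \<Rightarrow> nat \<Rightarrow> 'a stage \<Rightarrow> bool" where
  "valid_stage \<theta> \<tau> \<delta>\<^sub>0 D n = (\<lambda>(g, p, c, \<alpha>, d). periodic_sampling \<theta> g p c \<alpha> \<and> 0 < d \<and> d \<le> D \<and>
     homogeneous_upto \<delta>\<^sub>0 (\<tau> + (1 - \<tau>) / real (Suc n)) (cmv_spectrum \<alpha>) \<and>
     (\<forall>h. (\<forall>x. cmod (apply_bcontfun h x) \<le> 1) \<longrightarrow> dist h g \<le> d \<longrightarrow>
       (\<forall>\<omega>. cmv_spectrum (sampled_coefficients \<theta> h \<omega>) \<subseteq> (\<Union>x\<in>cmv_spectrum \<alpha>. ball x (inverse (real (Suc n)))) \<and>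
         (0 < n \<longrightarrow> porous (inverse (real (Suc n))) (cmv_spectrum (sampled_coefficients \<theta> h \<omega>))))))"

text \<open>Both the move of the sampling function and the new radius are at most
  \<open>d / 2\<close>, so the new ball lies within the old one.\<close>

lemma valid_stage_step:
  fixes \<theta> :: "'a::{topological_ab_group_add, t2_space}"
  assumes comp: "compact (UNIV :: 'a set)" and td: "totally_disconnected (UNIV :: 'a set)"
    and inf: "infinite (UNIV :: 'a set)" and gen: "topological_generator \<theta>" and \<tau>: "0 < \<tau>" "\<tau> < 1"
    and st: "valid_stage \<theta> \<tau> \<delta>\<^sub>0 D n (g, p, c, \<alpha>, d)"
  obtains g' p' c' \<alpha>' d' where "valid_stage \<theta> \<tau> \<delta>\<^sub>0 D (Suc n) (g', p', c', \<alpha>', d')" "dist g' g \<le> d / 2" "d' \<le> d / 2"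
proof -
  have samp: "periodic_sampling \<theta> g p c \<alpha>" and d: "0 < d" "d \<le> D"
    and hom: "homogeneous_upto \<delta>\<^sub>0 (\<tau> + (1 - \<tau>) / real (Suc n)) (cmv_spectrum \<alpha>)"
    using st by (auto simp: valid_stage_def)
  have c: "cyclic_quotient \<theta> p c" and per: "periodic_coeffs p \<alpha>" and g: "\<And>x. apply_bcontfun g x = \<alpha> (c x)"
    using samp by (auto simp: periodic_sampling_def)
  define e where "e = inverse (real (Suc (Suc n)))"
  have e: "0 < e" by (simp add: e_def)
  have \<sigma>: "0 \<le> \<tau> + (1 - \<tau>) / real (Suc (Suc n))"
    "\<tau> + (1 - \<tau>) / real (Suc (Suc n)) < \<tau> + (1 - \<tau>) / real (Suc n)" "\<tau> + (1 - \<tau>) / real (Suc n) \<le> 1"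
  proof -
    show "0 \<le> \<tau> + (1 - \<tau>) / real (Suc (Suc n))" using \<tau> by (intro add_nonneg_nonneg divide_nonneg_nonneg) auto
    have "(1 - \<tau>) / real (Suc (Suc n)) < (1 - \<tau>) / real (Suc n)" using \<tau> by (intro divide_strict_left_mono) auto
    then show "\<tau> + (1 - \<tau>) / real (Suc (Suc n)) < \<tau> + (1 - \<tau>) / real (Suc n)" by simp
    have "(1 - \<tau>) / real (Suc n) \<le> (1 - \<tau>) / 1" using \<tau> by (intro divide_left_mono) auto
    then show "\<tau> + (1 - \<tau>) / real (Suc n) \<le> 1" by simp
  qed
  \<comment> \<open>Porosity at scale \<open>e / 2\<close> is requested because
    \<open>porous_stable\<close> doubles the scale.\<close>
  obtain m0 where m0: "\<And>m \<eta>. m0 \<le> m \<Longrightarrow> 0 < \<eta> \<Longrightarrow> \<exists>\<beta>. periodic_coeffs (m * p) \<beta> \<and> (\<forall>n. cmod (\<beta> n - \<alpha> n) \<le> \<eta>) \<and>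
     homogeneous_upto \<delta>\<^sub>0 (\<tau> + (1 - \<tau>) / real (Suc (Suc n))) (cmv_spectrum \<beta>) \<and> porous (e / 2) (cmv_spectrum \<beta>)"
    using periodic_step[OF per hom \<sigma>, of "e / 2"] e by (metis half_gt_zero)
  obtain m c' where m: "m0 \<le> m" and c': "cyclic_quotient \<theta> (m * p) c'" "\<And>x. c x = c' x mod int p"
    using cyclic_quotient_refine[OF comp td inf gen c] by metis
  obtain \<beta> where \<beta>: "periodic_coeffs (m * p) \<beta>" "\<And>n. cmod (\<beta> n - \<alpha> n) \<le> d / 2"
     "homogeneous_upto \<delta>\<^sub>0 (\<tau> + (1 - \<tau>) / real (Suc (Suc n))) (cmv_spectrum \<beta>)" "porous (e / 2) (cmv_spectrum \<beta>)"
    using m0[OF m, of "d / 2"] d(1) by auto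
  obtain g' where g': "periodic_sampling \<theta> g' (m * p) c' \<beta>" using periodic_sampling_exists[OF c'(1) \<beta>(1)] .
  have "dist g' g \<le> d / 2"
  proof (rule dist_bound)
    fix x
    have "apply_bcontfun g x = \<alpha> (c' x)"
      using periodic_mod[OF periodic_coeffsD(2)[OF per], of "c' x"] by (simp add: g c'(2))
    then show "dist (apply_bcontfun g' x) (apply_bcontfun g x) \<le> d / 2"
      using g' \<beta>(2) by (simp add: periodic_sampling_def dist_norm)
  qed
  obtain d1 where d1: "0 < d1" "\<And>h \<omega>. (\<forall>x. cmod (apply_bcontfun h x) \<le> 1) \<Longrightarrow> dist h g' \<le> d1 \<Longrightarrow>
    cmv_spectrum (sampled_coefficients \<theta> h \<omega>) \<subseteq> (\<Union>x\<in>cmv_spectrum \<beta>. ball x e)"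
    using sampled_spectrum_nearby[OF g' e] by metis
  have "closed (cmv_spectrum \<beta>)" by (rule closed_approx_spectrum[OF periodic_coeffsD(4)[OF \<beta>(1)]])
  then obtain \<eta> where \<eta>: "0 < \<eta>" "\<And>K'. K' \<subseteq> (\<Union>x\<in>cmv_spectrum \<beta>. ball x \<eta>) \<Longrightarrow> porous e K'"
    using porous_stable[of "cmv_spectrum \<beta>" "e / 2"] \<beta>(4) e by (metis half_gt_zero field_sum_of_halves mult_2)
  obtain d2 where d2: "0 < d2" "\<And>h \<omega>. (\<forall>x. cmod (apply_bcontfun h x) \<le> 1) \<Longrightarrow> dist h g' \<le> d2 \<Longrightarrow>
    cmv_spectrum (sampled_coefficients \<theta> h \<omega>) \<subseteq> (\<Union>x\<in>cmv_spectrum \<beta>. ball x \<eta>)"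
    using sampled_spectrum_nearby[OF g' \<eta>(1)] by metis
  define d' where "d' = min (d / 2) (min d1 d2)"
  have "valid_stage \<theta> \<tau> \<delta>\<^sub>0 D (Suc n) (g', m * p, c', \<beta>, d')"
    unfolding valid_stage_def prod.case e_def[symmetric]
  proof (intro conjI allI impI)
    show "0 < d'" "d' \<le> D" using d d1(1) d2(1) by (auto simp: d'_def)
    fix h \<omega> assume h: "\<forall>x. cmod (apply_bcontfun h x) \<le> 1" "dist h g' \<le> d'"
    have hd: "dist h g' \<le> d1" "dist h g' \<le> d2" using h(2) by (auto simp: d'_def)
    show "cmv_spectrum (sampled_coefficients \<theta> h \<omega>) \<subseteq> (\<Union>x\<in>cmv_spectrum \<beta>. ball x e)"
      by (rule d1(2)[OF h(1) hd(1)])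
    show "porous e (cmv_spectrum (sampled_coefficients \<theta> h \<omega>))"
      by (rule \<eta>(2)[OF d2(2)[OF h(1) hd(2)]])
  qed (use g' \<beta>(3) in auto)
  moreover have "d' \<le> d / 2" by (simp add: d'_def)
  ultimately show thesis using that \<open>dist g' g \<le> d / 2\<close> by blast
qed

theorem H_CMV_approximation:
  fixes \<theta> :: "'a::{topological_ab_group_add, t2_space}" and g :: "'a \<Rightarrow>\<^sub>C complex"
  assumes comp: "compact (UNIV :: 'a set)" and td: "totally_disconnected (UNIV :: 'a set)"
    and inf: "infinite (UNIV :: 'a set)" and gen: "topological_generator \<theta>" and \<tau>: "0 < \<tau>" "\<tau> < 1"
    and g: "g \<in> continuous_into_disk" and \<epsilon>: "0 < \<epsilon>"
  shows "\<exists>h\<in>H_CMV \<theta> \<tau>. dist h g \<le> \<epsilon>"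
proof -
  obtain r where r: "r < 1" "\<And>x. cmod (apply_bcontfun g x) \<le> r" using bcontfun_bounded_below_one[OF comp g] by metis
  \<comment> \<open>The limit will be within \<open>2 * D\<close> of \<open>g\<close>: this is at
    most \<epsilon>, and less than the distance \<open>1 - r\<close> to the unit circle.\<close>
  define D where "D = min (\<epsilon> / 2) ((1 - r) / 3)"
  have D: "0 < D" "D \<le> \<epsilon> / 2" "3 * D \<le> 1 - r" using \<epsilon> r(1) by (auto simp: D_def min_def)
  obtain g0 p0 c0 \<alpha>0 where samp0: "periodic_sampling \<theta> g0 p0 c0 \<alpha>0" "dist g0 g \<le> D"
    using periodic_sampling_dense[OF comp td gen g D(1)] by metis
  then have per0: "periodic_coeffs p0 \<alpha>0" by (simp add: periodic_sampling_def)
  obtain \<delta>\<^sub>0 where \<delta>\<^sub>0: "0 < \<delta>\<^sub>0" "homogeneous_upto \<delta>\<^sub>0 1 (cmv_spectrum \<alpha>0)" using periodic_homogeneous[OF per0] .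
  define P where "P = (\<lambda>n x. valid_stage \<theta> \<tau> \<delta>\<^sub>0 D n x \<and> (n = 0 \<longrightarrow> dist (fst x) g \<le> D))"
  define Q where "Q = (\<lambda>(g, p :: nat, c :: 'a \<Rightarrow> int, \<alpha> :: int \<Rightarrow> complex, d :: real)
    (g' :: 'a \<Rightarrow>\<^sub>C complex, p' :: nat, c' :: 'a \<Rightarrow> int, \<alpha>' :: int \<Rightarrow> complex, d'). dist g' g \<le> d / 2 \<and> d' \<le> d / 2)"
  have base: "\<exists>x. P 0 x"
  proof -
    obtain d1 where d1: "0 < d1" "\<And>h \<omega>. (\<forall>x. cmod (apply_bcontfun h x) \<le> 1) \<Longrightarrow> dist h g0 \<le> d1 \<Longrightarrow>
      cmv_spectrum (sampled_coefficients \<theta> h \<omega>) \<subseteq> (\<Union>x\<in>cmv_spectrum \<alpha>0. ball x 1)"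
      using sampled_spectrum_nearby[OF samp0(1), of 1] by (metis zero_less_one)
    have "P 0 (g0, p0, c0, \<alpha>0, min D d1)"
      unfolding P_def valid_stage_def prod.case using samp0 \<delta>\<^sub>0 D(1) d1 by simp
    then show ?thesis by blast
  qed
  have "\<exists>y. P (Suc n) y \<and> Q x y" if x: "P n x" for n x
  proof -
    obtain g1 p1 c1 \<alpha>1 d1 where x1: "x = (g1, p1, c1, \<alpha>1, d1)" by (metis prod_cases5)
    obtain g' p' c' \<alpha>' d' where "valid_stage \<theta> \<tau> \<delta>\<^sub>0 D (Suc n) (g', p', c', \<alpha>', d')" "dist g' g1 \<le> d1 / 2" "d' \<le> d1 / 2"
      using valid_stage_step[OF comp td inf gen \<tau>, of \<delta>\<^sub>0 D n g1 p1 c1 \<alpha>1 d1] x unfolding P_def x1 by metis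
    then show ?thesis by (intro exI[of _ "(g', p', c', \<alpha>', d')"]) (simp add: P_def Q_def x1)
  qed
  \<comment> \<open>Dependent choice; \<open>P\<close> also records that the initial stage is close
    to \<open>g\<close>.\<close>
  then obtain X where X: "\<And>n. P n (X n)" "\<And>n. Q (X n) (X (Suc n))"
    using dependent_nat_choice[of P "\<lambda>n. Q", OF base] by metis
  define f where "f n = fst (X n)" for n
  define \<alpha> where "\<alpha> n = fst (snd (snd (snd (X n))))" for n
  define d where "d n = snd (snd (snd (snd (X n))))" for n
  have Xn: "X n = (f n, fst (snd (X n)), fst (snd (snd (X n))), \<alpha> n, d n)" for n
    by (simp add: f_def \<alpha>_def d_def)
  have stage: "valid_stage \<theta> \<tau> \<delta>\<^sub>0 D n (f n, fst (snd (X n)), fst (snd (snd (X n))), \<alpha> n, d n)" for n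
    using X(1)[of n] unfolding P_def by (metis Xn)
  have f0: "dist (f 0) g \<le> D" using X(1)[of 0] by (simp add: P_def f_def)
  have step: "dist (f (Suc n)) (f n) \<le> d n / 2" "d (Suc n) \<le> d n / 2" for n
    using X(2)[of n] by (simp_all add: Q_def f_def d_def case_prod_beta)
  have samp: "periodic_sampling \<theta> (f n) (fst (snd (X n))) (fst (snd (snd (X n)))) (\<alpha> n)" and d: "0 < d n" "d n \<le> D"
    and hom: "homogeneous_upto \<delta>\<^sub>0 (\<tau> + (1 - \<tau>) / real (Suc n)) (cmv_spectrum (\<alpha> n))"
    and near: "\<And>h \<omega>. \<forall>x. cmod (apply_bcontfun h x) \<le> 1 \<Longrightarrow> dist h (f n) \<le> d n \<Longrightarrow>
      cmv_spectrum (sampled_coefficients \<theta> h \<omega>) \<subseteq> (\<Union>x\<in>cmv_spectrum (\<alpha> n). ball x (inverse (real (Suc n))))"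
    and por: "\<And>h \<omega>. \<forall>x. cmod (apply_bcontfun h x) \<le> 1 \<Longrightarrow> dist h (f n) \<le> d n \<Longrightarrow> 0 < n \<Longrightarrow>
      porous (inverse (real (Suc n))) (cmv_spectrum (sampled_coefficients \<theta> h \<omega>))" for n
    using stage[of n] unfolding valid_stage_def prod.case by blast+
  have per: "periodic_coeffs (fst (snd (X n))) (\<alpha> n)" for n using samp[of n] by (simp add: periodic_sampling_def)
  obtain h where h: "\<And>n. dist h (f n) \<le> d n" and d0: "d \<longlonglongrightarrow> 0"
    using bcontfun_limit[where d = d and f = f, OF d(1) step(2,1)] by metis
  have hg: "dist h g \<le> 2 * D" using h[of 0] d(2)[of 0] f0 dist_triangle[of h g "f 0"] by simp
  have h1: "cmod (apply_bcontfun h x) < 1" for x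
  proof -
    have "cmod (apply_bcontfun h x) \<le> cmod (apply_bcontfun g x) + dist h g"
      using dist_bounded[of h x g] norm_triangle_sub[of "apply_bcontfun h x" "apply_bcontfun g x"] by (simp add: dist_norm)
    then show ?thesis using r(2)[of x] hg D by simp
  qed
  then have h1': "\<forall>x. cmod (apply_bcontfun h x) \<le> 1" using less_imp_le by blast
  define K where "K \<omega> = cmv_spectrum (sampled_coefficients \<theta> h \<omega>)" for \<omega>
  have coeff: "\<forall>n. cmod (sampled_coefficients \<theta> h \<omega> n) \<le> 1" for \<omega> using h1' by (simp add: sampled_coefficients_def)
  have Kcl: "closed (K \<omega>)" for \<omega> unfolding K_def by (rule closed_approx_spectrum[OF coeff])
  have Kcirc: "K \<omega> \<subseteq> sphere 0 1" for \<omega> unfolding K_def by (rule approx_spectrum_circle[OF coeff])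
  have inv0: "\<forall>\<^sub>F n in sequentially. inverse (real (Suc n)) < \<eta>" if "0 < \<eta>" for \<eta>
    using LIMSEQ_inverse_real_of_nat that by (rule order_tendstoD)
  \<comment> \<open>Semicontinuity applied at the limit coefficients. Together with
    \<open>lower\<close>, which comes from the recorded radii, it says that the stage spectra
    converge to each \<open>K \<omega>\<close> in the Hausdorff sense.\<close>
  have upper: "\<forall>\<^sub>F n in sequentially. cmv_spectrum (\<alpha> n) \<subseteq> (\<Union>x\<in>K \<omega>. ball x \<eta>)" if \<eta>: "0 < \<eta>" for \<eta> \<omega>
  proof -
    obtain e where e: "0 < e" "\<And>\<beta>. \<forall>n. cmod (\<beta> n) \<le> 1 \<Longrightarrow> \<forall>n. cmod (\<beta> n - sampled_coefficients \<theta> h \<omega> n) \<le> e \<Longrightarrow>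
        cmv_spectrum \<beta> \<subseteq> (\<Union>x\<in>K \<omega>. ball x \<eta>)"
      using approx_spectrum_upper_semicontinuous[OF coeff[of \<omega>] \<eta>] unfolding K_def by metis
    have "\<forall>\<^sub>F n in sequentially. d n < e" using d0 e(1) by (rule order_tendstoD)
    then show ?thesis
    proof eventually_elim
      case (elim n)
      let ?\<beta> = "sampled_coefficients \<theta> (f n) \<omega>"
      define k where "k = fst (snd (snd (X n))) \<omega>"
      have \<beta>: "?\<beta> = (\<lambda>m. \<alpha> n (m + k))" unfolding k_def by (rule periodic_sampling_coefficients[OF samp])
      have "\<forall>m. cmod (?\<beta> m - sampled_coefficients \<theta> h \<omega> m) \<le> e"
      proof
        fix m
        have "cmod (?\<beta> m - sampled_coefficients \<theta> h \<omega> m) \<le> dist h (f n)"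
          using dist_bounded[of "f n" "int_multiple m \<theta> + \<omega>" h] by (simp add: sampled_coefficients_def dist_norm norm_minus_commute[of "f n"])
        then show "cmod (?\<beta> m - sampled_coefficients \<theta> h \<omega> m) \<le> e" using h[of n] elim by simp
      qed
      moreover have "\<forall>m. cmod (?\<beta> m) \<le> 1" unfolding \<beta> using periodic_coeffsD(4)[OF per] by blast
      ultimately have "cmv_spectrum ?\<beta> \<subseteq> (\<Union>x\<in>K \<omega>. ball x \<eta>)" using e(2) by blast
      then show ?case unfolding \<beta> cmv_spectrum_shift(2)[OF per] .
    qed
  qed
  have lower: "\<forall>\<^sub>F n in sequentially. K \<omega> \<subseteq> (\<Union>x\<in>cmv_spectrum (\<alpha> n). ball x \<eta>)" if \<eta>: "0 < \<eta>" for \<eta> \<omega>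
    using inv0[OF \<eta>]
  proof eventually_elim
    case (elim n)
    have "ball x (inverse (real (Suc n))) \<subseteq> ball x \<eta>" for x :: complex using elim by (intro subset_ball) simp
    then show ?case using near[OF h1' h[of n], of \<omega>] unfolding K_def by blast
  qed
  \<comment> \<open>Independence of \<omega>: both spectra are limits of the same sequence of stage
    spectra.\<close>
  have Ksub: "K \<omega> \<subseteq> K \<omega>'" for \<omega> \<omega>'
  proof
    fix x assume x: "x \<in> K \<omega>"
    have "\<exists>y\<in>K \<omega>'. dist y x < e" if e: "0 < e" for e
    proof -
      have "\<forall>\<^sub>F n in sequentially. K \<omega> \<subseteq> (\<Union>x\<in>cmv_spectrum (\<alpha> n). ball x (e / 2)) \<and>
          cmv_spectrum (\<alpha> n) \<subseteq> (\<Union>x\<in>K \<omega>'. ball x (e / 2))"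
        using e by (intro eventually_conj lower upper) auto
      then obtain n where n: "K \<omega> \<subseteq> (\<Union>x\<in>cmv_spectrum (\<alpha> n). ball x (e / 2))"
          "cmv_spectrum (\<alpha> n) \<subseteq> (\<Union>x\<in>K \<omega>'. ball x (e / 2))"
        using eventually_happens'[OF sequentially_bot] by blast
      obtain z where z: "z \<in> cmv_spectrum (\<alpha> n)" "dist z x < e / 2" using n(1) x by auto
      obtain y where y: "y \<in> K \<omega>'" "dist y z < e / 2" using n(2) z(1) by auto
      then show ?thesis using z(2) dist_triangle[of y x z] by (intro bexI[of _ y]) auto
    qed
    then have "x \<in> closure (K \<omega>')" by (simp add: closure_approachable)
    then show "x \<in> K \<omega>'" using Kcl by simp
  qed
  have Kconst: "K \<omega> = K 0" for \<omega> using Ksub by blast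
  have spec: "common_spectrum \<theta> h = K 0"
    unfolding common_spectrum_def
  proof (rule the_equality)
    show "\<forall>\<omega>. ell2_spectrum (cmv_operator (sampled_coefficients \<theta> h \<omega>)) = K 0"
      using cmv_spectrum_eq[OF coeff] Kconst by (simp add: K_def)
    fix S assume "\<forall>\<omega>. ell2_spectrum (cmv_operator (sampled_coefficients \<theta> h \<omega>)) = S"
    then show "S = K 0" using cmv_spectrum_eq[OF coeff[of 0]] by (simp add: K_def)
  qed
  have homK: "homogeneous_upto \<delta>\<^sub>0 \<tau> (K 0)"
  proof (rule homogeneous_limit[where S = "\<lambda>n. cmv_spectrum (\<alpha> n)"])
    show "homogeneous_upto \<delta>\<^sub>0 \<tau> (cmv_spectrum (\<alpha> n))" for n
      unfolding homogeneous_upto_def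
    proof (intro ballI allI impI)
      fix x \<delta> assume x: "x \<in> cmv_spectrum (\<alpha> n)" "0 < \<delta> \<and> \<delta> \<le> \<delta>\<^sub>0"
      have "\<tau> * \<delta> \<le> (\<tau> + (1 - \<tau>) / real (Suc n)) * \<delta>" using \<tau> x(2) by (intro mult_right_mono) auto
      also have "\<dots> \<le> measure arc_length (ball x \<delta> \<inter> cmv_spectrum (\<alpha> n))"
        using hom[of n] x unfolding homogeneous_upto_def by blast
      finally show "\<tau> * \<delta> \<le> measure arc_length (ball x \<delta> \<inter> cmv_spectrum (\<alpha> n))" .
    qed
    show "cmv_spectrum (\<alpha> n) \<in> sets borel" for n by (rule borel_cmv_spectrum[OF periodic_coeffsD(4)[OF per]])
  qed (use Kcl \<tau> upper lower in auto)
  have porK: "porous e (K 0)" if e: "0 < e" for e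
  proof -
    have "\<forall>\<^sub>F n in sequentially. inverse (real (Suc n)) < e \<and> 0 < n"
      using inv0[OF e] eventually_gt_at_top[of 0] by (rule eventually_conj)
    then obtain n where n: "inverse (real (Suc n)) < e" "0 < n" using eventually_happens'[OF sequentially_bot] by blast
    show ?thesis using por[OF h1' h n(2), of 0] n(1) unfolding porous_def K_def by (meson less_trans)
  qed
  have "K 0 \<noteq> {}"
  proof
    assume "K 0 = {}"
    moreover have "\<forall>\<^sub>F n in sequentially. cmv_spectrum (\<alpha> n) \<subseteq> (\<Union>x\<in>K 0. ball x 1)" by (rule upper) simp
    then obtain n where "cmv_spectrum (\<alpha> n) \<subseteq> (\<Union>x\<in>K 0. ball x 1)" using eventually_happens'[OF sequentially_bot] by blast
    ultimately show False using cmv_spectrum_nonempty[OF per[of n]] by simp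
  qed
  moreover have "compact (K 0)"
    using Kcl bounded_subset[OF compact_imp_bounded[OF compact_sphere] Kcirc] by (simp add: compact_eq_bounded_closed)
  ultimately have "Cantor_set (K 0)"
    unfolding Cantor_set_def using porous_totally_disconnected[OF Kcirc porK] homogeneous_not_isolated[OF homK \<delta>\<^sub>0(1) \<tau>(1)] by blast
  moreover have "homogeneous \<tau> (K 0)"
    unfolding homogeneous_def using Kcl Kcirc homK \<delta>\<^sub>0(1) unfolding homogeneous_upto_def by blast
  moreover have "h \<in> continuous_into_disk" using h1 by (simp add: continuous_into_disk_def)
  ultimately have "h \<in> H_CMV \<theta> \<tau>" by (simp add: H_CMV_def spec)
  then show ?thesis using hg D(2) by (intro bexI[of _ h]) auto
qed

theorem theorem1p6:
  fixes \<theta> :: "'a :: {topological_ab_group_add, t2_space}" and \<tau> :: real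
  assumes "compact (UNIV :: 'a set)"
    and "totally_disconnected (UNIV :: 'a set)"
    and "infinite (UNIV :: 'a set)"
    and "topological_generator \<theta>"
    and "0 < \<tau>" and "\<tau> < 1"
  shows "top_of_set (continuous_into_disk :: ('a \<Rightarrow>\<^sub>C complex) set) closure_of H_CMV \<theta> \<tau>
           = continuous_into_disk"
proof (intro equalityI subsetI)
  fix g assume "g \<in> top_of_set (continuous_into_disk :: ('a \<Rightarrow>\<^sub>C complex) set) closure_of H_CMV \<theta> \<tau>"
  then show "g \<in> continuous_into_disk" by (simp add: in_closure_of)
next
  fix g :: "'a \<Rightarrow>\<^sub>C complex" assume g: "g \<in> continuous_into_disk"
  show "g \<in> top_of_set continuous_into_disk closure_of H_CMV \<theta> \<tau>"
    unfolding in_closure_of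
  proof (intro conjI allI impI; (elim conjE)?)
    show "g \<in> topspace (top_of_set continuous_into_disk)" using g by simp
    fix T assume T: "g \<in> T" "openin (top_of_set continuous_into_disk) T"
    then obtain U where U: "open U" "T = continuous_into_disk \<inter> U" by (auto simp: openin_open)
    then obtain e where e: "0 < e" "ball g e \<subseteq> U" using T(1) open_contains_ball by blast
    obtain h where h: "h \<in> H_CMV \<theta> \<tau>" "dist h g \<le> e / 2"
      using H_CMV_approximation[OF assms g, of "e / 2"] e(1) by auto
    then have "h \<in> ball g e" using e(1) by (simp add: dist_commute)
    moreover have "h \<in> continuous_into_disk" using h(1) by (simp add: H_CMV_def)
    ultimately show "\<exists>y. y \<in> H_CMV \<theta> \<tau> \<and> y \<in> T" using h(1) U(2) e(2) by blast
  qed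
qed

end
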